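(* Let $(M,g)=(B\times_f F,\ g_B+f^2g_F)$ be a warped product manifold with $m_1=\dim B$, let $(\overline{M},\overline{g})=Q^k=SO_{k+2}/SO_kSO_2$ be the complex quadric, and let $\psi:(M,g)\to(\overline{M},\overline{g})$ be an isometric immersion. Assume that $(M,g)$ is a 2-dimensional totally geodesic submanifold of $(\overline{M},\overline{g})$ with $TM\subset V(A)$. Then $$m_1\cdot 2\ \le\ \frac{\triangle f}{f}\ \le\ m_1\cdot 2.$$
   Context: $(B,g_B)$ and $(F,g_F)$ are Riemannian manifolds (of positive dimension), $f:B\to\mathbb{R}^+$ is a smooth positive function (the warping function), and $B\times_f F$ is the product $B\times F$ with the metric $g=g_B+f^2g_F$; $f$ is also regarded as a function on $M$ via the projection to $B$. All dimensions of $M,B,F$ are real. The Laplacian is $\triangle f=\sum_i\big((\nabla_{v_i}v_i)f-v_i^2f\big)$ for a local orthonormal frame $\{v_i\}$ of $TM$, where $\nabla$ is the Levi-Civita connection of $M$ (note the sign). Totally geodesic means that the second fundamental form of the immersion vanishes identically. The complex quadric $Q^k$ (complex dimension $k$) carries its Kähler structure $J$ and real structures $A$ on its tangent spaces: $A$ is a self-adjoint involution ($A^2=\mathrm{id}$) with $AJ=-JA$ (the shape operator of $Q^k\subset\mathbb{C}P^{k+1}$ with respect to a unit normal vector). $V(A)=\{Z\in T_p\overline{M}\mid AZ=Z\}$, so $T_p\overline{M}=V(A)\oplus JV(A)$ orthogonally; $TM\subset V(A)$ means $T_pM\subset V(A)$ at each $p\in M$. The metric $\overline{g}$ is normalized so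 that the curvature tensor is $$\overline{R}(X,Y)Z=\overline{g}(Y,Z)X-\overline{g}(X,Z)Y+\overline{g}(JY,Z)JX-\overline{g}(JX,Z)JY-2\overline{g}(JX,Y)JZ$$ $$+\overline{g}(AY,Z)AX-\overline{g}(AX,Z)AY+\overline{g}(JAY,Z)JAX-\overline{g}(JAX,Z)JAY.$$
   Formalization: △f is taken to be the Laplacian of f on the base B, not on M as in the stated definition; with the Laplacian of M the claim is false, since then △f/f = 2 − |grad f|²/f², which is below 2 wherever grad f ≠ 0. *)

theory Defs
  imports "HOL-Analysis.Analysis"
begin

section \<open>Smooth maps between Euclidean spaces\<close>

primrec Ck_on ::
  "nat \<Rightarrow> 'a::euclidean_space set \<Rightarrow> ('a \<Rightarrow> 'b::real_normed_vector) \<Rightarrow> bool" where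
  "Ck_on 0 S u \<longleftrightarrow> continuous_on S u"
| "Ck_on (Suc n) S u \<longleftrightarrow> (\<forall>x\<in>S. u differentiable (at x)) \<and>
     (\<forall>v. Ck_on n S (\<lambda>x. frechet_derivative u (at x) v))"

text \<open>Only meaningful for open \<open>S\<close>.\<close>

definition smooth_on :: "'a::euclidean_space set \<Rightarrow> ('a \<Rightarrow> 'b::real_normed_vector) \<Rightarrow> bool" where
  "smooth_on S u \<longleftrightarrow> (\<forall>n. Ck_on n S u)"


section \<open>Riemannian manifolds\<close>

text \<open>
  A manifold is given by an indexed family of local parametrizations \<open>param M i\<close>, defined on
  open subsets \<open>cdom M i\<close> of the model space \<open>'b\<close>; its dimension is \<open>DIM('b)\<close>.
  A tangent vector at \<open>param M i x\<close> is represented by its coordinate vector in \<open>'b\<close> with respect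
  to \<open>param M i\<close>, and \<open>metric M i x v w\<close> is the inner product of the tangent vectors
  with coordinates \<open>v\<close> and \<open>w\<close>.  The atlas need not be maximal.
\<close>

record ('i, 'p, 'b) rmanifold =
  pts :: "'p set"
  idx :: "'i set"
  cdom :: "'i \<Rightarrow> 'b set"
  param :: "'i \<Rightarrow> 'b \<Rightarrow> 'p"
  metric :: "'i \<Rightarrow> 'b \<Rightarrow> 'b \<Rightarrow> 'b \<Rightarrow> real"

definition coord :: "('i, 'p, 'b) rmanifold \<Rightarrow> 'i \<Rightarrow> 'p \<Rightarrow> 'b" where
  "coord M i = inv_into (cdom M i) (param M i)"

definition cimage :: "('i, 'p, 'b) rmanifold \<Rightarrow> 'i \<Rightarrow> 'p set" where
  "cimage M i = param M i ` cdom M i"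

definition local_rep ::
  "('i, 'p, 'b) rmanifold \<Rightarrow> ('j, 'q, 'c) rmanifold \<Rightarrow> ('p \<Rightarrow> 'q) \<Rightarrow> 'i \<Rightarrow> 'j \<Rightarrow> 'b \<Rightarrow> 'c" where
  "local_rep M N \<psi> i j = coord N j \<circ> \<psi> \<circ> param M i"

definition riemannian_manifold ::
  "('i, 'p::{t2_space,second_countable_topology}, 'b::euclidean_space) rmanifold \<Rightarrow> bool" where
  "riemannian_manifold M \<longleftrightarrow>
     pts M = (\<Union>i\<in>idx M. cimage M i) \<and>
     (\<forall>i\<in>idx M. open (cdom M i) \<and> openin (top_of_set (pts M)) (cimage M i) \<and>
        homeomorphism (cdom M i) (cimage M i) (param M i) (coord M i)) \<and>
     (\<forall>i\<in>idx M. \<forall>j\<in>idx M.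
        smooth_on {x \<in> cdom M i. param M i x \<in> cimage M j} (local_rep M M id i j)) \<and>
     (\<forall>i\<in>idx M. \<forall>x\<in>cdom M i. bilinear (metric M i x) \<and>
        (\<forall>v w. metric M i x v w = metric M i x w v) \<and>
        (\<forall>v. v \<noteq> 0 \<longrightarrow> metric M i x v v > 0)) \<and>
     (\<forall>i\<in>idx M. \<forall>v w. smooth_on (cdom M i) (\<lambda>x. metric M i x v w)) \<and>
     (\<forall>i\<in>idx M. \<forall>j\<in>idx M. \<forall>x\<in>cdom M i. param M i x \<in> cimage M j \<longrightarrow>
        (\<forall>v w. metric M i x v w =
           metric M j (local_rep M M id i j x)
             (frechet_derivative (local_rep M M id i j) (at x) v)
             (frechet_derivative (local_rep M M id i j) (at x) w)))"

definition smooth_fun :: "('i, 'p, 'b::euclidean_space) rmanifold \<Rightarrow> ('p \<Rightarrow> real) \<Rightarrow> bool" where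
  "smooth_fun M u \<longleftrightarrow> (\<forall>i\<in>idx M. smooth_on (cdom M i) (u \<circ> param M i))"


section \<open>Levi-Civita connection and Laplacian\<close>

text \<open>
  \<open>christoffel M i x v w\<close> is the covariant derivative at \<open>x\<close>, in the direction \<open>v\<close>, of the
  vector field with constant coordinates \<open>w\<close>.  It is determined by the Koszul formula,
  in which all brackets vanish.
\<close>

definition christoffel ::
  "('i, 'p, 'b::euclidean_space) rmanifold \<Rightarrow> 'i \<Rightarrow> 'b \<Rightarrow> 'b \<Rightarrow> 'b \<Rightarrow> 'b" where
  "christoffel M i x v w =
     (THE u. \<forall>z. 2 * metric M i x u z =
        frechet_derivative (\<lambda>y. metric M i y w z) (at x) v +
        frechet_derivative (\<lambda>y. metric M i y v z) (at x) w -
        frechet_derivative (\<lambda>y. metric M i y v w) (at x) z)"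

text \<open>Vector fields near \<open>x\<close> are given by their coordinates \<open>X, Y\<close> in the chart \<open>i\<close>.\<close>

definition levi_civita ::
  "('i, 'p, 'b::euclidean_space) rmanifold \<Rightarrow> 'i \<Rightarrow> ('b \<Rightarrow> 'b) \<Rightarrow> ('b \<Rightarrow> 'b) \<Rightarrow> 'b \<Rightarrow> 'b" where
  "levi_civita M i X Y x = frechet_derivative Y (at x) (X x) + christoffel M i x (X x) (Y x)"

definition vf_apply :: "('b::euclidean_space \<Rightarrow> 'b) \<Rightarrow> ('b \<Rightarrow> real) \<Rightarrow> 'b \<Rightarrow> real" where
  "vf_apply X u x = frechet_derivative u (at x) (X x)"

text \<open>A frame is indexed by the standard basis of the model space, so it has \<open>DIM('b)\<close> members.\<close>

definition local_orthonormal_frame ::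
  "('i, 'p, 'b::euclidean_space) rmanifold \<Rightarrow> 'i \<Rightarrow> 'b \<Rightarrow> ('b \<Rightarrow> 'b \<Rightarrow> 'b) \<Rightarrow> bool" where
  "local_orthonormal_frame M i x e \<longleftrightarrow>
     (\<exists>W. open W \<and> x \<in> W \<and> W \<subseteq> cdom M i \<and>
        (\<forall>b\<in>Basis. smooth_on W (e b)) \<and>
        (\<forall>y\<in>W. \<forall>b\<in>Basis. \<forall>c\<in>Basis.
           metric M i y (e b y) (e c y) = (if b = c then 1 else 0)))"

definition frame_laplacian ::
  "('i, 'p, 'b::euclidean_space) rmanifold \<Rightarrow> 'i \<Rightarrow> ('b \<Rightarrow> 'b \<Rightarrow> 'b) \<Rightarrow> ('b \<Rightarrow> real) \<Rightarrow> 'b \<Rightarrow> real" where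
  "frame_laplacian M i e u x =
     (\<Sum>b\<in>Basis. vf_apply (levi_civita M i (e b) (e b)) u x
               - vf_apply (e b) (vf_apply (e b) u) x)"

text \<open>
  The Laplacian with the sign \<open>\<Sum> (\<nabla>\<^sub>v v) u - v (v u)\<close>, i.e. minus the trace of the Hessian;
  the value does not depend on the chart or the frame.

  For a warping function \<open>f\<close> on \<open>B\<close>, \<open>\<triangle>f\<close> is the Laplacian \<open>laplacian B f\<close> of \<open>B\<close>, on which \<open>f\<close>
  lives.  Equivalently, the sum runs over the members of an adapted orthonormal frame of
  \<open>B \<times>\<^sub>f F\<close> that are tangent to \<open>B\<close>.  The Laplacian of \<open>f \<circ> fst\<close> on \<open>B \<times>\<^sub>f F\<close> is a different
  function: it equals \<open>\<triangle>f - dim F * |grad f|\<^sup>2 / f\<close>.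
\<close>

definition laplacian ::
  "('i, 'p, 'b::euclidean_space) rmanifold \<Rightarrow> ('p \<Rightarrow> real) \<Rightarrow> 'p \<Rightarrow> real" where
  "laplacian M u p =
     (THE L. \<exists>i x e. i \<in> idx M \<and> x \<in> cdom M i \<and> param M i x = p \<and>
        local_orthonormal_frame M i x e \<and> L = frame_laplacian M i e (u \<circ> param M i) x)"


section \<open>Warped products\<close>

definition warped_product ::
  "('i, 'p, 'b) rmanifold \<Rightarrow> ('p \<Rightarrow> real) \<Rightarrow> ('j, 'q, 'c) rmanifold
     \<Rightarrow> ('i \<times> 'j, 'p \<times> 'q, 'b \<times> 'c) rmanifold" where
  "warped_product B f F =
     \<lparr> pts = pts B \<times> pts F,
       idx = idx B \<times> idx F,
       cdom = (\<lambda>(i, j). cdom B i \<times> cdom F j),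
       param = (\<lambda>(i, j) (x, y). (param B i x, param F j y)),
       metric = (\<lambda>(i, j) (x, y) (v, v') (w, w').
          metric B i x v w + (f (param B i x))\<^sup>2 * metric F j y v' w') \<rparr>"


section \<open>Isometric immersions and the second fundamental form\<close>

definition smooth_map ::
  "('i, 'p, 'b::euclidean_space) rmanifold \<Rightarrow> ('j, 'q, 'c::euclidean_space) rmanifold
     \<Rightarrow> ('p \<Rightarrow> 'q) \<Rightarrow> bool" where
  "smooth_map M N \<psi> \<longleftrightarrow>
     \<psi> ` pts M \<subseteq> pts N \<and>
     (\<forall>p\<in>pts M. \<exists>i\<in>idx M. \<exists>j\<in>idx N. \<exists>x W. param M i x = p \<and>
        open W \<and> x \<in> W \<and> W \<subseteq> cdom M i \<and> \<psi> ` param M i ` W \<subseteq> cimage N j \<and>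
        smooth_on W (local_rep M N \<psi> i j))"

definition isometric_immersion ::
  "('i, 'p, 'b::euclidean_space) rmanifold \<Rightarrow> ('j, 'q, 'c::euclidean_space) rmanifold
     \<Rightarrow> ('p \<Rightarrow> 'q) \<Rightarrow> bool" where
  "isometric_immersion M N \<psi> \<longleftrightarrow>
     smooth_map M N \<psi> \<and>
     (\<forall>i\<in>idx M. \<forall>j\<in>idx N. \<forall>x\<in>cdom M i. \<psi> (param M i x) \<in> cimage N j \<longrightarrow>
        inj (frechet_derivative (local_rep M N \<psi> i j) (at x)) \<and>
        (\<forall>v w. metric M i x v w =
           metric N j (local_rep M N \<psi> i j x)
             (frechet_derivative (local_rep M N \<psi> i j) (at x) v)
             (frechet_derivative (local_rep M N \<psi> i j) (at x) w)))"

text \<open>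
  Gauss formula: the covariant derivative in \<open>N\<close> of \<open>d\<psi> w\<close> in the direction \<open>d\<psi> v\<close>, minus \<open>d\<psi>\<close> of
  the covariant derivative in \<open>M\<close> of \<open>w\<close> in the direction \<open>v\<close>, for constant coordinate fields.
  The result is a tangent vector of \<open>N\<close> in the chart \<open>j\<close>.
\<close>

definition second_fundamental_form ::
  "('i, 'p, 'b::euclidean_space) rmanifold \<Rightarrow> ('j, 'q, 'c::euclidean_space) rmanifold
     \<Rightarrow> ('p \<Rightarrow> 'q) \<Rightarrow> 'i \<Rightarrow> 'j \<Rightarrow> 'b \<Rightarrow> 'b \<Rightarrow> 'b \<Rightarrow> 'c" where
  "second_fundamental_form M N \<psi> i j x v w =
     (let \<phi> = local_rep M N \<psi> i j; d = (\<lambda>y. frechet_derivative \<phi> (at y))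
      in frechet_derivative (\<lambda>y. d y w) (at x) v
           + christoffel N j (\<phi> x) (d x v) (d x w)
           - d x (christoffel M i x v w))"

definition totally_geodesic ::
  "('i, 'p, 'b::euclidean_space) rmanifold \<Rightarrow> ('j, 'q, 'c::euclidean_space) rmanifold
     \<Rightarrow> ('p \<Rightarrow> 'q) \<Rightarrow> bool" where
  "totally_geodesic M N \<psi> \<longleftrightarrow>
     (\<forall>i\<in>idx M. \<forall>j\<in>idx N. \<forall>x\<in>cdom M i. \<psi> (param M i x) \<in> cimage N j \<longrightarrow>
        (\<forall>v w. second_fundamental_form M N \<psi> i j x v w = 0))"

definition unit_normal ::
  "('i, 'p, 'b::euclidean_space) rmanifold \<Rightarrow> ('j, 'q, 'c::euclidean_space) rmanifold
     \<Rightarrow> ('p \<Rightarrow> 'q) \<Rightarrow> 'i \<Rightarrow> 'j \<Rightarrow> 'b \<Rightarrow> 'c \<Rightarrow> bool" where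
  "unit_normal M N \<psi> i j x \<xi> \<longleftrightarrow>
     metric N j (local_rep M N \<psi> i j x) \<xi> \<xi> = 1 \<and>
     (\<forall>v. metric N j (local_rep M N \<psi> i j x)
            (frechet_derivative (local_rep M N \<psi> i j) (at x) v) \<xi> = 0)"

definition shape_operator ::
  "('i, 'p, 'b::euclidean_space) rmanifold \<Rightarrow> ('j, 'q, 'c::euclidean_space) rmanifold
     \<Rightarrow> ('p \<Rightarrow> 'q) \<Rightarrow> 'i \<Rightarrow> 'j \<Rightarrow> 'b \<Rightarrow> 'c \<Rightarrow> 'b \<Rightarrow> 'b" where
  "shape_operator M N \<psi> i j x \<xi> v =
     (THE u. \<forall>w. metric M i x u w =
        metric N j (local_rep M N \<psi> i j x) (second_fundamental_form M N \<psi> i j x v w) \<xi>)"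


section \<open>The complex quadric\<close>

text \<open>
  An embedded submanifold \<open>S\<close>, of dimension \<open>DIM('b)\<close>, of a Euclidean space \<open>'e\<close>, with all its
  smooth local parametrizations, and with \<open>r\<close> times the metric induced from \<open>'e\<close>.
\<close>

definition embedded_submanifold ::
  "real \<Rightarrow> 'e::euclidean_space set
     \<Rightarrow> ('b set \<times> ('b \<Rightarrow> 'e), 'e, 'b::euclidean_space) rmanifold" where
  "embedded_submanifold r S =
     \<lparr> pts = S,
       idx = {(V, \<sigma>). open V \<and> smooth_on V \<sigma> \<and>
                (\<forall>x\<in>V. inj (frechet_derivative \<sigma> (at x))) \<and>
                openin (top_of_set S) (\<sigma> ` V) \<and>
                homeomorphism V (\<sigma> ` V) \<sigma> (inv_into V \<sigma>)},
       cdom = fst,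
       param = snd,
       metric = (\<lambda>(V, \<sigma>) x v w.
          r * (frechet_derivative \<sigma> (at x) v \<bullet> frechet_derivative \<sigma> (at x) w)) \<rparr>"

text \<open>
  The complex line spanned by a unit vector \<open>z\<close> is represented by the orthogonal projection
  \<open>z z\<^sup>*\<close> onto it.
\<close>

definition line_proj :: "complex ^ 'n \<Rightarrow> complex ^ 'n ^ 'n" where
  "line_proj z = (\<chi> a b. z $ a * cnj (z $ b))"

text \<open>
  \<open>\<complex>P\<^sup>k\<^sup>+\<^sup>1\<close> and \<open>Q\<^sup>k\<close> for \<open>k = CARD('k)\<close>: homogeneous coordinates lie in \<open>complex ^ ('k + 2)\<close>, where
  \<open>CARD('k + 2) = k + 2\<close>, and the model spaces \<open>complex ^ ('k + 1)\<close> and \<open>complex ^ 'k\<close> have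
  real dimensions \<open>2 (k + 1)\<close> and \<open>2 k\<close>.  If \<open>z\<close> is a unit vector and \<open>\<zeta>\<close> is (Hermitian) orthogonal
  to \<open>z\<close>, the tangent vector \<open>\<zeta> z\<^sup>* + z \<zeta>\<^sup>*\<close> has square norm \<open>2 |\<zeta>|\<^sup>2\<close> in the space of matrices; the
  factor \<open>1/2\<close> therefore gives the Fubini-Study metric that makes the Hopf fibration of the
  unit sphere a Riemannian submersion (holomorphic sectional curvature 4).  For the induced
  metric on \<open>Q\<^sup>k\<close> the shape operators of unit normals are involutions and the
  curvature tensor has the form
  \<open>R(X,Y)Z = g(Y,Z)X - g(X,Z)Y + g(JY,Z)JX - g(JX,Z)JY - 2g(JX,Y)JZ
     + g(AY,Z)AX - g(AX,Z)AY + g(JAY,Z)JAX - g(JAX,Z)JAY\<close>.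
\<close>

definition complex_projective_space ::
  "((complex ^ ('k + 1)) set \<times> (complex ^ ('k + 1) \<Rightarrow> complex ^ ('k + 2) ^ ('k + 2)),
    complex ^ ('k + 2) ^ ('k + 2), complex ^ ('k::finite + 1)) rmanifold" where
  "complex_projective_space = embedded_submanifold (1/2) {line_proj z |z. norm z = 1}"

definition complex_quadric ::
  "((complex ^ 'k) set \<times> (complex ^ 'k \<Rightarrow> complex ^ ('k + 2) ^ ('k + 2)),
    complex ^ ('k + 2) ^ ('k + 2), complex ^ ('k::finite)) rmanifold" where
  "complex_quadric =
     embedded_submanifold (1/2) {line_proj z |z. norm z = 1 \<and> (\<Sum>a\<in>UNIV. (z $ a)\<^sup>2) = 0}"

text \<open>
  The real structures of \<open>Q\<^sup>k\<close> on the tangent space at \<open>param complex_quadric i x\<close>: the shape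
  operators of \<open>Q\<^sup>k\<close> in \<open>\<complex>P\<^sup>k\<^sup>+\<^sup>1\<close> for the unit normal vectors at that point.
\<close>

definition real_structures ::
  "(complex ^ 'k) set \<times> (complex ^ 'k \<Rightarrow> complex ^ ('k + 2) ^ ('k + 2))
     \<Rightarrow> complex ^ 'k \<Rightarrow> (complex ^ 'k \<Rightarrow> complex ^ ('k::finite)) set" where
  "real_structures i x =
     {shape_operator complex_quadric complex_projective_space id i l x \<xi> | l \<xi>.
        l \<in> idx complex_projective_space \<and>
        param complex_quadric i x \<in> cimage complex_projective_space l \<and>
        unit_normal complex_quadric complex_projective_space id i l x \<xi>}"

definition V_of :: "('a \<Rightarrow> 'a) \<Rightarrow> 'a set" where
  "V_of A = {Z. A Z = Z}"

text \<open>
  \<open>TM \<subset> V(A)\<close>, pointwise: every \<open>d\<psi>(T\<^sub>pM)\<close> lies in \<open>V(A)\<close> for a real structure \<open>A\<close> at \<open>\<psi> p\<close>.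
\<close>

definition tangent_in_V ::
  "('i, 'p, 'b::euclidean_space) rmanifold \<Rightarrow>
     ('p \<Rightarrow> complex ^ ('k + 2) ^ ('k::finite + 2)) \<Rightarrow> bool" where
  "tangent_in_V M \<psi> \<longleftrightarrow>
     (\<forall>i\<in>idx M. \<forall>j\<in>idx complex_quadric. \<forall>x\<in>cdom M i.
        \<psi> (param M i x) \<in> cimage complex_quadric j \<longrightarrow>
        (\<exists>A\<in>real_structures j (local_rep M complex_quadric \<psi> i j x).
           range (frechet_derivative (local_rep M complex_quadric \<psi> i j) (at x)) \<subseteq> V_of A))"

end

theory Submission
  imports Defs
begin

text \<open>
  Regard the surface as a map \<open>\<Psi>\<close> into the Euclidean space of matrices.  Since \<open>M\<close> is totally
  geodesic in the quadric, the normal parts of the second derivatives of \<open>\<Psi>\<close> are values of the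
  second fundamental form of the quadric in the space of matrices, which is determined by
  differentiating \<open>P = P\<^sup>*\<close>, \<open>P P = P\<close> and \<open>P cnj P = 0\<close> twice.  A real structure acts on horizontal lifts as
  \<open>\<zeta> \<mapsto> - \<mu> cnj \<zeta>\<close> with \<open>|\<mu>| = 1\<close>, so \<open>TM \<subset> V(A)\<close> makes the lifts of tangent vectors real up to a
  common phase, and the Gauss equation gives the curvature \<open>2\<close>.  For \<open>dim B = dim F = 1\<close> the warped
  metric has curvature \<open>\<triangle>f / f\<close>, hence \<open>\<triangle>f = 2 f\<close>.
\<close>

section \<open>Calculus of directional derivatives\<close>

text \<open>Origin of the constant: for orthogonal tangent vectors \<open>X\<close>,
  \<open>Y\<close> of the surface, the normal parts of the second derivatives contribute
  \<open>3/2 - 1/2 = 1\<close> times \<open>(X \<bullet> X) * (Y \<bullet> Y)\<close> to the Gauss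
  equation in the space of matrices. The metric of the quadric is half the matrix inner product, so
  this product is 4 times the one formed with the metric, while the curvature term itself is halved:
  \<open>4 / 2 = 2\<close>.

  The real structures are definite descriptions formed in charts of projective space. To evaluate
  them, the inclusion of the quadric must be differentiated twice in such a chart, where it is given
  only as a continuous \<open>\<rho>\<close> with \<open>\<tau> (\<rho> y) = \<sigma> y\<close> for
  an immersion \<open>\<tau>\<close>. This is the reason for the results on maps that factor through
  an immersion.

  \<open>laplacian\<close> is a definite description as well, over all charts and orthonormal
  frames; evaluating it requires a frame and independence of the chart. The charts of
  \<open>B\<close> and \<open>F\<close> are arbitrary, not by arc length, so the metric of the
  surface is \<open>E dx^2 + f^2 G dy^2\<close> and derivatives of \<open>E\<close> enter.\<close>

abbreviation dd :: "'a::real_normed_vector \<Rightarrow> ('a \<Rightarrow> 'b::real_normed_vector) \<Rightarrow> 'a \<Rightarrow> 'b" where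
  "dd v u \<equiv> \<lambda>x. frechet_derivative u (at x) v"

lemma dd_eqI: "(u has_derivative u') (at x) \<Longrightarrow> dd v u x = u' v"
  by (metis frechet_derivative_at)

lemma dd_cong:
  assumes "open S" "x \<in> S" "\<And>y. y \<in> S \<Longrightarrow> u y = w y"
  shows "dd v u x = dd v w x"
proof -
  have "(u has_derivative d) (at x) \<longleftrightarrow> (w has_derivative d) (at x)" for d
    using assms has_derivative_transform_within_open[of u d x UNIV S w]
      has_derivative_transform_within_open[of w d x UNIV S u] by auto
  then show ?thesis
    by (simp add: frechet_derivative_def)
qed

lemma differentiable_cong_open:
  assumes "open S" "x \<in> S" "\<And>y. y \<in> S \<Longrightarrow> u y = w y" "u differentiable (at x)"
  shows "w differentiable (at x)"
  using assms has_derivative_transform_within_open[of u _ x UNIV S w] unfolding differentiable_def by auto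

lemma dd_add:
  "u differentiable (at x) \<Longrightarrow> dd (v + w) u x = dd v u x + dd w u x"
  by (simp add: linear_add linear_frechet_derivative)

lemma dd_scaleR:
  "u differentiable (at x) \<Longrightarrow> dd (c *\<^sub>R v) u x = c *\<^sub>R dd v u x"
  by (simp add: linear_cmul linear_frechet_derivative)

text \<open>Used where the direction varies with the point: it reduces such a derivative to
  derivatives in fixed directions, the only ones that \<open>Ck_on\<close> controls.\<close>

lemma dd_euclidean:
  fixes u :: "'a::euclidean_space \<Rightarrow> 'b::real_normed_vector"
  assumes "u differentiable (at x)"
  shows "dd v u x = (\<Sum>b\<in>Basis. (v \<bullet> b) *\<^sub>R dd b u x)"
proof -
  have L: "linear (\<lambda>v. dd v u x)"
    using linear_frechet_derivative[OF assms] by (simp add: eta_contract_eq)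
  have "dd v u x = dd (\<Sum>b\<in>Basis. (v \<bullet> b) *\<^sub>R b) u x"
    by (simp add: euclidean_representation)
  also have "\<dots> = (\<Sum>b\<in>Basis. (v \<bullet> b) *\<^sub>R dd b u x)"
    using linear_sum[OF L, of "\<lambda>b. (v \<bullet> b) *\<^sub>R b" Basis] linear_cmul[OF L]
    by simp
  finally show ?thesis .
qed

lemma dd_bilinear:
  assumes "bounded_bilinear \<beta>" "u differentiable (at x)" "w differentiable (at x)"
  shows "dd v (\<lambda>y. \<beta> (u y) (w y)) x = \<beta> (u x) (dd v w x) + \<beta> (dd v u x) (w x)"
proof -
  interpret bounded_bilinear \<beta> by fact
  from assms(2,3) show ?thesis
    by (intro dd_eqI) (auto simp: frechet_derivative_works intro: FDERIV)
qed

lemma differentiable_bilinear: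
  assumes "bounded_bilinear \<beta>" "u differentiable (at x)" "w differentiable (at x)"
  shows "(\<lambda>y. \<beta> (u y) (w y)) differentiable (at x)"
  using assms bounded_bilinear.FDERIV[OF assms(1)] unfolding differentiable_def by fast

lemma dd_linear:
  assumes "bounded_linear L" "u differentiable (at x)"
  shows "dd v (\<lambda>y. L (u y)) x = L (dd v u x)"
  using assms bounded_linear.has_derivative[OF assms(1)]
  by (intro dd_eqI) (auto simp: frechet_derivative_works)

lemma dd_sum:
  assumes "\<And>i. i \<in> I \<Longrightarrow> u i differentiable (at x)"
  shows "dd v (\<lambda>y. \<Sum>i\<in>I. u i y) x = (\<Sum>i\<in>I. dd v (u i) x)"
  using assms by (intro dd_eqI has_derivative_sum) (auto simp: frechet_derivative_works)

lemma dd_plus: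
  assumes "u differentiable (at x)" "w differentiable (at x)"
  shows "dd v (\<lambda>y. u y + w y) x = dd v u x + dd v w x"
  using assms by (intro dd_eqI has_derivative_add) (auto simp: frechet_derivative_works)

lemma dd_compose:
  assumes "\<phi> differentiable (at x)" "\<sigma> differentiable (at (\<phi> x))"
  shows "dd v (\<lambda>y. \<sigma> (\<phi> y)) x = dd (dd v \<phi> x) \<sigma> (\<phi> x)"
  using frechet_derivative_compose[OF assms] by (simp add: o_def fun_eq_iff)

section \<open>Closure properties of the classes \<open>Ck_on\<close>\<close>

lemma Ck_on_cong:
  assumes "open S"
  shows "Ck_on n S u \<Longrightarrow> (\<And>x. x \<in> S \<Longrightarrow> u x = w x) \<Longrightarrow> Ck_on n S w"
proof (induction n arbitrary: u w)
  case 0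
  then show ?case using continuous_on_cong by force
next
  case (Suc n)
  have "w differentiable (at x)" if "x \<in> S" for x
    using Suc.prems that differentiable_cong_open[OF assms that, of u w] by simp
  moreover have "Ck_on n S (dd v w)" for v
    using Suc.prems(1) by (rule_tac Suc.IH[of "dd v u"]) (auto intro: dd_cong[OF assms] Suc.prems(2))
  ultimately show ?case by simp
qed

lemma Ck_on_subset: "Ck_on n S u \<Longrightarrow> T \<subseteq> S \<Longrightarrow> Ck_on n T u"
  by (induction n arbitrary: u) (auto intro: continuous_on_subset)

lemma Ck_on_SucD: "Ck_on (Suc n) S u \<Longrightarrow> Ck_on n S u"
proof (induction n arbitrary: u)
  case 0
  then show ?case
    by (auto intro!: continuous_at_imp_continuous_on differentiable_imp_continuous_within)
next
  case (Suc n)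
  then show ?case by (metis Ck_on.simps(2))
qed

lemma Ck_on_const: "Ck_on n S (\<lambda>x. c)"
  by (induction n arbitrary: c) auto

lemma Ck_on_add:
  assumes "open S"
  shows "Ck_on n S u \<Longrightarrow> Ck_on n S w \<Longrightarrow> Ck_on n S (\<lambda>x. u x + w x)"
proof (induction n arbitrary: u w)
  case (Suc n)
  have "Ck_on n S (dd v (\<lambda>x. u x + w x))" for v
    by (rule Ck_on_cong[OF assms Suc.IH[of "dd v u" "dd v w"]])
      (use Suc.prems in \<open>auto simp: dd_plus\<close>)
  then show ?case using Suc.prems by auto
qed (auto intro: continuous_intros)

lemma Ck_on_sum:
  assumes "open S" "\<And>i. i \<in> I \<Longrightarrow> Ck_on n S (u i)"
  shows "Ck_on n S (\<lambda>x. \<Sum>i\<in>I. u i x)"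
  using assms(2) by (induction I rule: infinite_finite_induct) (auto intro: Ck_on_const Ck_on_add assms(1))

lemma Ck_on_linear:
  assumes "open S" "bounded_linear L"
  shows "Ck_on n S u \<Longrightarrow> Ck_on n S (\<lambda>x. L (u x))"
proof (induction n arbitrary: u)
  case 0
  then show ?case using bounded_linear.continuous_on[OF assms(2)] by simp
next
  case (Suc n)
  have "Ck_on n S (dd v (\<lambda>x. L (u x)))" for v
    by (rule Ck_on_cong[OF assms(1) Suc.IH[of "dd v u"]])
      (use Suc.prems in \<open>auto simp: dd_linear[OF assms(2)]\<close>)
  moreover have "(\<lambda>x. L (u x)) differentiable (at x)" if "x \<in> S" for x
    using Suc.prems that bounded_linear.has_derivative[OF assms(2)]
    unfolding Ck_on.simps differentiable_def by blast
  ultimately show ?case by auto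
qed

lemma Ck_on_bilinear:
  assumes "open S" "bounded_bilinear \<beta>"
  shows "Ck_on n S u \<Longrightarrow> Ck_on n S w \<Longrightarrow> Ck_on n S (\<lambda>x. \<beta> (u x) (w x))"
proof (induction n arbitrary: u w)
  case 0
  then show ?case using bounded_bilinear.continuous_on[OF assms(2)] by simp
next
  case (Suc n)
  have "Ck_on n S (dd v (\<lambda>x. \<beta> (u x) (w x)))" for v
    by (rule Ck_on_cong[OF assms(1) Ck_on_add[OF assms(1) Suc.IH[of u "dd v w"] Suc.IH[of "dd v u" w]]])
      (use Suc.prems Ck_on_SucD[OF Suc.prems(1)] Ck_on_SucD[OF Suc.prems(2)] in
        \<open>auto simp: dd_bilinear[OF assms(2)]\<close>)
  then show ?case
    using Suc.prems by (auto intro: differentiable_bilinear[OF assms(2)])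
qed

lemma Ck_on_compose:
  fixes \<phi> :: "'a::euclidean_space \<Rightarrow> 'b::euclidean_space"
    and \<sigma> :: "'b \<Rightarrow> 'c::real_normed_vector"
  assumes "open S"
  shows "Ck_on n T \<sigma> \<Longrightarrow> Ck_on n S \<phi> \<Longrightarrow> \<phi> ` S \<subseteq> T \<Longrightarrow> Ck_on n S (\<lambda>x. \<sigma> (\<phi> x))"
proof (induction n arbitrary: \<sigma>)
  case 0
  then show ?case by (simp add: continuous_on_compose2)
next
  case (Suc n)
  have diff: "\<phi> differentiable (at x)" "\<sigma> differentiable (at (\<phi> x))" if "x \<in> S" for x
    using Suc.prems that by auto
  have "Ck_on n S (dd v (\<lambda>x. \<sigma> (\<phi> x)))" for v
  proof (rule Ck_on_cong[OF assms])
    \<comment> \<open>The chain rule gives \<open>dd (dd v \<phi> x) \<sigma> (\<phi> x)\<close>,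
      whose direction moves with \<open>x\<close>. After expansion in a basis, the induction
      hypothesis applies to each \<open>dd b \<sigma>\<close>.\<close>
    show "Ck_on n S (\<lambda>x. \<Sum>b\<in>Basis. (dd v \<phi> x \<bullet> b) *\<^sub>R dd b \<sigma> (\<phi> x))"
    proof (rule Ck_on_sum[OF assms])
      fix b :: 'b
      have "Ck_on n S (\<lambda>x. dd v \<phi> x \<bullet> b)"
        using Suc.prems(2) by (intro Ck_on_linear[OF assms bounded_linear_inner_left]) auto
      moreover have "Ck_on n S (\<lambda>x. dd b \<sigma> (\<phi> x))"
        using Suc.prems by (intro Suc.IH[OF _ Ck_on_SucD]) auto
      ultimately show "Ck_on n S (\<lambda>x. (dd v \<phi> x \<bullet> b) *\<^sub>R dd b \<sigma> (\<phi> x))"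
        by (rule Ck_on_bilinear[OF assms bounded_bilinear_scaleR])
    qed
    fix x assume x: "x \<in> S"
    show "(\<Sum>b\<in>Basis. (dd v \<phi> x \<bullet> b) *\<^sub>R dd b \<sigma> (\<phi> x)) = dd v (\<lambda>x. \<sigma> (\<phi> x)) x"
      using dd_compose[OF diff[OF x], of v] dd_euclidean[OF diff(2)[OF x], of "dd v \<phi> x"]
      by (simp only:)
  qed
  moreover have "(\<lambda>x. \<sigma> (\<phi> x)) differentiable (at x)" if "x \<in> S" for x
    using diff[OF that] differentiable_chain_at[of \<phi> x \<sigma>] by (simp add: o_def)
  ultimately show ?case by simp
qed

text \<open>Serves to normalize a vector field by \<open>E powr (-1/2)\<close>. The exponent is
  generalized because each derivative lowers it by one.\<close>

lemma Ck_on_powr: "Ck_on n {0<..} (\<lambda>t::real. t powr a)"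
proof (induction n arbitrary: a)
  case 0
  then show ?case by (auto intro!: continuous_intros)
next
  case (Suc n)
  have D: "((\<lambda>t. t powr a) has_derivative (\<lambda>v. a * t powr (a - 1) * v)) (at t)" if "0 < t" for t :: real
    using has_real_derivative_powr[OF that, of a] by (simp add: has_field_derivative_def)
  have "Ck_on n {0<..} (dd v (\<lambda>t. t powr a))" for v :: real
    by (rule Ck_on_cong[OF open_greaterThan Ck_on_linear[OF open_greaterThan
          bounded_linear_mult_right[of "a * v"] Suc.IH[of "a - 1"]]])
      (simp add: dd_eqI[OF D])
  then show ?case
    using D by (auto simp: differentiable_def)
qed

lemma smooth_onD:
  assumes "smooth_on S u"
  shows "Ck_on n S u" "smooth_on S (dd v u)" "x \<in> S \<Longrightarrow> u differentiable (at x)" "continuous_on S u"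
proof -
  have C: "Ck_on m S u" for m using assms by (simp add: smooth_on_def)
  show "Ck_on n S u" by (rule C)
  show "smooth_on S (dd v u)"
    using C[of "Suc _"] by (simp add: smooth_on_def)
  show "x \<in> S \<Longrightarrow> u differentiable (at x)"
    using C[of "Suc 0"] by simp
  show "continuous_on S u"
    using C[of 0] by simp
qed

lemma smooth_on_subset: "smooth_on S u \<Longrightarrow> T \<subseteq> S \<Longrightarrow> smooth_on T u"
  by (auto simp: smooth_on_def intro: Ck_on_subset)

lemma smooth_on_compose:
  fixes \<phi> :: "'a::euclidean_space \<Rightarrow> 'b::euclidean_space"
  assumes "open S" "smooth_on T \<sigma>" "smooth_on S \<phi>" "\<phi> ` S \<subseteq> T"
  shows "smooth_on S (\<lambda>x. \<sigma> (\<phi> x))"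
  using assms by (auto simp: smooth_on_def intro: Ck_on_compose)

section \<open>Symmetry of second derivatives\<close>

text \<open>The mean value theorem is applied once in direction \<open>v\<close> and once in
  direction \<open>w\<close>. The left side is symmetric in \<open>v\<close> and \<open>w\<close>,
  the right side is tied to one order of differentiation; comparing both orders gives Schwarz's
  theorem.\<close>

lemma second_difference_mvt:
  fixes u :: "'a::euclidean_space \<Rightarrow> real"
  assumes "\<And>s t. s \<in> {0..h} \<Longrightarrow> t \<in> {0..h} \<Longrightarrow> x + s *\<^sub>R v + t *\<^sub>R w \<in> S"
    and "Ck_on (Suc (Suc 0)) S u" and "0 < h"
  obtains s t where "s \<in> {0..h}" "t \<in> {0..h}"
    "u (x + h *\<^sub>R v + h *\<^sub>R w) - u (x + h *\<^sub>R v) - u (x + h *\<^sub>R w) + u x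
      = h * h * dd w (dd v u) (x + s *\<^sub>R v + t *\<^sub>R w)"
proof -
  have du: "u differentiable (at y)" "dd v u differentiable (at y)" if "y \<in> S" for y
    using assms(2) that by auto
  have along: "((\<lambda>s. g (p + s *\<^sub>R d)) has_derivative (\<lambda>k. k *\<^sub>R dd d g (p + s *\<^sub>R d))) (at s within A)"
    if "g differentiable (at (p + s *\<^sub>R d))" for g :: "'a \<Rightarrow> real" and p d s A
  proof -
    have "((\<lambda>s. p + s *\<^sub>R d) has_derivative (\<lambda>k. k *\<^sub>R d)) (at s within A)"
      by (auto intro!: derivative_eq_intros)
    from has_derivative_compose[OF this, of g "frechet_derivative g (at (p + s *\<^sub>R d))"]
    show ?thesis
      using that by (simp add: frechet_derivative_works[symmetric] dd_scaleR)
  qed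
  have "\<exists>s\<in>{0<..<h}. (\<lambda>s. u ((x + h *\<^sub>R w) + s *\<^sub>R v) - u (x + s *\<^sub>R v)) h -
      (\<lambda>s. u ((x + h *\<^sub>R w) + s *\<^sub>R v) - u (x + s *\<^sub>R v)) 0
    = (\<lambda>k. k *\<^sub>R dd v u ((x + h *\<^sub>R w) + s *\<^sub>R v) - k *\<^sub>R dd v u (x + s *\<^sub>R v)) (h - 0)"
  proof (rule mvt_simple[OF assms(3)])
    fix s assume "0 \<le> s" "s \<le> h"
    then have "(x + h *\<^sub>R w) + s *\<^sub>R v \<in> S" "x + s *\<^sub>R v \<in> S"
      using assms(1)[of s h] assms(1)[of s 0] assms(3) by (auto simp: add_ac)
    then show "((\<lambda>s. u ((x + h *\<^sub>R w) + s *\<^sub>R v) - u (x + s *\<^sub>R v)) has_derivative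
      (\<lambda>k. k *\<^sub>R dd v u ((x + h *\<^sub>R w) + s *\<^sub>R v) - k *\<^sub>R dd v u (x + s *\<^sub>R v))) (at s within {0..h})"
      by (intro has_derivative_diff along[of u "x + h *\<^sub>R w"] along[of u x] du(1))
  qed
  then obtain s where s: "s \<in> {0<..<h}"
    "u (x + h *\<^sub>R v + h *\<^sub>R w) - u (x + h *\<^sub>R v) - u (x + h *\<^sub>R w) + u x
      = h * (dd v u (x + s *\<^sub>R v + h *\<^sub>R w) - dd v u (x + s *\<^sub>R v))"
    by (auto simp: right_diff_distrib add.assoc add.commute[of "h *\<^sub>R w"] add.commute[of "_ *\<^sub>R w" "_ *\<^sub>R v"])
  have "\<exists>t\<in>{0<..<h}. (\<lambda>t. dd v u ((x + s *\<^sub>R v) + t *\<^sub>R w)) h - (\<lambda>t. dd v u ((x + s *\<^sub>R v) + t *\<^sub>R w)) 0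
    = (\<lambda>k. k *\<^sub>R dd w (dd v u) ((x + s *\<^sub>R v) + t *\<^sub>R w)) (h - 0)"
  proof (rule mvt_simple[OF assms(3)])
    fix t assume "0 \<le> t" "t \<le> h"
    then show "((\<lambda>t. dd v u ((x + s *\<^sub>R v) + t *\<^sub>R w)) has_derivative
      (\<lambda>k. k *\<^sub>R dd w (dd v u) ((x + s *\<^sub>R v) + t *\<^sub>R w))) (at t within {0..h})"
      using s(1) by (intro along[of "dd v u" "x + s *\<^sub>R v" t w] du(2) assms(1)) auto
  qed
  then obtain t where t: "t \<in> {0<..<h}"
    "dd v u (x + s *\<^sub>R v + h *\<^sub>R w) - dd v u (x + s *\<^sub>R v) = h * dd w (dd v u) (x + s *\<^sub>R v + t *\<^sub>R w)"
    unfolding diff_zero real_scaleR_def scaleR_zero_left add_0_right by blast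
  show ?thesis
  proof (rule that)
    show "s \<in> {0..h}" "t \<in> {0..h}" using s(1) t(1) by auto
  qed (simp only: s(2) t(2) mult.assoc)
qed

lemma dd_commute_real:
  fixes u :: "'a::euclidean_space \<Rightarrow> real"
  assumes S: "open S" "x \<in> S" and u: "Ck_on (Suc (Suc 0)) S u"
  shows "dd v (dd w u) x = dd w (dd v u) x"
proof (rule ccontr)
  assume ne: "\<not> ?thesis"
  \<comment> \<open>Half the gap between the two mixed derivatives: intervals of radius
    \<open>e\<close> around them are disjoint.\<close>
  define e where "e = \<bar>dd v (dd w u) x - dd w (dd v u) x\<bar> / 2"
  have e: "e > 0" using ne by (simp add: e_def)
  have "continuous_on S (dd v (dd w u))" "continuous_on S (dd w (dd v u))"
    using u by auto
  then obtain r where r: "r > 0" "ball x r \<subseteq> S"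
    "\<And>y. dist y x < r \<Longrightarrow> dist (dd v (dd w u) y) (dd v (dd w u) x) < e"
    "\<And>y. dist y x < r \<Longrightarrow> dist (dd w (dd v u) y) (dd w (dd v u) x) < e"
  proof -
    assume *: "\<And>r. r > 0 \<Longrightarrow> ball x r \<subseteq> S \<Longrightarrow>
      (\<And>y. dist y x < r \<Longrightarrow> dist (dd v (dd w u) y) (dd v (dd w u) x) < e) \<Longrightarrow>
      (\<And>y. dist y x < r \<Longrightarrow> dist (dd w (dd v u) y) (dd w (dd v u) x) < e) \<Longrightarrow> thesis"
      and c: "continuous_on S (dd v (dd w u))" "continuous_on S (dd w (dd v u))"
    obtain r1 where 1: "r1 > 0" "ball x r1 \<subseteq> S" using S by (meson open_contains_ball)
    have "isCont (dd v (dd w u)) x" "isCont (dd w (dd v u)) x"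
      using c S by (simp_all add: continuous_on_eq_continuous_at)
    then obtain r2 r3 where "r2 > 0" "r3 > 0"
      "\<And>y. dist y x < r2 \<Longrightarrow> dist (dd v (dd w u) y) (dd v (dd w u) x) < e"
      "\<And>y. dist y x < r3 \<Longrightarrow> dist (dd w (dd v u) y) (dd w (dd v u) x) < e"
      using e unfolding continuous_at_eps_delta by metis
    with 1 show thesis by (intro *[of "min r1 (min r2 r3)"]) auto
  qed
  \<comment> \<open>Small enough for the whole parallelogram with sides \<open>h v\<close> and
    \<open>h w\<close> to stay within \<open>r / 2\<close> of \<open>x\<close>; the summand 1 keeps
    the denominator positive.\<close>
  define h where "h = r / (2 * (norm v + norm w + 1))"
  have h: "h > 0"
    using r(1) unfolding h_def by (intro divide_pos_pos) (auto intro: add_nonneg_pos)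
  have near: "dist (x + s *\<^sub>R v + t *\<^sub>R w) x < r" if "s \<in> {0..h}" "t \<in> {0..h}" for s t
  proof -
    have "dist (x + s *\<^sub>R v + t *\<^sub>R w) x = norm (s *\<^sub>R v + t *\<^sub>R w)"
      by (simp add: dist_norm algebra_simps)
    also have "\<dots> \<le> s * norm v + t * norm w"
      using that norm_triangle_ineq[of "s *\<^sub>R v" "t *\<^sub>R w"] by simp
    also have "\<dots> \<le> h * norm v + h * norm w"
      using that by (intro add_mono mult_right_mono) auto
    also have "\<dots> \<le> h * (norm v + norm w + 1)"
      using h by (simp add: algebra_simps)
    also have "\<dots> = r / 2"
      unfolding h_def using norm_ge_zero[of v] norm_ge_zero[of w] by (simp add: field_simps add_nonneg_eq_0_iff)
    also have "\<dots> < r" using r(1) by simp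
    finally show ?thesis .
  qed
  have inS: "x + s *\<^sub>R v + t *\<^sub>R w \<in> S" if "s \<in> {0..h}" "t \<in> {0..h}" for s t
    using near[OF that] r(2) by (auto simp: dist_commute)
  obtain s t where 1: "s \<in> {0..h}" "t \<in> {0..h}"
    "u (x + h *\<^sub>R v + h *\<^sub>R w) - u (x + h *\<^sub>R v) - u (x + h *\<^sub>R w) + u x
      = h * h * dd w (dd v u) (x + s *\<^sub>R v + t *\<^sub>R w)"
    using second_difference_mvt[OF inS u h] by blast
  have inS': "x + s *\<^sub>R w + t *\<^sub>R v \<in> S" if "s \<in> {0..h}" "t \<in> {0..h}" for s t
    using inS[OF that(2,1)] by (simp add: add_ac)
  obtain s' t' where 2: "s' \<in> {0..h}" "t' \<in> {0..h}"
    "u (x + h *\<^sub>R w + h *\<^sub>R v) - u (x + h *\<^sub>R w) - u (x + h *\<^sub>R v) + u x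
      = h * h * dd v (dd w u) (x + s' *\<^sub>R w + t' *\<^sub>R v)"
    using second_difference_mvt[OF inS' u h] by blast
  have "h * h * dd w (dd v u) (x + s *\<^sub>R v + t *\<^sub>R w) = h * h * dd v (dd w u) (x + t' *\<^sub>R v + s' *\<^sub>R w)"
    using 1(3) 2(3) by (simp add: algebra_simps)
  then have "dd w (dd v u) (x + s *\<^sub>R v + t *\<^sub>R w) = dd v (dd w u) (x + t' *\<^sub>R v + s' *\<^sub>R w)"
    using h by simp
  then show False
    using r(4)[OF near[OF 1(1,2)]] r(3)[OF near[OF 2(2,1)]] unfolding e_def dist_real_def
    by (simp add: abs_if split: if_splits)
qed

lemma dd_commute:
  fixes u :: "'a::euclidean_space \<Rightarrow> 'b::euclidean_space"
  assumes S: "open S" "x \<in> S" and u: "smooth_on S u"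
  shows "dd v (dd w u) x = dd w (dd v u) x"
proof (rule euclidean_eqI)
  fix b :: 'b
  have 1: "dd v (\<lambda>y. u y \<bullet> b) y = dd v u y \<bullet> b" if "y \<in> S" for v y
    using dd_linear[OF bounded_linear_inner_left] smooth_onD(3)[OF u that] by blast
  have 2: "dd v (dd w (\<lambda>y. u y \<bullet> b)) x = dd v (dd w u) x \<bullet> b" for v w
  proof -
    have "dd v (dd w (\<lambda>y. u y \<bullet> b)) x = dd v (\<lambda>y. dd w u y \<bullet> b) x"
      using 1 by (intro dd_cong[OF S]) auto
    also have "\<dots> = dd v (dd w u) x \<bullet> b"
      using dd_linear[OF bounded_linear_inner_left] smooth_onD(3)[OF smooth_onD(2)[OF u] S(2)] by blast
    finally show ?thesis .
  qed
  have "Ck_on (Suc (Suc 0)) S (\<lambda>y. u y \<bullet> b)"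
    by (intro Ck_on_linear[OF S(1) bounded_linear_inner_left] smooth_onD[OF u])
  from dd_commute_real[OF S this, of v w]
  show "dd v (dd w u) x \<bullet> b = dd w (dd v u) x \<bullet> b" by (simp add: 2)
qed

section \<open>Maps that factor through an immersion\<close>

text \<open>Riesz representation for the inner product pulled back along \<open>L\<close>: the Gram
  map \<open>adjoint L\<close> after \<open>L\<close> is injective, hence surjective. It resolves
  the definite descriptions in \<open>christoffel\<close> and \<open>shape_operator\<close>.\<close>

lemma ex1_inner_representation:
  fixes L :: "'b::euclidean_space \<Rightarrow> 'e::euclidean_space" and g :: "'b \<Rightarrow> real"
  assumes L: "linear L" "inj L" and g: "linear g" and r: "r \<noteq> 0"
  shows "\<exists>!u. \<forall>w. r * (L u \<bullet> L w) = g w"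
proof -
  have adj: "adjoint L (L u) \<bullet> w = L u \<bullet> L w" for u w
    by (metis adjoint_clauses(2) L(1))
  have lin: "linear (\<lambda>u. adjoint L (L u))"
    using linear_compose[OF L(1) adjoint_linear[OF L(1)]] by (simp add: o_def)
  have "inj (\<lambda>u. adjoint L (L u))"
    unfolding linear_injective_0[OF lin]
  proof (intro allI impI)
    fix u assume "adjoint L (L u) = 0"
    then have "L u \<bullet> L u = 0" using adj[of u u] by simp
    then show "u = 0" using L linear_injective_0 by auto
  qed
  then have sj: "surj (\<lambda>u. adjoint L (L u))"
    by (rule linear_injective_imp_surjective[OF lin _ refl])
  from surjD[OF sj, of "\<Sum>b\<in>Basis. (g b / r) *\<^sub>R b"]
  obtain u where u: "adjoint L (L u) = (\<Sum>b\<in>Basis. (g b / r) *\<^sub>R b)"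
    by auto
  have "r * (L u \<bullet> L w) = g w" for w
  proof -
    have gw: "g w = (\<Sum>b\<in>Basis. (w \<bullet> b) * g b)"
      using linear_sum[OF g, of "\<lambda>b. (w \<bullet> b) *\<^sub>R b" Basis] linear_cmul[OF g]
      by (simp add: euclidean_representation)
    show ?thesis
    proof -
      have "r * (L u \<bullet> L w) = r * (adjoint L (L u) \<bullet> w)" by (simp only: adj)
      also have "\<dots> = (\<Sum>b\<in>Basis. r * ((g b / r) * (b \<bullet> w)))"
        by (simp add: u inner_sum_left sum_distrib_left)
      also have "\<dots> = (\<Sum>b\<in>Basis. (w \<bullet> b) * g b)"
        using r by (intro sum.cong) (auto simp: inner_commute)
      finally show ?thesis using gw by simp
    qed
  qed
  moreover have "u = u'" if "\<forall>w. r * (L u \<bullet> L w) = g w" "\<forall>w. r * (L u' \<bullet> L w) = g w" for u u'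
  proof -
    have "L (u - u') \<bullet> L (u - u') = 0"
      using that r by (metis inner_diff_left linear_diff[OF L(1)] mult_cancel_left diff_self)
    then show ?thesis using L linear_injective_0[OF L(1)] by auto
  qed
  ultimately show ?thesis by blast
qed

text \<open>For a linear left inverse \<open>L\<close> of the derivative of \<open>\<tau>\<close>,
  the map \<open>L\<close> after \<open>\<tau>\<close> has derivative the identity at
  \<open>\<rho> x\<close>. Since \<open>L (\<tau> (\<rho> y)) = L (\<sigma> y)\<close>, the
  increment of \<open>\<rho>\<close> equals that of \<open>L\<close> after \<open>\<sigma>\<close>
  up to a relative error, which continuity of \<open>\<rho>\<close> makes small.\<close>

lemma differentiable_factor_through_immersion:
  fixes \<tau> :: "'b::euclidean_space \<Rightarrow> 'e::euclidean_space" and \<rho> :: "'a::euclidean_space \<Rightarrow> 'b"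
  assumes \<tau>: "\<tau> differentiable (at (\<rho> x))" "inj (frechet_derivative \<tau> (at (\<rho> x)))"
    and \<rho>: "isCont \<rho> x" and S: "open S" "x \<in> S" and eq: "\<And>y. y \<in> S \<Longrightarrow> \<tau> (\<rho> y) = \<sigma> y"
    and \<sigma>: "\<sigma> differentiable (at x)"
  shows "\<rho> differentiable (at x)"
proof -
  define \<tau>' where "\<tau>' = frechet_derivative \<tau> (at (\<rho> x))"
  obtain L where L: "linear L" "L \<circ> \<tau>' = id"
    using linear_injective_left_inverse \<tau> linear_frechet_derivative unfolding \<tau>'_def by metis
  have bL: "bounded_linear L" using L(1) linear_conv_bounded_linear by blast
  define G' where "G' = L \<circ> frechet_derivative \<sigma> (at x)"
  have D\<tau>: "((\<lambda>z. L (\<tau> z)) has_derivative (\<lambda>k. k)) (at (\<rho> x))"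
    using bounded_linear.has_derivative[OF bL \<tau>(1)[unfolded frechet_derivative_works]] L(2)
    by (simp add: \<tau>'_def o_def fun_eq_iff)
  have D\<sigma>: "((\<lambda>y. L (\<sigma> y)) has_derivative G') (at x)"
    using bounded_linear.has_derivative[OF bL \<sigma>[unfolded frechet_derivative_works]]
    by (simp add: G'_def o_def)
  have bG: "bounded_linear G'" using D\<sigma> has_derivative_bounded_linear by blast
  then obtain K where K: "K > 0" "\<And>h. norm (G' h) \<le> norm h * K"
    using bounded_linear.pos_bounded by blast
  have "(\<rho> has_derivative G') (at x)"
    unfolding has_derivative_at_alt
  proof (intro conjI bG allI impI)
    fix e :: real assume e: "0 < e"
    \<comment> \<open>The bound \<open>1/2\<close> allows the error term \<open>e1 * R\<close> to be
      absorbed; the other bound makes its final contribution at most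
      \<open>e / 2 * N\<close>.\<close>
    define e1 where "e1 = min (1/2) (e / (4 * (K + 1)))"
    have "2 * (K + 1) * e1 \<le> 2 * (K + 1) * (e / (4 * (K + 1)))"
      using K(1) by (intro mult_left_mono) (auto simp: e1_def)
    also have "\<dots> = e / 2" using K(1) by (simp add: divide_simps)
    finally have e1: "e1 > 0" "e1 \<le> 1/2" "2 * (K + 1) * e1 \<le> e / 2"
      using e K(1) unfolding e1_def by (auto intro: min.cobounded1 simp del: distrib_left_numeral)
    define e2 where "e2 = min 1 (e / 2)"
    have e2: "e2 > 0" "e2 \<le> 1" "e2 \<le> e / 2" using e by (auto simp: e2_def)
    obtain d1 where d1: "d1 > 0" "\<And>z. norm (z - \<rho> x) < d1 \<Longrightarrow>
        norm (L (\<tau> z) - L (\<tau> (\<rho> x)) - (z - \<rho> x)) \<le> e1 * norm (z - \<rho> x)"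
      using D\<tau> e1(1) unfolding has_derivative_at_alt by blast
    obtain d2 where d2: "d2 > 0" "\<And>y. norm (y - x) < d2 \<Longrightarrow>
        norm (L (\<sigma> y) - L (\<sigma> x) - G' (y - x)) \<le> e2 * norm (y - x)"
      using D\<sigma> e2(1) unfolding has_derivative_at_alt by blast
    obtain d3 where d3: "d3 > 0" "\<And>y. norm (y - x) < d3 \<Longrightarrow> norm (\<rho> y - \<rho> x) < d1"
      using \<rho> d1(1) unfolding continuous_at_eps_delta dist_norm by blast
    obtain d4 where d4: "d4 > 0" "ball x d4 \<subseteq> S" using S by (meson open_contains_ball)
    show "\<exists>d>0. \<forall>y. norm (y - x) < d \<longrightarrow> norm (\<rho> y - \<rho> x - G' (y - x)) \<le> e * norm (y - x)"
    proof (intro exI[of _ "min d2 (min d3 d4)"] conjI allI impI)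
      show "0 < min d2 (min d3 d4)" using d2 d3 d4 by simp
      fix y assume y: "norm (y - x) < min d2 (min d3 d4)"
      define R where "R = norm (\<rho> y - \<rho> x)"
      define N where "N = norm (y - x)"
      have "y \<in> S" using y d4(2) by (auto simp: dist_norm norm_minus_commute)
      then have eqs: "L (\<tau> (\<rho> y)) = L (\<sigma> y)" "L (\<tau> (\<rho> x)) = L (\<sigma> x)" using eq S by auto
      have 1: "norm (L (\<sigma> y) - L (\<sigma> x) - (\<rho> y - \<rho> x)) \<le> e1 * R"
        using d1(2)[of "\<rho> y"] d3(2)[of y] y eqs by (simp add: R_def)
      have 2: "norm (L (\<sigma> y) - L (\<sigma> x) - G' (y - x)) \<le> e2 * N"
        using d2(2)[of y] y by (simp add: N_def)
      have N: "N \<ge> 0" "R \<ge> 0" by (auto simp: N_def R_def)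
      have "norm (L (\<sigma> y) - L (\<sigma> x)) \<le> e2 * N + norm (G' (y - x))"
        using 2 norm_triangle_sub[of "L (\<sigma> y) - L (\<sigma> x)" "G' (y - x)"] by linarith
      also have "\<dots> \<le> 1 * N + N * K"
        using K(2)[of "y - x"] N e2(2) by (intro add_mono mult_right_mono) (auto simp: N_def)
      finally have 3: "norm (L (\<sigma> y) - L (\<sigma> x)) \<le> (K + 1) * N" by (simp add: algebra_simps)
      \<comment> \<open>\<open>R\<close> occurs on both sides; since \<open>e1 \<le> 1/2\<close>,
        half of it moves to the left, and \<open>\<rho>\<close> is seen to be Lipschitz at
        \<open>x\<close>.\<close>
      have "R \<le> norm (L (\<sigma> y) - L (\<sigma> x)) + e1 * R"
        using 1 norm_triangle_sub[of "\<rho> y - \<rho> x" "L (\<sigma> y) - L (\<sigma> x)"]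
        by (simp add: R_def norm_minus_commute)
      moreover have "e1 * R \<le> 1/2 * R" using e1 N by (intro mult_right_mono) auto
      ultimately have 4: "R \<le> 2 * ((K + 1) * N)" using 3 by simp
      have "norm (\<rho> y - \<rho> x - G' (y - x)) \<le> e1 * R + e2 * N"
        using 1 2 norm_triangle_ineq4[of "L (\<sigma> y) - L (\<sigma> x) - G' (y - x)" "L (\<sigma> y) - L (\<sigma> x) - (\<rho> y - \<rho> x)"]
        by (simp add: algebra_simps)
      also have "\<dots> \<le> e1 * (2 * ((K + 1) * N)) + e / 2 * N"
        using 4 e1 e2 N by (intro add_mono mult_left_mono mult_right_mono) auto
      also have "\<dots> \<le> e / 2 * N + e / 2 * N"
        using mult_right_mono[OF e1(3) N(1)] by (simp add: algebra_simps)
      finally show "norm (\<rho> y - \<rho> x - G' (y - x)) \<le> e * norm (y - x)"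
        by (simp add: N_def)
    qed
  qed
  then show ?thesis by (auto simp: differentiable_def)
qed

text \<open>\<open>T x\<close> is bounded below by some \<open>c > 0\<close>. Where
  \<open>T y\<close> differs from \<open>T x\<close> by less than \<open>c / 2\<close> in the bound
  \<open>\<eta>\<close>, the distance from \<open>u y\<close> to \<open>u x\<close> is controlled by
  the change \<open>\<delta>\<close> of \<open>T y (u y)\<close> and by \<open>\<eta>\<close>, which
  both tend to 0.\<close>

lemma continuous_factor_through_injections:
  fixes T :: "'a::t2_space \<Rightarrow> 'b::euclidean_space \<Rightarrow> 'e::euclidean_space"
  assumes lin: "\<And>y. y \<in> S \<Longrightarrow> linear (T y)" and inj: "inj (T x)"
    and cont: "\<And>b. b \<in> Basis \<Longrightarrow> isCont (\<lambda>y. T y b) x" "isCont (\<lambda>y. T y (u y)) x"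
    and S: "open S" "x \<in> S"
  shows "isCont u x"
proof -
  define \<eta> where "\<eta> y = (\<Sum>b\<in>Basis. norm (T y b - T x b))" for y
  define \<delta> where "\<delta> y = norm (T y (u y) - T x (u x))" for y
  obtain c where c: "c > 0" "\<And>w. norm w * c \<le> norm (T x w)"
    using linear_inj_bounded_below_pos[OF lin[OF S(2)] inj] by (metis mult.commute)
  have "((\<lambda>y. T y b) \<longlongrightarrow> T x b) (at x)" if "b \<in> Basis" for b
    using cont(1)[OF that] by (simp add: isCont_def)
  then have "(\<eta> \<longlongrightarrow> (\<Sum>b\<in>Basis. norm (T x b - T x b))) (at x)"
    unfolding \<eta>_def by (intro tendsto_intros) auto
  then have \<eta>0: "(\<eta> \<longlongrightarrow> 0) (at x)" by simp
  have "((\<lambda>y. T y (u y)) \<longlongrightarrow> T x (u x)) (at x)"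
    using cont(2) by (simp add: isCont_def)
  then have "(\<delta> \<longlongrightarrow> norm (T x (u x) - T x (u x))) (at x)"
    unfolding \<delta>_def by (intro tendsto_intros)
  then have \<delta>0: "(\<delta> \<longlongrightarrow> 0) (at x)" by simp
  have "((\<lambda>y. 2 / c * (\<delta> y + norm (u x) * \<eta> y)) \<longlongrightarrow> 2 / c * (0 + norm (u x) * 0)) (at x)"
    by (intro tendsto_intros \<eta>0 \<delta>0)
  then have lim: "((\<lambda>y. 2 / c * (\<delta> y + norm (u x) * \<eta> y)) \<longlongrightarrow> 0) (at x)" by simp
  have "eventually (\<lambda>y. \<eta> y < c / 2) (at x)"
    using order_tendstoD(2)[OF \<eta>0, of "c / 2"] c(1) by simp
  moreover have "eventually (\<lambda>y. y \<in> S) (at x)"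
    using S by (simp add: eventually_at_topological) blast
  ultimately have "eventually (\<lambda>y. norm (u y - u x) \<le> 2 / c * (\<delta> y + norm (u x) * \<eta> y)) (at x)"
  proof eventually_elim
    fix y assume y: "\<eta> y < c / 2" "y \<in> S"
    have bnd: "norm (T y w - T x w) \<le> norm w * \<eta> y" for w
    proof -
      have exp: "T z w = (\<Sum>b\<in>Basis. (w \<bullet> b) *\<^sub>R T z b)" if "z \<in> S" for z
        using linear_sum[OF lin[OF that], of "\<lambda>b. (w \<bullet> b) *\<^sub>R b" Basis] linear_cmul[OF lin[OF that]]
        by (simp add: euclidean_representation)
      have "T y w - T x w = (\<Sum>b\<in>Basis. (w \<bullet> b) *\<^sub>R (T y b - T x b))"
        using exp y(2) S(2) by (simp add: sum_subtractf scaleR_diff_right)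
      also have "norm \<dots> \<le> (\<Sum>b\<in>Basis. norm w * norm (T y b - T x b))"
        by (rule sum_norm_le) (simp add: Basis_le_norm mult_right_mono)
      finally show ?thesis by (simp add: \<eta>_def sum_distrib_left)
    qed
    define n where "n = norm (u y - u x)"
    have n: "n \<ge> 0" by (simp add: n_def)
    have "T x (u y - u x) = (T y (u y) - T x (u x)) - (T y (u y) - T x (u y))"
      using linear_diff[OF lin[OF S(2)]] by simp
    then have "norm (T x (u y - u x)) \<le> \<delta> y + norm (u y) * \<eta> y"
      using norm_triangle_ineq4[of "T y (u y) - T x (u x)" "T y (u y) - T x (u y)"] bnd[of "u y"]
      by (simp add: \<delta>_def)
    moreover have "norm (u y) * \<eta> y \<le> (norm (u x) + n) * \<eta> y"
      using norm_triangle_sub[of "u y" "u x"]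
      by (intro mult_right_mono) (auto simp: n_def \<eta>_def sum_nonneg)
    moreover have "n * \<eta> y \<le> n * (c / 2)" using y n by (intro mult_left_mono) auto
    ultimately have "n * c \<le> \<delta> y + norm (u x) * \<eta> y + n * (c / 2)"
      using c(2)[of "u y - u x"] by (simp add: n_def algebra_simps)
    then show "norm (u y - u x) \<le> 2 / c * (\<delta> y + norm (u x) * \<eta> y)"
      using c(1) by (simp add: n_def field_simps)
  qed
  from Lim_null_comparison[OF this lim] show ?thesis
    unfolding isCont_def by (simp add: LIM_zero_iff)
qed

text \<open>The second derivative comes from applying the first-order statement to the tangent map
  \<open>(z, k) \<mapsto> (\<tau> z, d\<tau>\<^sub>z k)\<close>, which is again an immersion.\<close>

lemma twice_differentiable_factor_through_immersion:
  fixes \<tau> :: "'b::euclidean_space \<Rightarrow> 'e::euclidean_space" and \<rho> :: "'a::euclidean_space \<Rightarrow> 'b"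
  assumes V: "open V" and \<tau>: "smooth_on V \<tau>" "\<And>z. z \<in> V \<Longrightarrow> inj (frechet_derivative \<tau> (at z))"
    and S: "open S" and \<rho>: "continuous_on S \<rho>" "\<rho> ` S \<subseteq> V"
    and eq: "\<And>y. y \<in> S \<Longrightarrow> \<tau> (\<rho> y) = \<sigma> y" and \<sigma>: "smooth_on S \<sigma>" and x: "x \<in> S"
  shows "\<rho> differentiable (at x)" "dd w \<rho> differentiable (at x)"
proof -
  have d\<tau>: "\<tau> differentiable (at z)" "dd v \<tau> differentiable (at z)" if "z \<in> V" for z v
    using smooth_onD[OF \<tau>(1)] smooth_onD(3)[OF smooth_onD(2)[OF \<tau>(1)]] that by auto
  have c\<rho>: "isCont \<rho> y" if "y \<in> S" for y
    using \<rho>(1) S that by (simp add: continuous_on_eq_continuous_at)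
  have d\<rho>: "\<rho> differentiable (at y)" if "y \<in> S" for y
    by (rule differentiable_factor_through_immersion[where \<tau>=\<tau> and \<sigma>=\<sigma> and S=S])
      (use that \<rho>(2) \<tau>(2) S eq smooth_onD(3)[OF \<sigma>] d\<tau> c\<rho> in auto)
  then show "\<rho> differentiable (at x)" using x by blast
  define u where "u = dd w \<rho>"
  have u: "dd (u y) \<tau> (\<rho> y) = dd w \<sigma> y" if "y \<in> S" for y
  proof -
    have "dd w \<sigma> y = dd w (\<lambda>y. \<tau> (\<rho> y)) y"
      using eq by (intro dd_cong[OF S that]) simp
    then show ?thesis
      using dd_compose[OF d\<rho>[OF that] d\<tau>(1), of w] \<rho>(2) that by (auto simp: u_def)
  qed
  have lin: "linear (frechet_derivative \<tau> (at (\<rho> y)))" if "y \<in> S" for y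
    using that \<rho>(2) d\<tau> linear_frechet_derivative by blast
  \<comment> \<open>The first-order statement requires a continuous factor, so continuity of
    \<open>u\<close> must be known before its differentiability. It comes from the injections
    \<open>d\<tau>\<close> at \<open>\<rho> y\<close>, which vary continuously.\<close>
  have cu: "isCont u x"
  proof (rule continuous_factor_through_injections[where S=S and T="\<lambda>y. frechet_derivative \<tau> (at (\<rho> y))"])
    show "inj (frechet_derivative \<tau> (at (\<rho> x)))" using \<tau>(2) \<rho>(2) x by auto
    show "isCont (\<lambda>y. frechet_derivative \<tau> (at (\<rho> y)) b) x" for b
      using isCont_o2[OF c\<rho>[OF x] differentiable_imp_continuous_within[OF d\<tau>(2)]] \<rho>(2) x by auto
    have "isCont (dd w \<sigma>) x"
      using smooth_onD(3)[OF smooth_onD(2)[OF \<sigma>]] x differentiable_imp_continuous_within by blast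
    then show "isCont (\<lambda>y. dd (u y) \<tau> (\<rho> y)) x"
      using u x S by (subst isCont_cong[of _ "dd w \<sigma>"]) (auto simp: eventually_nhds)
  qed (use lin S x in auto)
  \<comment> \<open>The fibre component is expanded in a basis because differentiability in
    \<open>z\<close> is known for derivatives in fixed directions. \<open>\<tau>2'\<close> is the
    derivative at \<open>(\<rho> x, u x)\<close> by the product rule.\<close>
  define \<tau>2 where "\<tau>2 = (\<lambda>(z, k). (\<tau> z, \<Sum>b\<in>Basis. (k \<bullet> b) *\<^sub>R dd b \<tau> z))"
  define \<tau>2' where "\<tau>2' = (\<lambda>(h, k). (dd h \<tau> (\<rho> x),
      \<Sum>b\<in>Basis. (u x \<bullet> b) *\<^sub>R dd h (dd b \<tau>) (\<rho> x) + (k \<bullet> b) *\<^sub>R dd b \<tau> (\<rho> x)))"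
  have \<rho>x: "\<rho> x \<in> V" using \<rho>(2) x by auto
  have D: "(\<tau>2 has_derivative \<tau>2') (at (\<rho> x, u x))"
  proof -
    have a: "((\<lambda>p. g (fst p)) has_derivative (\<lambda>p. dd (fst p) g (\<rho> x))) (at (\<rho> x, u x))"
      if "g differentiable (at (\<rho> x))" for g :: "'b \<Rightarrow> 'e"
      using has_derivative_compose[OF has_derivative_fst[OF has_derivative_ident, of "at (\<rho> x, u x)"], of g]
        that by (simp add: frechet_derivative_works)
    show ?thesis
      unfolding \<tau>2_def \<tau>2'_def case_prod_unfold
      by (intro has_derivative_Pair has_derivative_sum a d\<tau> \<rho>x
          has_derivative_eq_rhs[OF has_derivative_scaleR[OF has_derivative_inner_left[OF has_derivative_snd[OF has_derivative_ident]] a]])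
        auto
  qed
  \<comment> \<open>The derivative is block triangular with \<open>d\<tau>\<close> in both diagonal
    blocks: the first component forces \<open>h = 0\<close>, and then the second forces
    \<open>k = 0\<close>.\<close>
  have inj2: "inj \<tau>2'"
  proof -
    have "linear \<tau>2'" using D has_derivative_linear by blast
    then show ?thesis
      unfolding linear_injective_0[OF \<open>linear \<tau>2'\<close>]
    proof safe
      fix h k assume 0: "\<tau>2' (h, k) = 0"
      have i0: "dd a \<tau> (\<rho> x) = 0 \<Longrightarrow> a = 0" for a
        using \<tau>(2)[OF \<rho>x] linear_injective_0[OF lin[OF x]] by blast
      have h: "h = 0" using 0 i0 by (simp add: \<tau>2'_def zero_prod_def)
      then have "dd k \<tau> (\<rho> x) = 0"
        using 0 dd_euclidean[OF d\<tau>(1)[OF \<rho>x], of k] linear_0[OF linear_frechet_derivative[OF d\<tau>(2)[OF \<rho>x]]]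
        by (simp add: \<tau>2'_def zero_prod_def)
      with h i0 show "(h, k) = 0" by (simp add: zero_prod_def)
    qed
  qed
  have D2: "frechet_derivative \<tau>2 (at (\<rho> x, u x)) = \<tau>2'"
    using D frechet_derivative_at by metis
  have "(\<lambda>y. (\<rho> y, u y)) differentiable (at x)"
  proof (rule differentiable_factor_through_immersion[where \<tau>=\<tau>2 and \<sigma>="\<lambda>y. (\<sigma> y, dd w \<sigma> y)" and S=S])
    show "\<tau>2 differentiable (at (\<rho> x, u x))" using D by (auto simp: differentiable_def)
    show "inj (frechet_derivative \<tau>2 (at (\<rho> x, u x)))" using D2 inj2 by simp
    show "isCont (\<lambda>y. (\<rho> y, u y)) x" using c\<rho>[OF x] cu by (intro continuous_intros)
    show "\<tau>2 (\<rho> y, u y) = (\<sigma> y, dd w \<sigma> y)" if "y \<in> S" for y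
      using that eq u[OF that] dd_euclidean[OF d\<tau>(1), of "\<rho> y" "u y"] \<rho>(2) by (auto simp: \<tau>2_def)
    have "(\<sigma> has_derivative frechet_derivative \<sigma> (at x)) (at x)"
      "(dd w \<sigma> has_derivative frechet_derivative (dd w \<sigma>) (at x)) (at x)"
      using smooth_onD(3)[OF \<sigma> x] smooth_onD(3)[OF smooth_onD(2)[OF \<sigma>] x]
      by (simp_all add: frechet_derivative_works)
    then show "(\<lambda>y. (\<sigma> y, dd w \<sigma> y)) differentiable (at x)"
      unfolding differentiable_def using has_derivative_Pair by blast
  qed (use S x in auto)
  then show "dd w \<rho> differentiable (at x)"
    unfolding differentiable_def u_def using has_derivative_snd by fastforce
qed

section \<open>Linear algebra of rank-one projections\<close>

text \<open>Linear in the first and conjugate-linear in the second argument. Its real part is the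
  Euclidean inner product, so orthogonality with respect to \<open>\<bullet>\<close> is weaker than
  \<open>herm a b = 0\<close>; passing from one to the other is the point at which
  \<open>TM \<subset> V(A)\<close> enters.\<close>

definition herm :: "complex ^ 'n \<Rightarrow> complex ^ 'n \<Rightarrow> complex" where
  "herm a b = (\<Sum>i\<in>UNIV. a $ i * cnj (b $ i))"

definition vcnj :: "complex ^ 'n \<Rightarrow> complex ^ 'n" where
  "vcnj a = (\<chi> i. cnj (a $ i))"

definition outer :: "complex ^ 'n \<Rightarrow> complex ^ 'n \<Rightarrow> complex ^ 'n ^ 'n" where
  "outer a b = (\<chi> i j. a $ i * cnj (b $ j))"

definition mcnj :: "complex ^ 'n ^ 'm \<Rightarrow> complex ^ 'n ^ 'm" where
  "mcnj A = (\<chi> i j. cnj (A $ i $ j))"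

definition hermitian :: "complex ^ 'n ^ 'n \<Rightarrow> bool" where
  "hermitian A \<longleftrightarrow> (\<forall>i j. A $ i $ j = cnj (A $ j $ i))"

lemma hermitianD: "hermitian A \<Longrightarrow> A $ i $ j = cnj (A $ j $ i)"
  unfolding hermitian_def by blast

lemma herm_add_left: "herm (a + b) c = herm a c + herm b c"
  by (simp add: herm_def algebra_simps sum.distrib)

lemma herm_add_right: "herm a (b + c) = herm a b + herm a c"
  by (simp add: herm_def algebra_simps sum.distrib)

lemma herm_diff_left: "herm (a - b) c = herm a c - herm b c"
  by (simp add: herm_def algebra_simps sum_subtractf)

lemma herm_smult_left: "herm (k *s a) b = k * herm a b"
  by (simp add: herm_def sum_distrib_left mult.assoc)

lemma herm_smult_right: "herm a (k *s b) = cnj k * herm a b"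
  by (simp add: herm_def sum_distrib_left mult_ac)

lemma herm_scaleR_left: "herm (r *\<^sub>R a) b = of_real r * herm a b"
  by (simp add: herm_def sum_distrib_left scaleR_conv_of_real[where 'a=complex] mult.assoc)

lemma cnj_herm: "cnj (herm a b) = herm b a"
  by (simp add: herm_def mult.commute)

lemma Re_herm: "Re (herm a b) = a \<bullet> b"
  by (simp add: herm_def inner_vec_def inner_complex_def)

lemma herm_self: "herm a a = of_real (a \<bullet> a)"
proof -
  have "Im (herm a a) = 0" using cnj_herm[of a a] by (simp add: complex_eq_iff)
  then show ?thesis by (simp add: complex_eq_iff Re_herm)
qed

lemma vcnj_vcnj [simp]: "vcnj (vcnj a) = a"
  by (simp add: vcnj_def vec_eq_iff)

lemma vcnj_smult: "vcnj (k *s a) = cnj k *s vcnj a"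
  by (simp add: vcnj_def vec_eq_iff)

lemma herm_vcnj_vcnj: "herm (vcnj a) (vcnj b) = herm b a"
  by (simp add: herm_def vcnj_def mult.commute)

lemma herm_vcnj_commute: "herm a (vcnj b) = herm b (vcnj a)"
  by (simp add: herm_def vcnj_def mult.commute)

lemma herm_vcnj_left: "herm (vcnj a) b = cnj (herm a (vcnj b))"
  by (simp add: herm_def vcnj_def)

lemma herm_zero [simp]: "herm 0 a = 0" "herm a 0 = 0"
  by (simp_all add: herm_def)

lemmas herm_simps = herm_add_left herm_add_right herm_diff_left herm_smult_left herm_smult_right
  herm_scaleR_left

lemma outer_mult_vec: "outer a b *v c = herm c b *s a"
  by (simp add: outer_def matrix_vector_mult_def herm_def vec_eq_iff sum_distrib_left sum_distrib_right mult_ac)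

lemma scaleR_outer_mult_vec: "(r *\<^sub>R outer a b) *v c = of_real r *s (herm c b *s a)"
  unfolding outer_mult_vec[symmetric]
  by (simp add: matrix_vector_mult_def vec_eq_iff sum_distrib_left scaleR_conv_of_real[where 'a=complex] mult.assoc)

lemma mult_outer: "A ** outer a b = outer (A *v a) b"
  by (simp add: outer_def matrix_matrix_mult_def matrix_vector_mult_def vec_eq_iff
      sum_distrib_left sum_distrib_right mult_ac)

lemma outer_mult:
  assumes "hermitian A"
  shows "outer a b ** A = outer a (A *v b)"
proof -
  have A: "A $ k $ j = cnj (A $ j $ k)" for k j by (rule hermitianD[OF assms])
  have "(\<Sum>k\<in>UNIV. a $ i * cnj (b $ k) * A $ k $ j) = (\<Sum>k\<in>UNIV. a $ i * cnj (A $ j $ k * b $ k))" for i j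
    by (intro sum.cong refl) (subst A, simp)
  then have "(\<Sum>k\<in>UNIV. a $ i * cnj (b $ k) * A $ k $ j) = a $ i * cnj (\<Sum>k\<in>UNIV. A $ j $ k * b $ k)" for i j
    by (simp add: sum_distrib_left)
  then show ?thesis
    by (simp add: outer_def matrix_matrix_mult_def matrix_vector_mult_def vec_eq_iff)
qed

lemma mcnj_outer: "mcnj (outer a b) = outer (vcnj a) (vcnj b)"
  by (simp add: mcnj_def outer_def vcnj_def vec_eq_iff)

lemma mcnj_mult_vec: "mcnj A *v a = vcnj (A *v vcnj a)"
  by (simp add: mcnj_def vcnj_def matrix_vector_mult_def vec_eq_iff)

lemma hermitian_mcnj:
  assumes "hermitian A"
  shows "hermitian (mcnj A)"
  unfolding hermitian_def mcnj_def vec_lambda_beta by (intro allI arg_cong[OF hermitianD[OF assms]])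

lemma herm_mult_vec:
  assumes "hermitian A"
  shows "herm (A *v a) b = herm a (A *v b)"
proof -
  have A: "A $ k $ j = cnj (A $ j $ k)" for k j by (rule hermitianD[OF assms])
  have "herm (A *v a) b = (\<Sum>i\<in>UNIV. \<Sum>j\<in>UNIV. A $ i $ j * a $ j * cnj (b $ i))"
    by (simp add: herm_def matrix_vector_mult_def sum_distrib_right)
  also have "\<dots> = (\<Sum>j\<in>UNIV. \<Sum>i\<in>UNIV. A $ i $ j * a $ j * cnj (b $ i))"
    by (rule sum.swap)
  also have "\<dots> = (\<Sum>j\<in>UNIV. \<Sum>i\<in>UNIV. a $ j * cnj (A $ j $ i * b $ i))"
    by (intro sum.cong refl) (subst A, simp)
  also have "\<dots> = herm a (A *v b)"
    by (simp add: herm_def matrix_vector_mult_def sum_distrib_left)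
  finally show ?thesis .
qed

lemma inner_outer: "A \<bullet> outer a b = (A *v b) \<bullet> a"
proof -
  have "(A *v b) \<bullet> a = Re (\<Sum>i\<in>UNIV. \<Sum>j\<in>UNIV. A $ i $ j * b $ j * cnj (a $ i))"
    by (simp only: Re_herm[symmetric]) (simp add: herm_def matrix_vector_mult_def sum_distrib_right)
  also have "\<dots> = A \<bullet> outer a b"
    by (simp add: inner_vec_def outer_def inner_complex_def algebra_simps)
  finally show ?thesis by simp
qed

text \<open>The tangent vector of projective space at \<open>z z\<^sup>*\<close> with horizontal lift \<open>\<kappa>\<close> for the Hopf fibration.\<close>

definition tang :: "complex ^ 'n \<Rightarrow> complex ^ 'n \<Rightarrow> complex ^ 'n ^ 'n" where
  "tang z \<kappa> = outer \<kappa> z + outer z \<kappa>"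

text \<open>The first condition is horizontality for the Hopf fibration, the second the derivative
  of \<open>\<Sum>a. (z $ a)^2 = 0\<close> in direction \<open>\<kappa>\<close>.\<close>

definition quadric_horizontal :: "complex ^ 'n \<Rightarrow> (complex ^ 'n) set" where
  "quadric_horizontal z = {\<kappa>. herm \<kappa> z = 0 \<and> herm \<kappa> (vcnj z) = 0}"

text \<open>For Hermitian \<open>A\<close> both summands of \<open>tang\<close> contribute equally.
  Pairing with a tangent vector therefore sees only the vector \<open>A *v z\<close>, which reduces
  computations with matrices to computations with vectors.\<close>

lemma inner_tang:
  assumes "hermitian A"
  shows "A \<bullet> tang z \<kappa> = 2 * ((A *v z) \<bullet> \<kappa>)"
proof -
  have "(A *v \<kappa>) \<bullet> z = (A *v z) \<bullet> \<kappa>"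
    by (metis Re_herm herm_mult_vec[OF assms] inner_commute)
  then show ?thesis by (simp add: tang_def inner_add_right inner_outer)
qed

lemma hermitian_tang: "hermitian (tang z \<kappa>)"
  by (simp add: hermitian_def tang_def outer_def mult_ac)

lemma hermitian_outer: "hermitian (outer z z)"
  by (simp add: hermitian_def outer_def mult_ac)

lemma linear_tang: "linear (tang z)"
  by (rule linearI) (simp_all add: tang_def outer_def vec_eq_iff algebra_simps scaleR_conv_of_real[where 'a=complex])

section \<open>Linear algebra at one point of the quadric\<close>

text \<open>\<open>herm z (vcnj z)\<close> is the sum of the squares of the coordinates, so
  \<open>z\<close> is a unit representative of a point of the quadric. Equivalently,
  \<open>z\<close> and \<open>vcnj z\<close> are Hermitian orthonormal.\<close>

locale null_unit_vector =
  fixes z :: "complex ^ 'n"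
  assumes unit: "herm z z = 1" and null: "herm z (vcnj z) = 0"
begin

lemma null': "herm (vcnj z) z = 0"
  using null by (simp add: herm_vcnj_left)

lemma unit': "herm (vcnj z) (vcnj z) = 1"
  using unit by (simp add: herm_vcnj_vcnj)

lemma horizontalD:
  assumes "\<kappa> \<in> quadric_horizontal z"
  shows "herm \<kappa> z = 0" "herm z \<kappa> = 0" "herm \<kappa> (vcnj z) = 0" "herm (vcnj z) \<kappa> = 0"
    "herm (vcnj \<kappa>) z = 0" "herm z (vcnj \<kappa>) = 0"
proof -
  show 1: "herm \<kappa> z = 0" "herm \<kappa> (vcnj z) = 0"
    using assms by (auto simp: quadric_horizontal_def)
  show 2: "herm z \<kappa> = 0" "herm (vcnj z) \<kappa> = 0"
    using 1 by (metis cnj_herm complex_cnj_zero)+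
  show "herm (vcnj \<kappa>) z = 0" "herm z (vcnj \<kappa>) = 0"
    using 1 2 by (simp_all add: herm_vcnj_left herm_vcnj_commute[of z])
qed

lemma tang_mult_vec:
  assumes "\<kappa> \<in> quadric_horizontal z"
  shows "tang z \<kappa> *v z = \<kappa>"
  using horizontalD[OF assms] unit
  by (simp add: tang_def matrix_vector_mult_add_rdistrib outer_mult_vec)

lemma horizontal_projection:
  "s - herm s z *s z - herm s (vcnj z) *s vcnj z \<in> quadric_horizontal z"
  by (simp add: quadric_horizontal_def herm_simps unit unit' null null')

text \<open>Real orthogonality suffices: the projection \<open>\<kappa>\<close> of \<open>s\<close>
  is itself horizontal, so it is an admissible test vector and
  \<open>\<kappa> \<bullet> \<kappa> = s \<bullet> \<kappa> = 0\<close>.\<close>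

lemma orthogonal_to_horizontal:
  assumes "\<And>\<kappa>. \<kappa> \<in> quadric_horizontal z \<Longrightarrow> s \<bullet> \<kappa> = 0"
  shows "s = herm s z *s z + herm s (vcnj z) *s vcnj z"
proof -
  define \<kappa> where "\<kappa> = s - herm s z *s z - herm s (vcnj z) *s vcnj z"
  have \<kappa>: "\<kappa> \<in> quadric_horizontal z" unfolding \<kappa>_def by (rule horizontal_projection)
  have "herm (s - herm s z *s z - herm s (vcnj z) *s vcnj z) \<kappa> = herm s \<kappa>"
    using horizontalD[OF \<kappa>] by (simp add: herm_simps)
  then have "Re (herm \<kappa> \<kappa>) = Re (herm s \<kappa>)"
    unfolding \<kappa>_def[symmetric] by simp
  then have "\<kappa> = 0" using assms[OF \<kappa>] by (simp add: Re_herm)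
  then show ?thesis by (simp add: \<kappa>_def algebra_simps)
qed

text \<open>The hypotheses are the first derivatives of \<open>P = P\<^sup>*\<close>, \<open>P P = P\<close> and \<open>P cnj P = 0\<close>,
  equations that hold on the quadric, at \<open>P = z z\<^sup>*\<close>.\<close>

lemma projective_tangent:
  assumes X: "hermitian X" and 1: "X ** outer z z + outer z z ** X = X"
  shows "X = tang z (X *v z)" "herm (X *v z) z = 0"
proof -
  show X': "X = tang z (X *v z)"
    using 1 by (simp add: mult_outer outer_mult[OF X] tang_def)
  have "X *v z = herm z z *s (X *v z) + herm z (X *v z) *s z"
    by (subst X', simp add: tang_def matrix_vector_mult_add_rdistrib outer_mult_vec)
  then have "herm z (X *v z) *s z = 0" by (simp add: unit)
  then have "herm (herm z (X *v z) *s z) z = 0" by (metis herm_zero(1))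
  then have "herm z (X *v z) = 0" by (simp add: herm_simps unit)
  then show "herm (X *v z) z = 0" by (metis cnj_herm complex_cnj_zero)
qed

lemma quadric_tangent:
  assumes X: "hermitian X" and 1: "X ** outer z z + outer z z ** X = X"
    and 2: "X ** mcnj (outer z z) + outer z z ** mcnj X = 0"
  shows "X = tang z (X *v z)" "X *v z \<in> quadric_horizontal z"
proof -
  have X': "X = tang z (X *v z)" and 3: "herm (X *v z) z = 0"
    using projective_tangent[OF X 1] by auto
  show "X = tang z (X *v z)" by (rule X')
  define b where "b = herm (vcnj z) (X *v z)"
  have Xc: "X *v vcnj z = b *s z"
    by (subst X', simp add: tang_def matrix_vector_mult_add_rdistrib outer_mult_vec null' b_def)
  \<comment> \<open>Applied to \<open>vcnj z\<close> and paired with \<open>z\<close>, each of the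
    two terms of the equation yields \<open>b\<close>.\<close>
  have "0 = herm ((X ** mcnj (outer z z) + outer z z ** mcnj X) *v vcnj z) z"
    by (simp add: 2 herm_def)
  also have "\<dots> = b + b"
    unfolding mcnj_outer mult_outer outer_mult[OF hermitian_mcnj[OF X]] matrix_vector_mult_add_rdistrib
      outer_mult_vec mcnj_mult_vec vcnj_vcnj Xc herm_add_left
    by (simp add: herm_simps unit unit' vcnj_smult)
  finally have "b = 0" by simp
  then have "herm (X *v z) (vcnj z) = 0" unfolding b_def by (metis cnj_herm complex_cnj_zero)
  with 3 show "X *v z \<in> quadric_horizontal z" by (simp add: quadric_horizontal_def)
qed

text \<open>The hypotheses on \<open>S\<close> are the second derivatives of the same equations.\<close>

lemma quadric_second_derivative:
  assumes \<zeta>: "\<zeta> \<in> quadric_horizontal z" and \<eta>: "\<eta> \<in> quadric_horizontal z"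
    and X: "X = tang z \<zeta>" and Y: "Y = tang z \<eta>" and S: "hermitian S"
    and 1: "S ** outer z z + outer z z ** S + X ** Y + Y ** X = S"
    and 2: "S ** mcnj (outer z z) + outer z z ** mcnj S + X ** mcnj Y + Y ** mcnj X = 0"
  shows "S = tang z (S *v z) + outer \<zeta> \<eta> + outer \<eta> \<zeta> + (2 * (\<zeta> \<bullet> \<eta>)) *\<^sub>R outer z z"
    "herm (S *v z) z = of_real (- 2 * (\<zeta> \<bullet> \<eta>))" "herm (S *v z) (vcnj z) = - herm \<zeta> (vcnj \<eta>)"
proof -
  note \<zeta>' = horizontalD[OF \<zeta>] and \<eta>' = horizontalD[OF \<eta>]
  have re: "herm \<eta> \<zeta> + herm \<zeta> \<eta> = of_real (2 * (\<zeta> \<bullet> \<eta>))"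
    using Re_herm[of \<zeta> \<eta>] cnj_herm[of \<zeta> \<eta>] complex_add_cnj[of "herm \<zeta> \<eta>"] by (simp add: add.commute)
  have XY: "X ** Y = outer (herm \<eta> \<zeta> *s z) z + outer \<zeta> \<eta>"
    using \<zeta>' \<eta>' by (simp add: X Y tang_def[of z \<eta>] matrix_add_ldistrib mult_outer tang_mult_vec[OF \<zeta>])
      (simp add: tang_def matrix_vector_mult_add_rdistrib outer_mult_vec)
  have YX: "Y ** X = outer (herm \<zeta> \<eta> *s z) z + outer \<eta> \<zeta>"
    using \<zeta>' \<eta>' by (simp add: X Y tang_def[of z \<zeta>] matrix_add_ldistrib mult_outer tang_mult_vec[OF \<eta>])
      (simp add: tang_def matrix_vector_mult_add_rdistrib outer_mult_vec)
  have "outer (herm \<eta> \<zeta> *s z) z + outer (herm \<zeta> \<eta> *s z) z = outer ((herm \<eta> \<zeta> + herm \<zeta> \<eta>) *s z) z"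
    by (simp add: outer_def vec_eq_iff algebra_simps)
  also have "\<dots> = (2 * (\<zeta> \<bullet> \<eta>)) *\<^sub>R outer z z"
    unfolding re by (simp add: outer_def vec_eq_iff scaleR_conv_of_real[where 'a=complex])
  finally have "X ** Y + Y ** X = outer \<zeta> \<eta> + outer \<eta> \<zeta> + (2 * (\<zeta> \<bullet> \<eta>)) *\<^sub>R outer z z"
    unfolding XY YX by (simp add: algebra_simps)
  then show S': "S = tang z (S *v z) + outer \<zeta> \<eta> + outer \<eta> \<zeta> + (2 * (\<zeta> \<bullet> \<eta>)) *\<^sub>R outer z z"
    using 1 by (simp add: mult_outer outer_mult[OF S] tang_def add.assoc)
  \<comment> \<open>Applying the formula for \<open>S\<close> to \<open>z\<close> and pairing with
    \<open>z\<close>, the term \<open>herm (S *v z) z\<close> cancels; what remains determines its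
    conjugate, which is real.\<close>
  have "herm (S *v z) z = herm (S *v z) z + herm z (S *v z) + of_real (2 * (\<zeta> \<bullet> \<eta>))"
    by (subst (1) S', simp add: tang_def matrix_vector_mult_add_rdistrib outer_mult_vec scaleR_outer_mult_vec \<zeta>' \<eta>' herm_simps unit)
  then have "herm z (S *v z) = of_real (- 2 * (\<zeta> \<bullet> \<eta>))"
    by (simp add: add.assoc eq_neg_iff_add_eq_0)
  then show "herm (S *v z) z = of_real (- 2 * (\<zeta> \<bullet> \<eta>))"
    by (metis cnj_herm complex_cnj_complex_of_real)
  \<comment> \<open>The same test as for first derivatives: apply to \<open>vcnj z\<close> and pair
    with \<open>z\<close>. The two terms with \<open>S\<close> agree, and so do the two terms with
    \<open>X\<close> and \<open>Y\<close>.\<close>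
  have "0 = herm ((S ** mcnj (outer z z) + outer z z ** mcnj S + X ** mcnj Y + Y ** mcnj X) *v vcnj z) z"
    by (simp add: 2 herm_def)
  also have "\<dots> = herm (S *v vcnj z) z + herm (vcnj z) (vcnj (S *v vcnj z))
      + herm (X *v vcnj \<eta>) z + herm (Y *v vcnj \<zeta>) z"
    using tang_mult_vec[OF \<zeta>] tang_mult_vec[OF \<eta>]
    by (simp add: mcnj_outer mult_outer outer_mult[OF hermitian_mcnj[OF S]] matrix_vector_mult_add_rdistrib
        outer_mult_vec mcnj_mult_vec matrix_vector_mul_assoc[symmetric] herm_simps unit unit' X Y)
  also have "\<dots> = 2 * herm (S *v vcnj z) z + herm (vcnj \<eta>) \<zeta> + herm (vcnj \<zeta>) \<eta>"
    by (simp add: herm_vcnj_vcnj X Y tang_def matrix_vector_mult_add_rdistrib outer_mult_vec \<zeta>' \<eta>' herm_simps unit)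
  also have "\<dots> = 2 * (herm (vcnj z) (S *v z) + herm (vcnj \<eta>) \<zeta>)"
    using herm_vcnj_commute[of \<eta> \<zeta>] by (simp add: herm_mult_vec[OF S] herm_vcnj_left)
  finally have "herm (vcnj z) (S *v z) = - herm (vcnj \<eta>) \<zeta>"
    by (simp add: add_eq_0_iff2)
  then show "herm (S *v z) (vcnj z) = - herm \<zeta> (vcnj \<eta>)"
    by (metis cnj_herm complex_cnj_minus)
qed

text \<open>Square length \<open>2\<close> in the space of matrices means a unit vector for the metric with factor \<open>1/2\<close>.
  The shape operator for the normal vector with horizontal lift \<open>\<mu> cnj z\<close> acts on horizontal lifts
  as \<open>\<zeta> \<mapsto> - \<mu> cnj \<zeta>\<close>.\<close>

lemma normal_vector:
  assumes \<nu>: "herm \<nu> z = 0" and orth: "\<And>\<kappa>. \<kappa> \<in> quadric_horizontal z \<Longrightarrow> tang z \<nu> \<bullet> tang z \<kappa> = 0"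
    and len: "tang z \<nu> \<bullet> tang z \<nu> = 2"
  obtains \<mu> where "cmod \<mu> = 1" "\<nu> = \<mu> *s vcnj z"
proof -
  have z\<nu>: "herm z \<nu> = 0" using \<nu> by (metis cnj_herm complex_cnj_zero)
  have tv: "tang z \<nu> *v z = \<nu>"
    by (simp add: tang_def matrix_vector_mult_add_rdistrib outer_mult_vec unit z\<nu>)
  have "\<nu> \<bullet> \<kappa> = 0" if "\<kappa> \<in> quadric_horizontal z" for \<kappa>
    using orth[OF that] inner_tang[OF hermitian_tang, of z \<nu> z \<kappa>] tv by simp
  from orthogonal_to_horizontal[OF this] \<nu> have e: "\<nu> = herm \<nu> (vcnj z) *s vcnj z"
    by simp
  define \<mu> where "\<mu> = herm \<nu> (vcnj z)"
  have e': "\<nu> = \<mu> *s vcnj z" unfolding \<mu>_def by (rule e)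
  have "\<nu> \<bullet> \<nu> = 1" using len inner_tang[OF hermitian_tang, of z \<nu> z \<nu>] tv by simp
  then have "herm \<nu> \<nu> = 1" by (simp add: herm_self)
  then have "\<mu> * cnj \<mu> = 1" by (simp add: e' herm_simps unit' mult.commute)
  then have "(cmod \<mu>)\<^sup>2 = 1"
    by (metis complex_norm_square of_real_eq_1_iff)
  then have "cmod \<mu> = 1" by (simp add: power2_eq_1_iff) (use norm_ge_zero[of \<mu>] in linarith)
  with e' show ?thesis using that by blast
qed

lemma fixed_by_shape_operator:
  assumes \<zeta>: "\<zeta> \<in> quadric_horizontal z"
    and eq: "\<And>\<eta>. \<eta> \<in> quadric_horizontal z \<Longrightarrow> \<exists>S. hermitian S \<and>
        herm (S *v z) (vcnj z) = - herm \<zeta> (vcnj \<eta>) \<and>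
        tang z \<zeta> \<bullet> tang z \<eta> = S \<bullet> tang z (\<mu> *s vcnj z)"
  shows "\<zeta> = - (\<mu> *s vcnj \<zeta>)"
proof -
  \<comment> \<open>The defect of the claim. It is horizontal, hence itself an admissible
    \<open>\<eta>\<close>, and the hypothesis for it reduces to
    \<open>\<omega> \<bullet> \<omega> = 0\<close>.\<close>
  define \<omega> where "\<omega> = \<zeta> + \<mu> *s vcnj \<zeta>"
  note \<zeta>' = horizontalD[OF \<zeta>]
  have "herm (vcnj \<zeta>) (vcnj z) = 0" by (simp add: herm_vcnj_vcnj \<zeta>')
  then have \<omega>: "\<omega> \<in> quadric_horizontal z"
    by (simp add: quadric_horizontal_def \<omega>_def herm_simps \<zeta>')
  obtain S where S: "hermitian S" "herm (S *v z) (vcnj z) = - herm \<zeta> (vcnj \<omega>)"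
    "tang z \<zeta> \<bullet> tang z \<omega> = S \<bullet> tang z (\<mu> *s vcnj z)"
    using eq[OF \<omega>] by blast
  have "2 * (\<zeta> \<bullet> \<omega>) = 2 * ((S *v z) \<bullet> (\<mu> *s vcnj z))"
    using S(3) inner_tang[OF S(1)] inner_tang[OF hermitian_tang, of z \<zeta> z \<omega>] tang_mult_vec[OF \<zeta>] by simp
  then have "Re (herm \<zeta> \<omega>) = Re (cnj \<mu> * (- herm \<zeta> (vcnj \<omega>)))"
    by (simp only: Re_herm[symmetric] herm_smult_right S(2))
  moreover have "herm \<zeta> (vcnj \<omega>) = cnj (herm (vcnj \<zeta>) \<omega>)"
    by (simp add: herm_vcnj_left)
  ultimately have "Re (herm \<zeta> \<omega>) + Re (herm (\<mu> *s vcnj \<zeta>) \<omega>) = 0"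
    by (simp add: herm_smult_left)
  then have "\<omega> \<bullet> \<omega> = 0"
    by (simp only: Re_herm[symmetric] plus_complex.sel(1)[symmetric] herm_add_left[symmetric] \<omega>_def[symmetric])
  then show ?thesis by (simp add: \<omega>_def eq_neg_iff_add_eq_0)
qed

text \<open>The hypothesis says that the part of \<open>S\<close> tangent to the quadric is
  \<open>c\<close> times \<open>X\<close>. Removing it from \<open>S *v z\<close> leaves a vector
  orthogonal to all horizontal ones, hence in the complex span of \<open>z\<close> and
  \<open>vcnj z\<close>.\<close>

lemma normal_component:
  assumes S: "hermitian S" and X: "X = tang z \<zeta>" "\<zeta> \<in> quadric_horizontal z"
    and orth: "\<And>\<kappa>. \<kappa> \<in> quadric_horizontal z \<Longrightarrow> (S - c *\<^sub>R X) \<bullet> tang z \<kappa> = 0"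
  shows "S *v z = c *\<^sub>R \<zeta> + herm (S *v z) z *s z + herm (S *v z) (vcnj z) *s vcnj z"
proof -
  note \<zeta>' = horizontalD[OF X(2)]
  have "(S *v z - c *\<^sub>R \<zeta>) \<bullet> \<kappa> = 0" if "\<kappa> \<in> quadric_horizontal z" for \<kappa>
    using orth[OF that] inner_tang[OF S] inner_tang[OF hermitian_tang, of z \<zeta> z \<kappa>] tang_mult_vec[OF X(2)]
    by (simp add: X inner_diff_left)
  from orthogonal_to_horizontal[OF this] show ?thesis
    by (simp add: herm_simps \<zeta>' algebra_simps)
qed

text \<open>By \<open>\<zeta> = - \<mu> cnj \<zeta>\<close> and \<open>\<eta> = - \<mu> cnj \<eta>\<close>, real orthogonality of \<open>\<zeta>\<close> and \<open>\<eta>\<close> implies Hermitian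
  orthogonality of \<open>\<zeta>\<close> to both \<open>\<eta>\<close> and \<open>cnj \<eta>\<close>, so that all mixed terms vanish.\<close>

lemma totally_real_gauss:
  assumes \<zeta>: "\<zeta> \<in> quadric_horizontal z" "\<zeta> = - (\<mu> *s vcnj \<zeta>)"
    and \<eta>: "\<eta> \<in> quadric_horizontal z" "\<eta> = - (\<mu> *s vcnj \<eta>)"
    and \<mu>: "cmod \<mu> = 1" and orth: "X \<bullet> Y = 0"
    and X: "X = tang z \<zeta>" and Y: "Y = tang z \<eta>"
    and S: "hermitian S" "S ** outer z z + outer z z ** S + X ** X + X ** X = S"
      "S ** mcnj (outer z z) + outer z z ** mcnj S + X ** mcnj X + X ** mcnj X = 0"
      "\<And>\<kappa>. \<kappa> \<in> quadric_horizontal z \<Longrightarrow> (S - c *\<^sub>R X) \<bullet> tang z \<kappa> = 0"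
    and T: "hermitian T" "T ** outer z z + outer z z ** T + X ** Y + Y ** X = T"
      "T ** mcnj (outer z z) + outer z z ** mcnj T + X ** mcnj Y + Y ** mcnj X = 0"
      "\<And>\<kappa>. \<kappa> \<in> quadric_horizontal z \<Longrightarrow> (T - d *\<^sub>R Y) \<bullet> tang z \<kappa> = 0"
    and U: "hermitian U" "U ** outer z z + outer z z ** U + Y ** Y + Y ** Y = U"
      "U ** mcnj (outer z z) + outer z z ** mcnj U + Y ** mcnj Y + Y ** mcnj Y = 0"
  shows "S \<bullet> U = c * (U \<bullet> X) + 3 / 2 * (X \<bullet> X) * (Y \<bullet> Y)"
    "T \<bullet> T = d\<^sup>2 * (Y \<bullet> Y) + 1 / 2 * (X \<bullet> X) * (Y \<bullet> Y)"
proof -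
  note \<zeta>' = horizontalD[OF \<zeta>(1)] and \<eta>' = horizontalD[OF \<eta>(1)]
  note S' = quadric_second_derivative[OF \<zeta>(1) \<zeta>(1) X X S(1-3)]
  note T' = quadric_second_derivative[OF \<zeta>(1) \<eta>(1) X Y T(1-3)]
  note U' = quadric_second_derivative[OF \<eta>(1) \<eta>(1) Y Y U(1-3)]
  have inn: "tang z a \<bullet> tang z b = 2 * (a \<bullet> b)" if "a \<in> quadric_horizontal z" for a b
    using inner_tang[OF hermitian_tang, of z a z b] tang_mult_vec[OF that] by simp
  have \<mu>\<mu>: "\<mu> * cnj \<mu> = 1" using \<mu> complex_norm_square[of \<mu>] by simp
  have o: "\<zeta> \<bullet> \<eta> = 0" using orth inn[OF \<zeta>(1)] by (simp add: X Y)
  have cnj_vec: "vcnj a = - (cnj \<mu> *s a)" if "a = - (\<mu> *s vcnj a)" for a :: "complex ^ 'n"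
  proof -
    have "vcnj a = vcnj (- (\<mu> *s vcnj a))" using that by simp
    also have "\<dots> = - (cnj \<mu> *s a)" by (simp add: vcnj_def vec_eq_iff)
    finally show ?thesis .
  qed
  have herm_minus: "herm a (- b) = - herm a b" "herm (- a) b = - herm a b" for a b :: "complex ^ 'n"
    by (simp_all add: herm_def sum_negf)
  have bil: "herm a (vcnj b) = - (\<mu> * herm a b)" if "b = - (\<mu> *s vcnj b)" for a b :: "complex ^ 'n"
    by (subst cnj_vec[OF that]) (simp add: herm_minus herm_simps)
  \<comment> \<open>Conjugating both vectors reverses the Hermitian product, and the common phase
    contributes \<open>\<mu> * cnj \<mu> = 1\<close>. The product is thus real, and its real part
    \<open>\<zeta> \<bullet> \<eta>\<close> is 0.\<close>
  have "herm \<zeta> \<eta> = cnj (herm \<zeta> \<eta>)"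
  proof -
    have "herm \<zeta> \<eta> = herm (- (\<mu> *s vcnj \<zeta>)) (- (\<mu> *s vcnj \<eta>))" using \<zeta>(2) \<eta>(2) by simp
    also have "\<dots> = (\<mu> * cnj \<mu>) * herm \<eta> \<zeta>"
      by (simp add: herm_minus herm_simps herm_vcnj_vcnj)
    finally show ?thesis by (simp add: \<mu>\<mu> cnj_herm)
  qed
  then have h0: "herm \<zeta> \<eta> = 0" "herm \<eta> \<zeta> = 0"
    using o Re_herm[of \<zeta> \<eta>] cnj_herm[of \<zeta> \<eta>] by (auto simp: complex_eq_iff)
  define p where "p = \<zeta> \<bullet> \<zeta>"
  define q where "q = \<eta> \<bullet> \<eta>"
  have pq: "X \<bullet> X = 2 * p" "Y \<bullet> Y = 2 * q" using inn \<zeta> \<eta> by (simp_all add: X Y p_def q_def)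
  have hh: "herm \<zeta> \<zeta> = of_real p" "herm \<eta> \<eta> = of_real q" by (simp_all add: herm_self p_def q_def)
  \<comment> \<open>Every summand of \<open>U\<close> has an outer factor \<open>z\<close> or
    \<open>\<eta>\<close>, both Hermitian orthogonal to \<open>\<zeta>\<close>.\<close>
  have U\<zeta>: "(U *v \<zeta>) \<bullet> \<zeta> = 0"
  proof -
    have "herm (U *v \<zeta>) \<zeta> = 0"
      by (subst U'(1)) (simp only: tang_def matrix_vector_mult_add_rdistrib outer_mult_vec h0 \<zeta>' herm_simps
        scaleR_outer_mult_vec mult_zero_left mult_zero_right add_0_left)
    then show ?thesis by (metis Re_herm zero_complex.sel(1))
  qed
  have "S \<bullet> U = U \<bullet> (tang z (S *v z) + outer \<zeta> \<zeta> + outer \<zeta> \<zeta> + (2 * p) *\<^sub>R outer z z)"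
    unfolding p_def using S'(1) by (metis inner_commute)
  \<comment> \<open>The correction is \<open>2 * p\<close> times
    \<open>(U *v z) \<bullet> z = - 2 * q\<close>; the two terms
    \<open>outer \<zeta> \<zeta>\<close> pair to 0 with \<open>U\<close>.\<close>
  also have "\<dots> = 2 * ((U *v z) \<bullet> (S *v z)) - 4 * p * q"
  proof -
    have "(U *v z) \<bullet> z = - 2 * q"
      unfolding Re_herm[symmetric] U'(2) by (simp add: q_def Re_herm)
    then show ?thesis
      unfolding inner_add_right inner_tang[OF U(1)] inner_outer inner_scaleR_right U\<zeta> by simp
  qed
  also have "(U *v z) \<bullet> (S *v z) = Re (herm (S *v z) (U *v z))"
    by (simp add: Re_herm inner_commute)
  \<comment> \<open>Three orthogonal contributions: the tangential one with factor \<open>c\<close>;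
    along \<open>z\<close> the product \<open>(- 2 * p) * (- 2 * q)\<close>; along
    \<open>vcnj z\<close> the product of \<open>\<mu> * p\<close> and the conjugate of
    \<open>\<mu> * q\<close>.\<close>
  also have "herm (S *v z) (U *v z) = of_real c * herm \<zeta> (U *v z) + of_real (4 * p * q) + of_real (p * q)"
  proof -
    have "herm (U *v z) (vcnj z) = \<mu> * of_real q"
      using U'(3) bil[OF \<eta>(2), of \<eta>] by (simp add: hh)
    then have uz: "herm z (U *v z) = of_real (- 2 * q)" "herm (vcnj z) (U *v z) = cnj (\<mu> * of_real q)"
      using U'(2) cnj_herm[of "U *v z" z] cnj_herm[of "U *v z" "vcnj z"]
      unfolding q_def by (metis complex_cnj_complex_of_real, metis)
    have sz: "herm (S *v z) z = of_real (- 2 * p)" "herm (S *v z) (vcnj z) = \<mu> * of_real p"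
      using S'(2,3) bil[OF \<zeta>(2), of \<zeta>] by (simp_all add: hh p_def[symmetric])
    have "\<mu> * of_real p * cnj (\<mu> * of_real q) = (\<mu> * cnj \<mu>) * of_real (p * q)" by simp
    also have "\<dots> = of_real (p * q)" by (simp only: \<mu>\<mu> mult_1)
    finally have pq': "\<mu> * of_real p * cnj (\<mu> * of_real q) = of_real (p * q)" .
    have nS: "S *v z = c *\<^sub>R \<zeta> + of_real (- 2 * p) *s z + (\<mu> * of_real p) *s vcnj z"
      using normal_component[OF S(1) X \<zeta>(1) S(4)] unfolding sz .
    have "herm (S *v z) (U *v z) = of_real c * herm \<zeta> (U *v z) + of_real (- 2 * p) * of_real (- 2 * q)
        + \<mu> * of_real p * cnj (\<mu> * of_real q)"
      by (simp only: nS herm_simps uz)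
    then show ?thesis by (simp only: pq') simp
  qed
  also have "Re (of_real c * herm \<zeta> (U *v z) + of_real (4 * p * q) + of_real (p * q))
      = c * (\<zeta> \<bullet> (U *v z)) + 5 * p * q"
    by (simp add: Re_herm)
  also have "\<zeta> \<bullet> (U *v z) = (U \<bullet> X) / 2"
    using inner_tang[OF U(1), of z \<zeta>] by (simp add: X inner_commute)
  \<comment> \<open>Besides the tangential term the total is
    \<open>2 * 5 * p * q - 4 * p * q = 6 * p * q\<close>, and \<open>p\<close>, \<open>q\<close> are
    half of \<open>X \<bullet> X\<close> and \<open>Y \<bullet> Y\<close>.\<close>
  finally show "S \<bullet> U = c * (U \<bullet> X) + 3 / 2 * (X \<bullet> X) * (Y \<bullet> Y)"
    by (simp add: pq algebra_simps)
  have tz: "T *v z = d *\<^sub>R \<eta>"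
  proof -
    have "herm (T *v z) z = 0" "herm (T *v z) (vcnj z) = 0"
      using T'(2,3) bil[OF \<eta>(2), of \<zeta>] by (simp_all add: h0 o)
    then show ?thesis using normal_component[OF T(1) Y \<eta>(1) T(4)] by simp
  qed
  have T\<eta>: "(T *v \<eta>) \<bullet> \<zeta> = p * q" "(T *v \<zeta>) \<bullet> \<eta> = p * q"
  proof -
    have "herm (T *v \<eta>) \<zeta> = of_real (p * q)" "herm (T *v \<zeta>) \<eta> = of_real (p * q)"
      by (subst T'(1), simp add: tang_def matrix_vector_mult_add_rdistrib outer_mult_vec h0 hh \<zeta>' \<eta>' herm_simps o)+
    then show "(T *v \<eta>) \<bullet> \<zeta> = p * q" "(T *v \<zeta>) \<bullet> \<eta> = p * q" by (metis Re_herm Re_complex_of_real)+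
  qed
  have "T \<bullet> T = T \<bullet> (tang z (T *v z) + outer \<zeta> \<eta> + outer \<eta> \<zeta>)"
    using T'(1) by (simp add: o)
  also have "\<dots> = 2 * (d\<^sup>2 * q) + 2 * (p * q)"
    by (simp add: inner_add_right inner_tang[OF T(1)] inner_outer tz T\<eta> q_def power2_eq_square)
  finally show "T \<bullet> T = d\<^sup>2 * (Y \<bullet> Y) + 1 / 2 * (X \<bullet> X) * (Y \<bullet> Y)"
    by (simp add: pq)
qed

text \<open>The vectors \<open>z\<close>, \<open>\<i> *s z\<close>, \<open>vcnj z\<close>,
  \<open>\<i> *s vcnj z\<close> are orthonormal over the reals and orthogonal to all horizontal
  vectors. For \<open>n = k + 2\<close> the resulting bound \<open>2 * k\<close> is the real
  dimension of the quadric.\<close>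

lemma dim_quadric_horizontal: "dim (quadric_horizontal z) + 4 \<le> 2 * CARD('n)"
proof -
  define A where "A = {z, \<i> *s z, vcnj z, \<i> *s vcnj z}"
  have nz: "herm a a = 1" if "a \<in> A" for a
    using that by (auto simp: A_def herm_simps unit unit')
  have in0: "a \<bullet> b = Re (herm a b)" for a b :: "complex ^ 'n" by (simp add: Re_herm)
  have ne: "a \<noteq> b" if "a \<in> A" "b \<in> A" "Re (herm a b) = 0" for a b
    using nz[OF that(1)] that(3) by auto
  have ort: "pairwise orthogonal A"
    unfolding A_def pairwise_insert orthogonal_def in0
    by (auto simp: herm_simps unit unit' null null')
  have "z \<noteq> \<i> *s z" "z \<noteq> vcnj z" "z \<noteq> \<i> *s vcnj z" "\<i> *s z \<noteq> vcnj z" "\<i> *s z \<noteq> \<i> *s vcnj z"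
    "vcnj z \<noteq> \<i> *s vcnj z"
    by (rule ne; simp add: A_def herm_simps unit unit' null null')+
  then have cardA: "card A = 4" by (simp add: A_def)
  have indA: "independent A"
    using ort nz by (intro pairwise_orthogonal_independent) (auto dest: nz)
  have dimA: "dim (span A) = 4"
    using indA cardA by (simp add: dim_span dim_eq_card_independent)
  have "quadric_horizontal z \<subseteq> {y \<in> UNIV. \<forall>x\<in>span A. orthogonal x y}"
  proof (clarify, intro conjI UNIV_I ballI)
    fix \<kappa> x assume \<kappa>: "\<kappa> \<in> quadric_horizontal z" and x: "x \<in> span A"
    have "orthogonal \<kappa> a" if "a \<in> A" for a
      using that horizontalD[OF \<kappa>] by (auto simp: A_def orthogonal_def in0 herm_simps)
    then show "orthogonal x \<kappa>" using x orthogonal_to_span orthogonal_commute by blast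
  qed
  then have "dim (quadric_horizontal z) \<le> dim {y \<in> UNIV. \<forall>x\<in>span A. orthogonal x y}"
    by (rule dim_subset)
  moreover have "dim {y \<in> (UNIV :: (complex ^ 'n) set). \<forall>x\<in>span A. orthogonal x y} + dim (span A) = dim (UNIV :: (complex ^ 'n) set)"
    by (rule dim_subspace_orthogonal_to_vectors) auto
  ultimately show ?thesis
    unfolding dimA by (simp add: mult.commute)
qed

end

section \<open>Embedded submanifolds\<close>

lemma bounded_bilinear_matrix_mult:
  "bounded_bilinear (\<lambda>(A :: complex ^ 'n ^ 'm) (B :: complex ^ 'k ^ 'n). A ** B)"
  unfolding bilinear_conv_bounded_bilinear[symmetric] bilinear_def
  by (intro conjI allI linearI)
    (simp_all add: vec_eq_iff matrix_matrix_mult_def algebra_simps sum.distrib scaleR_sum_right)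

lemma linear_mcnj: "linear (mcnj :: complex ^ 'n ^ 'm \<Rightarrow> _)"
  by (rule linearI) (simp_all add: mcnj_def vec_eq_iff)

lemma bounded_bilinear_mult_mcnj:
  "bounded_bilinear (\<lambda>(A :: complex ^ 'n ^ 'm) (B :: complex ^ 'k ^ 'n). A ** mcnj B)"
  using bounded_bilinear.comp[OF bounded_bilinear_matrix_mult bounded_linear_ident]
    linear_mcnj linear_conv_bounded_linear by blast

lemma hermitian_dd:
  fixes \<Psi> :: "'a::euclidean_space \<Rightarrow> complex ^ 'n ^ 'n"
  assumes W: "open W" "y \<in> W" and \<Psi>: "\<Psi> differentiable (at y)" "\<And>y. y \<in> W \<Longrightarrow> hermitian (\<Psi> y)"
  shows "hermitian (dd v \<Psi> y)"
proof -
  define L :: "complex ^ 'n ^ 'n \<Rightarrow> complex ^ 'n ^ 'n" where "L A = (\<chi> i j. cnj (A $ j $ i))" for A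
  have "linear L" by (rule linearI) (simp_all add: L_def vec_eq_iff)
  then have bL: "bounded_linear L" by (simp add: linear_conv_bounded_linear)
  have L: "hermitian A \<longleftrightarrow> L A = A" for A
    unfolding L_def hermitian_def vec_eq_iff vec_lambda_beta by metis
  have "dd v \<Psi> y = dd v (\<lambda>y. L (\<Psi> y)) y"
    using \<Psi>(2) L by (intro dd_cong[OF W]) simp
  then show ?thesis
    unfolding L by (simp add: dd_linear[OF bL \<Psi>(1)])
qed

text \<open>Covers both quadratic equations: \<open>P P = P\<close> with \<open>L\<close> the
  identity, and \<open>P cnj P = 0\<close> with \<open>L = 0\<close>. Complex conjugation is real
  linear, so the second product is still bilinear over the reals.\<close>

lemma dd_bilinear_equation:
  fixes \<Psi> :: "'a::euclidean_space \<Rightarrow> 'e::euclidean_space"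
  assumes \<beta>: "bounded_bilinear \<beta>" and W: "open W" "y \<in> W" and \<Psi>: "smooth_on W \<Psi>"
    and L: "bounded_linear L" "\<And>y. y \<in> W \<Longrightarrow> \<beta> (\<Psi> y) (\<Psi> y) = L (\<Psi> y)"
  shows "\<beta> (dd v \<Psi> y) (\<Psi> y) + \<beta> (\<Psi> y) (dd v \<Psi> y) = L (dd v \<Psi> y)"
    "\<beta> (dd v (dd w \<Psi>) y) (\<Psi> y) + \<beta> (\<Psi> y) (dd v (dd w \<Psi>) y)
      + \<beta> (dd v \<Psi> y) (dd w \<Psi> y) + \<beta> (dd w \<Psi> y) (dd v \<Psi> y) = L (dd v (dd w \<Psi>) y)"
proof -
  have d: "\<Psi> differentiable (at z)" "dd u \<Psi> differentiable (at z)" if "z \<in> W" for z u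
    using smooth_onD(3)[OF \<Psi> that] smooth_onD(3)[OF smooth_onD(2)[OF \<Psi>] that] by auto
  have 1: "\<beta> (dd u \<Psi> z) (\<Psi> z) + \<beta> (\<Psi> z) (dd u \<Psi> z) = L (dd u \<Psi> z)" if "z \<in> W" for z u
  proof -
    have "\<beta> (\<Psi> z) (dd u \<Psi> z) + \<beta> (dd u \<Psi> z) (\<Psi> z) = dd u (\<lambda>y. \<beta> (\<Psi> y) (\<Psi> y)) z"
      using dd_bilinear[OF \<beta> d(1) d(1)] that by simp
    also have "\<dots> = dd u (\<lambda>y. L (\<Psi> y)) z" by (intro dd_cong[OF W(1) that] L(2))
    also have "\<dots> = L (dd u \<Psi> z)" using dd_linear[OF L(1) d(1)] that by simp
    finally show ?thesis by (simp add: add.commute)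
  qed
  from 1 W(2) show "\<beta> (dd v \<Psi> y) (\<Psi> y) + \<beta> (\<Psi> y) (dd v \<Psi> y) = L (dd v \<Psi> y)" .
  have "dd v (\<lambda>z. \<beta> (dd w \<Psi> z) (\<Psi> z) + \<beta> (\<Psi> z) (dd w \<Psi> z)) y = dd v (\<lambda>z. L (dd w \<Psi> z)) y"
    using 1 by (intro dd_cong[OF W])
  moreover have "dd v (\<lambda>z. L (dd w \<Psi> z)) y = L (dd v (dd w \<Psi>) y)"
    using dd_linear[OF L(1) d(2)[OF W(2)]] .
  moreover have "dd v (\<lambda>z. \<beta> (dd w \<Psi> z) (\<Psi> z) + \<beta> (\<Psi> z) (dd w \<Psi> z)) y =
      (\<beta> (dd w \<Psi> y) (dd v \<Psi> y) + \<beta> (dd v (dd w \<Psi>) y) (\<Psi> y))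
      + (\<beta> (\<Psi> y) (dd v (dd w \<Psi>) y) + \<beta> (dd v \<Psi> y) (dd w \<Psi> y))"
    unfolding dd_plus[OF differentiable_bilinear[OF \<beta> d(2,1)[OF W(2)]] differentiable_bilinear[OF \<beta> d(1,2)[OF W(2)]]]
    unfolding dd_bilinear[OF \<beta> d(2,1)[OF W(2)]] dd_bilinear[OF \<beta> d(1,2)[OF W(2)]] by simp
  ultimately show "\<beta> (dd v (dd w \<Psi>) y) (\<Psi> y) + \<beta> (\<Psi> y) (dd v (dd w \<Psi>) y)
      + \<beta> (dd v \<Psi> y) (dd w \<Psi> y) + \<beta> (dd w \<Psi> y) (dd v \<Psi> y) = L (dd v (dd w \<Psi>) y)"
    by (simp add: add_ac)
qed

section \<open>Charts of embedded submanifolds: Christoffel symbols and the Gauss formula\<close>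

locale embedded_chart =
  fixes r :: real and S :: "'e::euclidean_space set"
    and i :: "'b::euclidean_space set \<times> ('b \<Rightarrow> 'e)"
  assumes r: "r \<noteq> 0" and i: "i \<in> idx (embedded_submanifold r S)"
begin

abbreviation N :: "('b set \<times> ('b \<Rightarrow> 'e), 'e, 'b) rmanifold" where "N \<equiv> embedded_submanifold r S"
abbreviation V where "V \<equiv> cdom N i"
abbreviation \<sigma> where "\<sigma> \<equiv> param N i"

lemma chart:
  shows open_domain: "open V" and smooth: "smooth_on V \<sigma>"
    and immersion: "x \<in> V \<Longrightarrow> inj (frechet_derivative \<sigma> (at x))"
    and open_image: "openin (top_of_set S) (cimage N i)"
    and homeo: "homeomorphism V (cimage N i) \<sigma> (coord N i)"
  using i by (auto simp: embedded_submanifold_def cimage_def coord_def)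

lemma metric: "metric N i x v w = r * (dd v \<sigma> x \<bullet> dd w \<sigma> x)"
  by (simp add: embedded_submanifold_def split: prod.split)

lemma image_subset: "cimage N i \<subseteq> S"
  using open_image openin_imp_subset by blast

lemma in_S: "x \<in> V \<Longrightarrow> \<sigma> x \<in> S"
  using image_subset by (auto simp: cimage_def)

lemma diff: "x \<in> V \<Longrightarrow> \<sigma> differentiable (at x)" "x \<in> V \<Longrightarrow> dd v \<sigma> differentiable (at x)"
  using smooth_onD(3)[OF smooth] smooth_onD(3)[OF smooth_onD(2)[OF smooth]] by auto

lemma linear_deriv: "x \<in> V \<Longrightarrow> linear (\<lambda>v. dd v \<sigma> x)"
  using linear_frechet_derivative[OF diff(1)] by (simp add: eta_contract_eq)

lemma second_derivative_linear:
  assumes "x \<in> V"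
  shows "linear (\<lambda>w. dd v (dd w \<sigma>) x)"
proof -
  have "linear (\<lambda>w. dd w (dd v \<sigma>) x)"
    using linear_frechet_derivative[OF diff(2)[OF assms]] by (simp add: eta_contract_eq)
  then show ?thesis
    using dd_commute[OF open_domain assms smooth, of v] by simp
qed

lemma ex1_metric_representation:
  assumes "x \<in> V" "linear g" "c \<noteq> 0"
  shows "\<exists>!u. \<forall>w. c * (dd u \<sigma> x \<bullet> dd w \<sigma> x) = g w"
  using ex1_inner_representation[OF linear_deriv[OF assms(1)] _ assms(2,3)] immersion[OF assms(1)]
  by (simp add: eta_contract_eq)

text \<open>For an induced metric, symmetry of second derivatives reduces the three Koszul terms to
  \<open>2 * r * (dd v (dd w \<sigma>) x \<bullet> dd z \<sigma> x)\<close>. The Christoffel vector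
  therefore represents the tangential part of the second derivative of the parametrization.\<close>

lemma christoffel_tangential:
  assumes x: "x \<in> V"
  shows "dd (christoffel N i x v w) \<sigma> x \<bullet> dd z \<sigma> x = dd v (dd w \<sigma>) x \<bullet> dd z \<sigma> x"
proof -
  have comm: "dd a (dd b \<sigma>) x = dd b (dd a \<sigma>) x" for a b
    using dd_commute[OF open_domain x smooth] .
  have Dm: "dd a (\<lambda>y. metric N i y b c) x = r * (dd b \<sigma> x \<bullet> dd a (dd c \<sigma>) x + dd a (dd b \<sigma>) x \<bullet> dd c \<sigma> x)"
    for a b c
  proof -
    have "dd a (\<lambda>y. metric N i y b c) x = dd a (\<lambda>y. r * (dd b \<sigma> y \<bullet> dd c \<sigma> y)) x"
      by (simp add: metric)
    also have "\<dots> = r * dd a (\<lambda>y. dd b \<sigma> y \<bullet> dd c \<sigma> y) x"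
      by (intro dd_linear bounded_linear_mult_right differentiable_bilinear[OF bounded_bilinear_inner] diff x)
    also have "dd a (\<lambda>y. dd b \<sigma> y \<bullet> dd c \<sigma> y) x = dd b \<sigma> x \<bullet> dd a (dd c \<sigma>) x + dd a (dd b \<sigma>) x \<bullet> dd c \<sigma> x"
      by (intro dd_bilinear bounded_bilinear_inner diff x)
    finally show ?thesis .
  qed
  have K: "dd v (\<lambda>y. metric N i y w z) x + dd w (\<lambda>y. metric N i y v z) x - dd z (\<lambda>y. metric N i y v w) x
      = 2 * r * (dd v (dd w \<sigma>) x \<bullet> dd z \<sigma> x)" for z
    unfolding Dm comm[of w v] comm[of z v] comm[of z w]
    by (simp add: algebra_simps inner_commute)
  have lin: "linear (\<lambda>z. 2 * r * (dd v (dd w \<sigma>) x \<bullet> dd z \<sigma> x))"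
    by (rule linearI) (simp_all add: linear_add[OF linear_deriv[OF x]] linear_cmul[OF linear_deriv[OF x]] algebra_simps)
  have eq: "christoffel N i x v w = (THE u. \<forall>z. (2 * r) * (dd u \<sigma> x \<bullet> dd z \<sigma> x) =
      2 * r * (dd v (dd w \<sigma>) x \<bullet> dd z \<sigma> x))"
    unfolding christoffel_def K by (simp add: metric mult.assoc)
  have "\<forall>z. (2 * r) * (dd (christoffel N i x v w) \<sigma> x \<bullet> dd z \<sigma> x) = 2 * r * (dd v (dd w \<sigma>) x \<bullet> dd z \<sigma> x)"
    unfolding eq by (rule theI'[OF ex1_metric_representation[OF x lin]]) (simp add: r)
  then show ?thesis using r by simp
qed

text \<open>Only two derivatives of \<open>\<phi>\<close> are assumed, because this is what is
  established for the inclusion of the quadric in a chart of projective space.\<close>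

lemma second_derivative_compose:
  fixes \<phi> :: "'a::euclidean_space \<Rightarrow> 'b"
  assumes W: "open W" "x \<in> W" and \<phi>: "\<And>y. y \<in> W \<Longrightarrow> \<phi> differentiable (at y)"
    "dd w \<phi> differentiable (at x)" "\<phi> ` W \<subseteq> V"
    and \<Psi>: "\<And>y. y \<in> W \<Longrightarrow> \<Psi> y = \<sigma> (\<phi> y)"
  shows "dd v (dd w \<Psi>) x = dd (dd v (dd w \<phi>) x) \<sigma> (\<phi> x) + dd (dd v \<phi> x) (dd (dd w \<phi> x) \<sigma>) (\<phi> x)"
proof -
  have in_V: "\<phi> y \<in> V" if "y \<in> W" for y using \<phi>(3) that by auto
  note xV = in_V[OF W(2)]
  have 1: "dd w \<Psi> y = (\<Sum>b\<in>Basis. (dd w \<phi> y \<bullet> b) *\<^sub>R dd b \<sigma> (\<phi> y))" if "y \<in> W" for y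
  proof -
    have "dd w \<Psi> y = dd w (\<lambda>y. \<sigma> (\<phi> y)) y" by (rule dd_cong[OF W(1) that \<Psi>])
    also have "\<dots> = dd (dd w \<phi> y) \<sigma> (\<phi> y)" by (intro dd_compose \<phi> diff in_V that)
    also have "\<dots> = (\<Sum>b\<in>Basis. (dd w \<phi> y \<bullet> b) *\<^sub>R dd b \<sigma> (\<phi> y))"
      by (rule dd_euclidean[OF diff(1)[OF in_V[OF that]]])
    finally show ?thesis .
  qed
  have d: "(\<lambda>y. dd w \<phi> y \<bullet> b) differentiable (at x)" "(\<lambda>y. dd b \<sigma> (\<phi> y)) differentiable (at x)" for b
  proof -
    show "(\<lambda>y. dd w \<phi> y \<bullet> b) differentiable (at x)"
      using \<phi>(2) unfolding differentiable_def using has_derivative_inner_left by blast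
    show "(\<lambda>y. dd b \<sigma> (\<phi> y)) differentiable (at x)"
      using differentiable_chain_at[OF \<phi>(1)[OF W(2)] diff(2)[OF xV]] by (simp add: o_def)
  qed
  have "dd v (dd w \<Psi>) x = dd v (\<lambda>y. \<Sum>b\<in>Basis. (dd w \<phi> y \<bullet> b) *\<^sub>R dd b \<sigma> (\<phi> y)) x"
    by (rule dd_cong[OF W 1])
  also have "\<dots> = (\<Sum>b\<in>Basis. dd v (\<lambda>y. (dd w \<phi> y \<bullet> b) *\<^sub>R dd b \<sigma> (\<phi> y)) x)"
    by (intro dd_sum differentiable_bilinear[OF bounded_bilinear_scaleR] d)
  also have "\<dots> = (\<Sum>b\<in>Basis. (dd w \<phi> x \<bullet> b) *\<^sub>R dd b (dd (dd v \<phi> x) \<sigma>) (\<phi> x)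
      + (dd v (dd w \<phi>) x \<bullet> b) *\<^sub>R dd b \<sigma> (\<phi> x))"
  proof (intro sum.cong refl)
    fix b :: 'b
    have "dd v (\<lambda>y. dd w \<phi> y \<bullet> b) x = dd v (dd w \<phi>) x \<bullet> b"
      by (rule dd_linear[OF bounded_linear_inner_left \<phi>(2)])
    moreover have "dd v (\<lambda>y. dd b \<sigma> (\<phi> y)) x = dd (dd v \<phi> x) (dd b \<sigma>) (\<phi> x)"
      by (intro dd_compose \<phi>(1) W diff xV)
    \<comment> \<open>With the summation index moved to the outer derivative,
      \<open>dd_euclidean\<close> reassembles the sum over the basis.\<close>
    moreover have "dd (dd v \<phi> x) (dd b \<sigma>) (\<phi> x) = dd b (dd (dd v \<phi> x) \<sigma>) (\<phi> x)"
      by (rule dd_commute[OF open_domain xV smooth])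
    ultimately show "dd v (\<lambda>y. (dd w \<phi> y \<bullet> b) *\<^sub>R dd b \<sigma> (\<phi> y)) x =
      (dd w \<phi> x \<bullet> b) *\<^sub>R dd b (dd (dd v \<phi> x) \<sigma>) (\<phi> x) + (dd v (dd w \<phi>) x \<bullet> b) *\<^sub>R dd b \<sigma> (\<phi> x)"
      by (simp only: dd_bilinear[OF bounded_bilinear_scaleR d])
  qed
  also have "\<dots> = dd (dd w \<phi> x) (dd (dd v \<phi> x) \<sigma>) (\<phi> x) + dd (dd v (dd w \<phi>) x) \<sigma> (\<phi> x)"
    by (simp only: sum.distrib dd_euclidean[OF diff(1)[OF xV], symmetric] dd_euclidean[OF diff(2)[OF xV], symmetric])
  also have "dd (dd w \<phi> x) (dd (dd v \<phi> x) \<sigma>) (\<phi> x) = dd (dd v \<phi> x) (dd (dd w \<phi> x) \<sigma>) (\<phi> x)"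
    by (rule dd_commute[OF open_domain xV smooth])
  finally show ?thesis by (simp add: add.commute)
qed

lemma gauss_formula:
  fixes \<phi> :: "'a::euclidean_space \<Rightarrow> 'b"
  assumes W: "open W" "x \<in> W" and \<phi>: "\<And>y. y \<in> W \<Longrightarrow> \<phi> differentiable (at y)"
    "dd w \<phi> differentiable (at x)" "\<phi> ` W \<subseteq> V"
    and \<Psi>: "\<And>y. y \<in> W \<Longrightarrow> \<Psi> y = \<sigma> (\<phi> y)"
  shows "dd v (dd w \<Psi>) x \<bullet> dd \<eta> \<sigma> (\<phi> x) =
    dd (dd v (dd w \<phi>) x + christoffel N i (\<phi> x) (dd v \<phi> x) (dd w \<phi> x)) \<sigma> (\<phi> x) \<bullet> dd \<eta> \<sigma> (\<phi> x)"
proof -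
  have xV: "\<phi> x \<in> V" using \<phi>(3) W by auto
  have "dd v (dd w \<Psi>) x = dd (dd v (dd w \<phi>) x) \<sigma> (\<phi> x) + dd (dd v \<phi> x) (dd (dd w \<phi> x) \<sigma>) (\<phi> x)"
    by (rule second_derivative_compose[OF assms])
  then show ?thesis
    by (simp only: linear_add[OF linear_deriv[OF xV]] inner_add_left christoffel_tangential[OF xV])
qed

end

section \<open>Equations of projective space and of the quadric in the space of matrices\<close>

lemma line_proj_eq: "line_proj z = outer z z"
  by (simp add: line_proj_def outer_def)

lemma norm_eq_1_herm: "norm z = 1 \<longleftrightarrow> herm z z = 1"
  by (simp add: herm_self norm_eq_1)

abbreviation proj_pts :: "(complex ^ 'n ^ 'n) set" where
  "proj_pts \<equiv> {line_proj z |z. norm z = 1}"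

abbreviation quadric_pts :: "(complex ^ 'n ^ 'n) set" where
  "quadric_pts \<equiv> {line_proj z |z. norm z = 1 \<and> (\<Sum>a\<in>UNIV. (z $ a)\<^sup>2) = 0}"

lemma proj_ptsE:
  assumes "P \<in> proj_pts"
  obtains z where "P = outer z z" "herm z z = 1"
  using assms by (auto simp: line_proj_eq norm_eq_1_herm)

lemma quadric_ptsE:
  assumes "P \<in> quadric_pts"
  obtains z where "P = outer z z" "null_unit_vector z"
proof -
  obtain z where z: "P = line_proj z" "norm z = 1" "(\<Sum>a\<in>UNIV. (z $ a)\<^sup>2) = 0"
    using assms by blast
  have "null_unit_vector z"
  proof
    show "herm z z = 1" using z(2) by (simp add: norm_eq_1_herm)
    show "herm z (vcnj z) = 0" using z(3) by (simp add: herm_def vcnj_def power2_eq_square)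
  qed
  with z(1) show ?thesis using that by (simp add: line_proj_eq)
qed

lemma proj_equations:
  assumes "P \<in> proj_pts"
  shows "hermitian P" "P ** P = P"
proof -
  obtain z where z: "P = outer z z" "herm z z = 1" using proj_ptsE[OF assms] .
  then show "hermitian P" "P ** P = P"
    by (simp_all add: hermitian_outer mult_outer outer_mult_vec)
qed

lemma quadric_equation:
  assumes "P \<in> quadric_pts"
  shows "P ** mcnj P = 0"
proof -
  obtain z where z: "P = outer z z" "null_unit_vector z" using quadric_ptsE[OF assms] .
  interpret null_unit_vector z by fact
  have "outer 0 b = (0 :: complex ^ 'a ^ 'a)" for b :: "complex ^ 'a"
    by (simp add: outer_def vec_eq_iff)
  then show ?thesis
    by (simp add: z(1) mcnj_outer mult_outer outer_mult_vec null')
qed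

lemma proj_derivative:
  fixes \<Psi> :: "'a::euclidean_space \<Rightarrow> complex ^ 'n ^ 'n"
  assumes W: "open W" "y \<in> W" and \<Psi>: "smooth_on W \<Psi>" "\<Psi> ` W \<subseteq> proj_pts"
  shows "hermitian (dd v \<Psi> y)" "dd v \<Psi> y ** \<Psi> y + \<Psi> y ** dd v \<Psi> y = dd v \<Psi> y"
    and "hermitian (dd v (dd w \<Psi>) y)"
      "dd v (dd w \<Psi>) y ** \<Psi> y + \<Psi> y ** dd v (dd w \<Psi>) y
        + dd v \<Psi> y ** dd w \<Psi> y + dd w \<Psi> y ** dd v \<Psi> y = dd v (dd w \<Psi>) y"
proof -
  have 1: "hermitian (dd u \<Psi> z)" if "z \<in> W" for u z
    by (rule hermitian_dd[OF W(1) that smooth_onD(3)[OF \<Psi>(1) that]]) (use \<Psi>(2) proj_equations(1) in blast)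
  then show "hermitian (dd v \<Psi> y)" using W(2) .
  show "hermitian (dd v (dd w \<Psi>) y)"
    by (rule hermitian_dd[OF W smooth_onD(3)[OF smooth_onD(2)[OF \<Psi>(1)] W(2)] 1])
  have e: "\<Psi> z ** \<Psi> z = \<Psi> z" if "z \<in> W" for z
    using \<Psi>(2) that by (intro proj_equations(2)) blast
  note D = dd_bilinear_equation[OF bounded_bilinear_matrix_mult W \<Psi>(1) bounded_linear_ident e]
  show "dd v \<Psi> y ** \<Psi> y + \<Psi> y ** dd v \<Psi> y = dd v \<Psi> y" by (rule D(1))
  show "dd v (dd w \<Psi>) y ** \<Psi> y + \<Psi> y ** dd v (dd w \<Psi>) y
        + dd v \<Psi> y ** dd w \<Psi> y + dd w \<Psi> y ** dd v \<Psi> y = dd v (dd w \<Psi>) y" by (rule D(2))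
qed

lemma quadric_derivative:
  fixes \<Psi> :: "'a::euclidean_space \<Rightarrow> complex ^ 'n ^ 'n"
  assumes W: "open W" "y \<in> W" and \<Psi>: "smooth_on W \<Psi>" "\<Psi> ` W \<subseteq> quadric_pts"
  shows "dd v \<Psi> y ** mcnj (\<Psi> y) + \<Psi> y ** mcnj (dd v \<Psi> y) = 0"
    "dd v (dd w \<Psi>) y ** mcnj (\<Psi> y) + \<Psi> y ** mcnj (dd v (dd w \<Psi>) y)
        + dd v \<Psi> y ** mcnj (dd w \<Psi> y) + dd w \<Psi> y ** mcnj (dd v \<Psi> y) = 0"
proof -
  have e: "\<Psi> z ** mcnj (\<Psi> z) = 0" if "z \<in> W" for z
    using \<Psi>(2) that by (intro quadric_equation) blast
  note D = dd_bilinear_equation[OF bounded_bilinear_mult_mcnj W \<Psi>(1) bounded_linear_zero e]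
  show "dd v \<Psi> y ** mcnj (\<Psi> y) + \<Psi> y ** mcnj (dd v \<Psi> y) = 0" by (rule D(1))
  show "dd v (dd w \<Psi>) y ** mcnj (\<Psi> y) + \<Psi> y ** mcnj (dd v (dd w \<Psi>) y)
        + dd v \<Psi> y ** mcnj (dd w \<Psi> y) + dd w \<Psi> y ** mcnj (dd v \<Psi> y) = 0" by (rule D(2))
qed

lemma quadric_subset_proj: "quadric_pts \<subseteq> proj_pts"
  by blast

section \<open>The quadric\<close>

lemma subspace_quadric_horizontal: "subspace (quadric_horizontal z)"
  by (simp add: subspace_def quadric_horizontal_def herm_add_left herm_scaleR_left)

text \<open>The differentiated equations give one inclusion. Equality follows by counting
  dimensions: the left side has dimension \<open>2 * k\<close> since the parametrization is an
  immersion, and the right side has at most this dimension.\<close>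

lemma quadric_tangent_space:
  fixes j :: "(complex ^ 'k) set \<times> (complex ^ 'k \<Rightarrow> complex ^ ('k + 2) ^ ('k::finite + 2))"
  assumes j: "j \<in> idx complex_quadric" and x: "x \<in> cdom complex_quadric j"
    and z: "param complex_quadric j x = outer z z" "null_unit_vector z"
  shows "range (\<lambda>v. dd v (param complex_quadric j) x) = tang z ` quadric_horizontal z"
proof -
  interpret null_unit_vector z by fact
  interpret E: embedded_chart "1/2" quadric_pts j
    using j by unfold_locales (simp_all add: complex_quadric_def)
  let ?\<sigma> = "param complex_quadric j" and ?V = "cdom complex_quadric j"
  have N: "embedded_submanifold (1/2) quadric_pts = complex_quadric"
    by (simp add: complex_quadric_def)
  have sm: "open ?V" "smooth_on ?V ?\<sigma>" "?\<sigma> ` ?V \<subseteq> quadric_pts"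
    using E.open_domain E.smooth E.in_S unfolding N by blast+
  have "?\<sigma> ` ?V \<subseteq> proj_pts" using sm(3) quadric_subset_proj by blast
  note D = proj_derivative(1,2)[OF sm(1) x sm(2) this, unfolded z(1)]
    and Q = quadric_derivative(1)[OF sm(1) x sm(2,3), unfolded z(1)]
  have sub: "range (\<lambda>v. dd v ?\<sigma> x) \<subseteq> tang z ` quadric_horizontal z"
    using quadric_tangent[OF D Q] by blast
  have lin: "linear (\<lambda>v. dd v ?\<sigma> x)" using E.linear_deriv x unfolding N by blast
  have "inj (\<lambda>v. dd v ?\<sigma> x)" using E.immersion x unfolding N by (simp add: eta_contract_eq)
  then have "dim (range (\<lambda>v. dd v ?\<sigma> x)) = dim (UNIV :: (complex ^ 'k) set)"
    by (intro dim_image_eq lin) (auto intro: inj_on_subset)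
  moreover have "dim (tang z ` quadric_horizontal z) \<le> dim (quadric_horizontal z)"
    by (rule dim_image_le[OF linear_tang])
  ultimately have "dim (tang z ` quadric_horizontal z) \<le> dim (range (\<lambda>v. dd v ?\<sigma> x))"
    using dim_quadric_horizontal by simp
  then show ?thesis
    by (intro subspace_dim_equal sub linear_subspace_image[OF lin] linear_subspace_image[OF linear_tang]
        subspace_quadric_horizontal subspace_UNIV)
qed

text \<open>The phase \<open>\<mu>\<close> comes from the unit normal that defines \<open>A\<close>,
  so a single \<open>\<mu>\<close> serves all fixed vectors. The proof carries the shape operator
  from charts to the space of matrices, where \<open>fixed_by_shape_operator\<close>
  applies.\<close>

lemma real_structure_fixed:
  fixes j :: "(complex ^ 'k) set \<times> (complex ^ 'k \<Rightarrow> complex ^ ('k + 2) ^ ('k::finite + 2))"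
  assumes j: "j \<in> idx complex_quadric" and x: "x \<in> cdom complex_quadric j"
    and z: "param complex_quadric j x = outer z z" "null_unit_vector z"
    and A: "A \<in> real_structures j x"
  obtains \<mu> where "cmod \<mu> = 1"
    "\<And>v. A v = v \<Longrightarrow> dd v (param complex_quadric j) x *v z
      = - (\<mu> *s vcnj (dd v (param complex_quadric j) x *v z))"
proof -
  interpret null_unit_vector z by fact
  interpret E: embedded_chart "1/2" quadric_pts j
    using j by unfold_locales (simp_all add: complex_quadric_def)
  define \<sigma> where "\<sigma> = param complex_quadric j"
  define V where "V = cdom complex_quadric j"
  have N: "embedded_submanifold (1/2) quadric_pts = complex_quadric"
    by (simp add: complex_quadric_def)
  have sm: "open V" "smooth_on V \<sigma>" "\<sigma> ` V \<subseteq> quadric_pts" "\<sigma> ` V \<subseteq> proj_pts"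
    using E.open_domain E.smooth E.in_S quadric_subset_proj unfolding N V_def \<sigma>_def by blast+
  note xV = x[folded V_def] and z' = z(1)[folded \<sigma>_def]
  obtain l \<xi> where A': "A = shape_operator complex_quadric complex_projective_space id j l x \<xi>"
    and l: "l \<in> idx (complex_projective_space :: ((complex ^ ('k + 1)) set \<times> _, _, _) rmanifold)"
    and xl: "\<sigma> x \<in> cimage complex_projective_space l"
    and \<xi>: "unit_normal complex_quadric complex_projective_space id j l x \<xi>"
    using A unfolding real_structures_def \<sigma>_def by blast
  interpret P: embedded_chart "1/2" proj_pts l
    using l by unfold_locales (simp_all add: complex_projective_space_def)
  have NP: "embedded_submanifold (1/2) proj_pts = complex_projective_space"
    by (simp add: complex_projective_space_def)
  define \<tau> where "\<tau> = param complex_projective_space l"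
  define T where "T = cdom complex_projective_space l"
  define \<rho> where "\<rho> = local_rep complex_quadric complex_projective_space id j l"
  have P: "open T" "smooth_on T \<tau>" "\<And>y. y \<in> T \<Longrightarrow> inj (frechet_derivative \<tau> (at y))"
    "homeomorphism T (cimage complex_projective_space l) \<tau> (coord complex_projective_space l)"
    "openin (top_of_set proj_pts) (cimage complex_projective_space l)"
    "\<And>y a b. metric complex_projective_space l y a b = 1 / 2 * (dd a \<tau> y \<bullet> dd b \<tau> y)"
    using P.open_domain P.smooth P.immersion P.homeo P.open_image P.metric
    unfolding NP \<tau>_def[symmetric] T_def[symmetric] by auto
  define W where "W = {y \<in> V. \<sigma> y \<in> cimage complex_projective_space l}"
  have W: "open W" "x \<in> W" "W \<subseteq> V"
  proof -
    obtain Y where Y: "open Y" "cimage complex_projective_space l = proj_pts \<inter> Y"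
      using P(5) by (auto simp: openin_open)
    have "W = V \<inter> \<sigma> -` Y" using sm(4) by (auto simp: W_def Y(2))
    then show "open W"
      using continuous_open_preimage[OF smooth_onD(4)[OF sm(2)] sm(1) Y(1)] by simp
  qed (use xV xl in \<open>auto simp: W_def\<close>)
  have \<rho>_eq: "\<rho> y = coord complex_projective_space l (\<sigma> y)" for y
    by (simp add: \<rho>_def local_rep_def \<sigma>_def)
  have \<rho>: "continuous_on W \<rho>" "\<rho> ` W \<subseteq> T" "\<And>y. y \<in> W \<Longrightarrow> \<tau> (\<rho> y) = \<sigma> y"
  proof -
    have "continuous_on (cimage complex_projective_space l) (coord complex_projective_space l)"
      using P(4) by (simp add: homeomorphism_def)
    moreover have "continuous_on W \<sigma>" using smooth_onD(4)[OF sm(2)] W(3) continuous_on_subset by blast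
    ultimately show "continuous_on W \<rho>"
      unfolding \<rho>_eq[abs_def] by (rule continuous_on_compose2) (auto simp: W_def)
    show "\<rho> ` W \<subseteq> T"
      using P(4) by (auto simp: W_def \<rho>_eq homeomorphism_def)
    show "\<And>y. y \<in> W \<Longrightarrow> \<tau> (\<rho> y) = \<sigma> y"
      using P(4) by (auto simp: W_def \<rho>_eq homeomorphism_def)
  qed
  \<comment> \<open>\<open>\<rho>\<close> is the inclusion of the quadric read in the charts
    \<open>j\<close> and \<open>l\<close>; the second fundamental form differentiates it
    twice.\<close>
  have d\<rho>: "\<rho> differentiable (at y)" "dd w \<rho> differentiable (at y)" if "y \<in> W" for y w
    using twice_differentiable_factor_through_immersion[OF P(1-3) W(1) \<rho> smooth_on_subset[OF sm(2) W(3)] that]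
    by auto
  have \<rho>x: "\<rho> x \<in> T" using \<rho>(2) W(2) by blast
  have d\<tau>: "dd (dd v \<rho> x) \<tau> (\<rho> x) = dd v \<sigma> x" for v
  proof -
    have "dd v \<sigma> x = dd v (\<lambda>y. \<tau> (\<rho> y)) x" by (rule dd_cong[OF W(1,2)]) (simp add: \<rho>(3))
    also have "\<dots> = dd (dd v \<rho> x) \<tau> (\<rho> x)"
      by (intro dd_compose d\<rho>(1) W(2) smooth_onD(3)[OF P(2)] \<rho>x)
    finally show ?thesis ..
  qed
  \<comment> \<open>The unit normal as a matrix; the factor \<open>1/2\<close> in the metric turns
    length 1 into \<open>\<Xi> \<bullet> \<Xi> = 2\<close>.\<close>
  define \<Xi> where "\<Xi> = dd \<xi> \<tau> (\<rho> x)"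
  have \<Xi>: "\<Xi> \<bullet> \<Xi> = 2" "dd v \<sigma> x \<bullet> \<Xi> = 0" for v
  proof -
    show "\<Xi> \<bullet> \<Xi> = 2"
      using \<xi> by (simp add: unit_normal_def P(6) \<rho>_def[symmetric] \<Xi>_def)
    have "metric complex_projective_space l (\<rho> x) (dd v \<rho> x) \<xi> = 0"
      using \<xi> by (simp add: unit_normal_def \<rho>_def)
    then show "dd v \<sigma> x \<bullet> \<Xi> = 0" by (simp add: P(6) \<Xi>_def d\<tau>)
  qed
  have lin\<tau>: "linear (\<lambda>v. dd v \<tau> (\<rho> x))"
    using P.linear_deriv \<rho>x unfolding NP \<tau>_def T_def by blast
  \<comment> \<open>By the Gauss formula in projective space, the covariant derivative may be
    replaced by the second derivative of \<open>\<sigma>\<close> as a matrix-valued map. The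
    subtracted Christoffel term of the quadric is tangent to the quadric and vanishes against
    \<open>\<Xi>\<close>.\<close>
  have II: "metric complex_projective_space l (\<rho> x)
      (second_fundamental_form complex_quadric complex_projective_space id j l x v w) \<xi>
      = 1 / 2 * (dd v (dd w \<sigma>) x \<bullet> \<Xi>)" for v w
  proof -
    have G: "dd v (dd w \<sigma>) x \<bullet> \<Xi> = dd (dd v (dd w \<rho>) x
        + christoffel complex_projective_space l (\<rho> x) (dd v \<rho> x) (dd w \<rho> x)) \<tau> (\<rho> x) \<bullet> \<Xi>"
      using P.gauss_formula[where \<phi>=\<rho> and \<Psi>=\<sigma> and W=W and x=x and v=v and w=w and \<eta>=\<xi>]
        W d\<rho> \<rho> unfolding NP \<tau>_def[symmetric] T_def[symmetric] \<Xi>_def by auto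
    show ?thesis
      unfolding second_fundamental_form_def Let_def \<rho>_def[symmetric] P(6) \<Xi>_def[symmetric]
        linear_diff[OF lin\<tau>] inner_diff_left d\<tau> \<Xi>(2) G by simp
  qed
  \<comment> \<open>For a fixed vector the defining equation of the shape operator equates the first
    fundamental form with the second one in direction \<open>\<Xi>\<close>.\<close>
  have fixedD: "dd v \<sigma> x \<bullet> dd w \<sigma> x = dd v (dd w \<sigma>) x \<bullet> \<Xi>" if "A v = v" for v w
  proof -
    have l: "linear (\<lambda>w. dd v (dd w \<sigma>) x)"
      using E.second_derivative_linear x unfolding N \<sigma>_def by blast
    have lin: "linear (\<lambda>w. 1 / 2 * (dd v (dd w \<sigma>) x \<bullet> \<Xi>))"
      by (intro linearI) (simp_all add: linear_add[OF l] linear_cmul[OF l] algebra_simps)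
    have m: "metric complex_quadric j x a b = 1 / 2 * (dd a \<sigma> x \<bullet> dd b \<sigma> x)" for a b
      using E.metric unfolding N \<sigma>_def by simp
    have eq: "A v = (THE u. \<forall>w. 1 / 2 * (dd u \<sigma> x \<bullet> dd w \<sigma> x) = 1 / 2 * (dd v (dd w \<sigma>) x \<bullet> \<Xi>))"
      unfolding A' shape_operator_def \<rho>_def[symmetric] II m ..
    have "\<exists>!u. \<forall>w. 1 / 2 * (dd u \<sigma> x \<bullet> dd w \<sigma> x) = 1 / 2 * (dd v (dd w \<sigma>) x \<bullet> \<Xi>)"
      by (rule E.ex1_metric_representation[unfolded N, folded \<sigma>_def, OF x lin]) simp
    from theI'[OF this] have "\<forall>w. 1 / 2 * (dd (A v) \<sigma> x \<bullet> dd w \<sigma> x) = 1 / 2 * (dd v (dd w \<sigma>) x \<bullet> \<Xi>)"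
      unfolding eq .
    then show ?thesis using that by simp
  qed
  have tan: "range (\<lambda>v. dd v \<sigma> x) = tang z ` quadric_horizontal z"
    using quadric_tangent_space[OF j x z] unfolding \<sigma>_def .
  have \<Xi>_eq: "\<Xi> = tang z (\<Xi> *v z)" "herm (\<Xi> *v z) z = 0"
  proof -
    have T: "\<tau> ` T \<subseteq> proj_pts" using P.in_S unfolding NP \<tau>_def T_def by blast
    have "\<tau> (\<rho> x) = outer z z" using \<rho>(3)[OF W(2)] z' by simp
    note D = proj_derivative(1,2)[OF P(1) \<rho>x P(2) T, unfolded this, of \<xi>, folded \<Xi>_def]
    show "\<Xi> = tang z (\<Xi> *v z)" "herm (\<Xi> *v z) z = 0"
      using projective_tangent[OF D] by auto
  qed
  obtain \<mu> where \<mu>: "cmod \<mu> = 1" "\<Xi> *v z = \<mu> *s vcnj z"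
  proof (rule normal_vector[OF \<Xi>_eq(2)])
    show "tang z (\<Xi> *v z) \<bullet> tang z (\<Xi> *v z) = 2" using \<Xi>(1) \<Xi>_eq(1) by simp
    fix \<kappa> assume "\<kappa> \<in> quadric_horizontal z"
    then obtain v where "tang z \<kappa> = dd v \<sigma> x" using tan by (metis (mono_tags) imageE imageI)
    then show "tang z (\<Xi> *v z) \<bullet> tang z \<kappa> = 0"
      using \<Xi>(2) \<Xi>_eq(1) by (simp add: inner_commute)
  qed
  show ?thesis
  proof (rule that[OF \<mu>(1)], fold \<sigma>_def)
    fix v assume v: "A v = v"
    note D = proj_derivative[OF sm(1) xV sm(2,4), unfolded z']
      and Q = quadric_derivative[OF sm(1) xV sm(2,3), unfolded z']
    have t: "dd u \<sigma> x = tang z (dd u \<sigma> x *v z)" "dd u \<sigma> x *v z \<in> quadric_horizontal z" for u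
      using quadric_tangent[OF D(1,2) Q(1)] by auto
    show "dd v \<sigma> x *v z = - (\<mu> *s vcnj (dd v \<sigma> x *v z))"
    proof (rule fixed_by_shape_operator[OF t(2)])
      fix \<eta> assume \<eta>: "\<eta> \<in> quadric_horizontal z"
      then obtain w where w: "dd w \<sigma> x = tang z \<eta>" using tan by (metis (mono_tags) imageE imageI)
      have "herm (dd v (dd w \<sigma>) x *v z) (vcnj z) = - herm (dd v \<sigma> x *v z) (vcnj \<eta>)"
        by (rule quadric_second_derivative(3)[OF t(2) \<eta> t(1) w D(3,4) Q(2)])
      moreover have "tang z (dd v \<sigma> x *v z) \<bullet> tang z \<eta> = dd v (dd w \<sigma>) x \<bullet> tang z (\<mu> *s vcnj z)"
        using fixedD[OF v, of w] w t(1)[of v] \<Xi>_eq(1) \<mu>(2) by simp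
      ultimately show "\<exists>S. hermitian S \<and> herm (S *v z) (vcnj z) = - herm (dd v \<sigma> x *v z) (vcnj \<eta>) \<and>
          tang z (dd v \<sigma> x *v z) \<bullet> tang z \<eta> = S \<bullet> tang z (\<mu> *s vcnj z)"
        using D(3) by blast
    qed
  qed
qed

text \<open>\<open>tg\<close> expresses total geodesy: covariant derivatives of coordinate fields in
  the quadric stay in the span of the two coordinate directions. Hence each second derivative of
  \<open>\<Psi>\<close> is a combination of \<open>X\<close> and \<open>Y\<close> plus a vector
  normal to the quadric. The conditions \<open>S \<bullet> Y = 0\<close> and
  \<open>T \<bullet> X = 0\<close> leave one tangential coefficient in each case.\<close>

lemma totally_geodesic_gauss:
  fixes j :: "(complex ^ 'k) set \<times> (complex ^ 'k \<Rightarrow> complex ^ ('k + 2) ^ ('k::finite + 2))"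
    and \<phi> :: "'m::euclidean_space \<Rightarrow> complex ^ 'k"
  defines "\<Psi> \<equiv> \<lambda>y. param complex_quadric j (\<phi> y)"
  assumes j: "j \<in> idx complex_quadric" and W: "open W" "x \<in> W"
    and \<phi>: "smooth_on W \<phi>" "\<phi> ` W \<subseteq> cdom complex_quadric j"
    and A: "A \<in> real_structures j (\<phi> x)" "range (frechet_derivative \<phi> (at x)) \<subseteq> V_of A"
    and tg: "\<And>a b. \<exists>c d. dd a (dd b \<phi>) x + christoffel complex_quadric j (\<phi> x) (dd a \<phi> x) (dd b \<phi> x)
        = dd (c *\<^sub>R v + d *\<^sub>R w) \<phi> x"
    and X: "dd v \<Psi> x = X" "X \<noteq> 0" and Y: "dd w \<Psi> x = Y" "Y \<noteq> 0" and XY: "X \<bullet> Y = 0"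
    and S: "dd v (dd v \<Psi>) x = S" "S \<bullet> Y = 0" and T: "dd v (dd w \<Psi>) x = T" "T \<bullet> X = 0"
    and U: "dd w (dd w \<Psi>) x = U"
  shows "S \<bullet> U = (S \<bullet> X) / (X \<bullet> X) * (U \<bullet> X) + 3 / 2 * (X \<bullet> X) * (Y \<bullet> Y)"
    "T \<bullet> T = (T \<bullet> Y)\<^sup>2 / (Y \<bullet> Y) + 1 / 2 * (X \<bullet> X) * (Y \<bullet> Y)"
proof -
  interpret E: embedded_chart "1/2" quadric_pts j
    using j by unfold_locales (simp_all add: complex_quadric_def)
  have N: "embedded_submanifold (1/2) quadric_pts = complex_quadric"
    by (simp add: complex_quadric_def)
  define \<sigma> where "\<sigma> = param complex_quadric j"
  have \<phi>x: "\<phi> x \<in> cdom complex_quadric j" using \<phi>(2) W(2) by blast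
  have \<sigma>: "smooth_on (cdom complex_quadric j) \<sigma>" "\<sigma> ` cdom complex_quadric j \<subseteq> quadric_pts"
    using E.smooth E.in_S unfolding N \<sigma>_def by blast+
  have \<Psi>: "smooth_on W \<Psi>" "\<Psi> ` W \<subseteq> quadric_pts" "\<Psi> ` W \<subseteq> proj_pts"
  proof -
    show "smooth_on W \<Psi>"
      unfolding \<Psi>_def by (rule smooth_on_compose[OF W(1) \<sigma>(1) \<phi>, unfolded \<sigma>_def])
    show "\<Psi> ` W \<subseteq> quadric_pts" using \<sigma>(2) \<phi>(2) unfolding \<Psi>_def \<sigma>_def by blast
    then show "\<Psi> ` W \<subseteq> proj_pts" using quadric_subset_proj by blast
  qed
  have "\<Psi> x \<in> quadric_pts" using \<Psi>(2) W(2) by blast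
  then obtain z where z: "\<Psi> x = outer z z" "null_unit_vector z"
    by (rule quadric_ptsE)
  interpret null_unit_vector z by fact
  have z': "param complex_quadric j (\<phi> x) = outer z z" using z(1) by (simp add: \<Psi>_def)
  have d\<phi>: "\<phi> differentiable (at y)" "dd a \<phi> differentiable (at y)" if "y \<in> W" for y a
    using smooth_onD(3)[OF \<phi>(1) that] smooth_onD(3)[OF smooth_onD(2)[OF \<phi>(1)] that] by auto
  have d\<Psi>: "dd a \<Psi> x = dd (dd a \<phi> x) \<sigma> (\<phi> x)" for a
    unfolding \<Psi>_def \<sigma>_def[symmetric] by (intro dd_compose d\<phi>(1) W(2) smooth_onD(3)[OF \<sigma>(1) \<phi>x])
  obtain \<mu> where \<mu>: "cmod \<mu> = 1" "\<And>u. A u = u \<Longrightarrow> dd u \<sigma> (\<phi> x) *v z = - (\<mu> *s vcnj (dd u \<sigma> (\<phi> x) *v z))"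
    using real_structure_fixed[OF j \<phi>x z' z(2) A(1)] unfolding \<sigma>_def by metis
  have "A (dd a \<phi> x) = dd a \<phi> x" for a using A(2) by (auto simp: V_of_def)
  with \<mu>(2) have re: "dd a \<Psi> x *v z = - (\<mu> *s vcnj (dd a \<Psi> x *v z))" for a
    unfolding d\<Psi> by blast
  note D = proj_derivative[OF W \<Psi>(1,3), unfolded z(1)] and Q = quadric_derivative[OF W \<Psi>(1,2), unfolded z(1)]
  have t: "dd a \<Psi> x = tang z (dd a \<Psi> x *v z)" "dd a \<Psi> x *v z \<in> quadric_horizontal z" for a
    using quadric_tangent[OF D(1,2) Q(1)] by auto
  have normal: "\<exists>c d. \<forall>\<kappa>\<in>quadric_horizontal z. (dd a (dd b \<Psi>) x - (c *\<^sub>R X + d *\<^sub>R Y)) \<bullet> tang z \<kappa> = 0" for a b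
  proof -
    obtain c d where cd: "dd a (dd b \<phi>) x + christoffel complex_quadric j (\<phi> x) (dd a \<phi> x) (dd b \<phi> x)
        = dd (c *\<^sub>R v + d *\<^sub>R w) \<phi> x" using tg by blast
    have G: "dd a (dd b \<Psi>) x \<bullet> dd \<eta> \<sigma> (\<phi> x) = dd (c *\<^sub>R v + d *\<^sub>R w) \<Psi> x \<bullet> dd \<eta> \<sigma> (\<phi> x)" for \<eta>
    proof -
      have "dd a (dd b \<Psi>) x \<bullet> dd \<eta> \<sigma> (\<phi> x) = dd (dd (c *\<^sub>R v + d *\<^sub>R w) \<phi> x) \<sigma> (\<phi> x) \<bullet> dd \<eta> \<sigma> (\<phi> x)"
        unfolding cd[symmetric] \<sigma>_def
        by (rule E.gauss_formula[unfolded N]) (use W d\<phi> \<phi>(2) in \<open>auto simp: \<Psi>_def\<close>)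
      then show ?thesis unfolding d\<Psi> .
    qed
    have XY': "dd (c *\<^sub>R v + d *\<^sub>R w) \<Psi> x = c *\<^sub>R X + d *\<^sub>R Y"
      using X(1) Y(1) smooth_onD(3)[OF \<Psi>(1) W(2)] by (simp add: dd_add dd_scaleR)
    have "(dd a (dd b \<Psi>) x - (c *\<^sub>R X + d *\<^sub>R Y)) \<bullet> tang z \<kappa> = 0" if "\<kappa> \<in> quadric_horizontal z" for \<kappa>
    proof -
      have "tang z \<kappa> \<in> range (\<lambda>v. dd v \<sigma> (\<phi> x))"
        using quadric_tangent_space[OF j \<phi>x z' z(2)] that unfolding \<sigma>_def by blast
      then show ?thesis using G by (auto simp: inner_diff_left XY')
    qed
    then show ?thesis by blast
  qed
  define \<zeta> where "\<zeta> = X *v z"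
  define \<eta> where "\<eta> = Y *v z"
  have XX: "X \<bullet> X \<noteq> 0" "Y \<bullet> Y \<noteq> 0" using X Y by auto
  have \<zeta>: "X = tang z \<zeta>" "\<zeta> \<in> quadric_horizontal z" "\<zeta> = - (\<mu> *s vcnj \<zeta>)"
    using t[of v] re[of v] unfolding X(1) \<zeta>_def by auto
  have \<eta>: "Y = tang z \<eta>" "\<eta> \<in> quadric_horizontal z" "\<eta> = - (\<mu> *s vcnj \<eta>)"
    using t[of w] re[of w] unfolding Y(1) \<eta>_def by auto
  obtain c d where cd: "\<And>\<kappa>. \<kappa> \<in> quadric_horizontal z \<Longrightarrow> (S - (c *\<^sub>R X + d *\<^sub>R Y)) \<bullet> tang z \<kappa> = 0"
    using normal[of v v] S(1) by blast
  have "S \<bullet> Y = d * (Y \<bullet> Y)" "S \<bullet> X = c * (X \<bullet> X)"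
    using cd[OF \<eta>(2), folded \<eta>(1)] cd[OF \<zeta>(2), folded \<zeta>(1)] XY inner_commute[of X Y]
    by (simp_all add: inner_diff_left inner_add_left)
  then have c: "c = (S \<bullet> X) / (X \<bullet> X)" "d = 0" using XX S(2) by auto
  \<comment> \<open>In \<open>dd a (dd b \<Psi>)\<close> the inner direction \<open>b\<close> occurs
    first once \<open>dd\<close> is expanded, so \<open>[of w v]\<close> yields the statement for
    \<open>dd v (dd w \<Psi>)\<close>.\<close>
  obtain c' d' where cd': "\<And>\<kappa>. \<kappa> \<in> quadric_horizontal z \<Longrightarrow> (T - (c' *\<^sub>R X + d' *\<^sub>R Y)) \<bullet> tang z \<kappa> = 0"
    using normal[of w v] T(1) by blast
  have "T \<bullet> Y = d' * (Y \<bullet> Y)" "T \<bullet> X = c' * (X \<bullet> X)"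
    using cd'[OF \<eta>(2), folded \<eta>(1)] cd'[OF \<zeta>(2), folded \<zeta>(1)] XY inner_commute[of X Y]
    by (simp_all add: inner_diff_left inner_add_left)
  then have d': "d' = (T \<bullet> Y) / (Y \<bullet> Y)" "c' = 0" using XX T(2) by auto
  have oS: "(S - c *\<^sub>R X) \<bullet> tang z \<kappa> = 0" if "\<kappa> \<in> quadric_horizontal z" for \<kappa>
    using cd[OF that] c(2) by simp
  have oT: "(T - d' *\<^sub>R Y) \<bullet> tang z \<kappa> = 0" if "\<kappa> \<in> quadric_horizontal z" for \<kappa>
    using cd'[OF that] d'(2) by simp
  note DS = D(3,4)[of v v, unfolded S(1) X(1)] Q(2)[of v v, unfolded S(1) X(1)]
    and DT = D(3,4)[of w v, unfolded T(1) X(1) Y(1)] Q(2)[of w v, unfolded T(1) X(1) Y(1)]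
    and DU = D(3,4)[of w w, unfolded U Y(1)] Q(2)[of w w, unfolded U Y(1)]
  note R = totally_real_gauss[OF \<zeta>(2,3) \<eta>(2,3) \<mu>(1) XY \<zeta>(1) \<eta>(1) DS oS DT oT DU]
  show "S \<bullet> U = (S \<bullet> X) / (X \<bullet> X) * (U \<bullet> X) + 3 / 2 * (X \<bullet> X) * (Y \<bullet> Y)"
    using R(1) unfolding c(1) .
  show "T \<bullet> T = (T \<bullet> Y)\<^sup>2 / (Y \<bullet> Y) + 1 / 2 * (X \<bullet> X) * (Y \<bullet> Y)"
    using R(2) XX unfolding d'(1) by (simp add: power2_eq_square)
qed

section \<open>Curvature of a warped surface\<close>

text \<open>Differentiating \<open>|\<Psi>\<^sub>w|\<^sup>2 = 2 u\<^sup>2 G\<close> twice in the direction \<open>v\<close> produces \<open>\<Psi>\<^sub>v\<^sub>v\<^sub>w \<bullet> \<Psi>\<^sub>w\<close>, which is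
  \<open>- \<Psi>\<^sub>v\<^sub>v \<bullet> \<Psi>\<^sub>w\<^sub>w\<close> because \<open>\<Psi>\<^sub>v\<^sub>v\<close> is orthogonal to \<open>\<Psi>\<^sub>w\<close>.\<close>

lemma warped_surface_equation:
  fixes \<Psi> :: "'m::euclidean_space \<Rightarrow> 'e::euclidean_space" and E u G :: "'m \<Rightarrow> real"
  assumes W: "open W" "x \<in> W" and \<Psi>: "smooth_on W \<Psi>"
    and d: "\<And>z. z \<in> W \<Longrightarrow> E differentiable (at z)" "\<And>z. z \<in> W \<Longrightarrow> u differentiable (at z)"
      "dd v u differentiable (at x)" "\<And>z. z \<in> W \<Longrightarrow> G differentiable (at z)"
    and indep: "\<And>z. z \<in> W \<Longrightarrow> dd w E z = 0" "\<And>z. z \<in> W \<Longrightarrow> dd v G z = 0"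
    and pos: "E x > 0" "u x > 0" "G x > 0"
    and metric: "\<And>z. z \<in> W \<Longrightarrow> dd v \<Psi> z \<bullet> dd v \<Psi> z = 2 * E z"
      "\<And>z. z \<in> W \<Longrightarrow> dd v \<Psi> z \<bullet> dd w \<Psi> z = 0"
      "\<And>z. z \<in> W \<Longrightarrow> dd w \<Psi> z \<bullet> dd w \<Psi> z = 2 * ((u z * u z) * G z)"
    and X: "dd v \<Psi> x = X" and Y: "dd w \<Psi> x = Y"
    and S: "dd v (dd v \<Psi>) x = S" and T: "dd v (dd w \<Psi>) x = T" and U: "dd w (dd w \<Psi>) x = U"
    and gauss: "S \<bullet> Y = 0 \<Longrightarrow> T \<bullet> X = 0 \<Longrightarrow>
        S \<bullet> U = (S \<bullet> X) / (X \<bullet> X) * (U \<bullet> X) + 3 / 2 * (X \<bullet> X) * (Y \<bullet> Y)"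
      "S \<bullet> Y = 0 \<Longrightarrow> T \<bullet> X = 0 \<Longrightarrow>
        T \<bullet> T = (T \<bullet> Y)\<^sup>2 / (Y \<bullet> Y) + 1 / 2 * (X \<bullet> X) * (Y \<bullet> Y)"
  shows "dd v E x * dd v u x / (2 * (E x)\<^sup>2) - dd v (dd v u) x / E x = 2 * u x"
proof -
  have d\<Psi>: "dd a \<Psi> differentiable (at z)" "dd a (dd b \<Psi>) differentiable (at z)" if "z \<in> W" for a b z
    using smooth_onD(3)[OF smooth_onD(2)[OF \<Psi>] that]
      smooth_onD(3)[OF smooth_onD(2)[OF smooth_onD(2)[OF \<Psi>]] that] by auto
  have comm: "dd a (dd b \<Psi>) z = dd b (dd a \<Psi>) z" if "z \<in> W" for a b z
    by (rule dd_commute[OF W(1) that \<Psi>])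
  have inn: "dd a (\<lambda>y. p y \<bullet> q y) z = p z \<bullet> dd a q z + dd a p z \<bullet> q z"
    if "p differentiable (at z)" "q differentiable (at z)" for a z and p q :: "'m \<Rightarrow> 'e"
    using that by (rule dd_bilinear[OF bounded_bilinear_inner])
  have mul: "dd a (\<lambda>y. p y * q y) z = p z * dd a q z + dd a p z * q z"
    if "p differentiable (at z)" "q differentiable (at z)" for a z and p q :: "'m \<Rightarrow> real"
    using that by (rule dd_bilinear[OF bounded_bilinear_mult])
  have twice: "dd a (\<lambda>y. 2 * p y) z = 2 * dd a p z"
    if "p differentiable (at z)" for a z and p :: "'m \<Rightarrow> real"
    using that by (rule dd_linear[OF bounded_linear_mult_right])
  have metric_dd: "dd b \<Psi> z \<bullet> dd a (dd b \<Psi>) z = dd a E z" if "z \<in> W" "b = v" for a b z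
  proof -
    have "dd a (\<lambda>y. dd v \<Psi> y \<bullet> dd v \<Psi> y) z = dd a (\<lambda>y. 2 * E y) z"
      by (rule dd_cong[OF W(1) that(1) metric(1)])
    then show ?thesis
      unfolding inn[OF d\<Psi>(1)[OF that(1)] d\<Psi>(1)[OF that(1)]] twice[OF d(1)[OF that(1)]] that(2)
      by (simp add: inner_commute)
  qed
  have cross: "dd v \<Psi> z \<bullet> dd a (dd w \<Psi>) z + dd a (dd v \<Psi>) z \<bullet> dd w \<Psi> z = 0" if "z \<in> W" for a z
  proof -
    have "dd a (\<lambda>y. dd v \<Psi> y \<bullet> dd w \<Psi> y) z = dd a (\<lambda>y. 0) z"
      by (rule dd_cong[OF W(1) that metric(2)])
    then show ?thesis unfolding inn[OF d\<Psi>(1)[OF that] d\<Psi>(1)[OF that]] by simp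
  qed
  have vw_v: "dd v \<Psi> z \<bullet> dd v (dd w \<Psi>) z = 0" if "z \<in> W" for z
    using metric_dd[OF that refl, of w] indep(1)[OF that] comm[OF that, of v w] by simp
  have vv_w: "dd v (dd v \<Psi>) z \<bullet> dd w \<Psi> z = 0" if "z \<in> W" for z
    using cross[OF that, of v] vw_v[OF that] by simp
  define Z where "Z = dd v (dd v (dd w \<Psi>)) x"
  have "dd w (\<lambda>y. dd v (dd v \<Psi>) y \<bullet> dd w \<Psi> y) x = dd w (\<lambda>y. 0) x"
    by (rule dd_cong[OF W vv_w])
  then have 1: "S \<bullet> U + dd w (dd v (dd v \<Psi>)) x \<bullet> Y = 0"
    unfolding inn[OF d\<Psi>(2,1)[OF W(2)]] S U Y by simp
  have "dd w (dd v (dd v \<Psi>)) x = dd v (dd w (dd v \<Psi>)) x"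
    by (rule dd_commute[OF W smooth_onD(2)[OF \<Psi>]])
  also have "\<dots> = Z"
    unfolding Z_def by (rule dd_cong[OF W comm])
  finally have ZY: "Z \<bullet> Y = - (S \<bullet> U)" using 1 by simp
  have w_vw: "dd w \<Psi> z \<bullet> dd v (dd w \<Psi>) z = 2 * ((u z * dd v u z) * G z)" if "z \<in> W" for z
  proof -
    have du: "(\<lambda>y. u y * u y) differentiable (at z)"
      by (intro differentiable_bilinear[OF bounded_bilinear_mult] d(2) that)
    have "dd v (\<lambda>y. dd w \<Psi> y \<bullet> dd w \<Psi> y) z = dd v (\<lambda>y. 2 * ((u y * u y) * G y)) z"
      by (rule dd_cong[OF W(1) that metric(3)])
    also have "\<dots> = 2 * (2 * (u z * dd v u z) * G z)"
      unfolding twice[OF differentiable_bilinear[OF bounded_bilinear_mult du d(4)[OF that]]]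
        mul[OF du d(4)[OF that]] mul[OF d(2)[OF that] d(2)[OF that]] indep(2)[OF that]
      by (simp add: algebra_simps)
    finally show ?thesis
      unfolding inn[OF d\<Psi>(1)[OF that] d\<Psi>(1)[OF that]] by (simp add: inner_commute)
  qed
  have du: "(\<lambda>y. u y * dd v u y) differentiable (at x)"
    by (intro differentiable_bilinear[OF bounded_bilinear_mult] d(2,3) W(2))
  have "dd v (\<lambda>y. dd w \<Psi> y \<bullet> dd v (dd w \<Psi>) y) x = dd v (\<lambda>y. 2 * ((u y * dd v u y) * G y)) x"
    by (rule dd_cong[OF W w_vw])
  then have 2: "Y \<bullet> Z + T \<bullet> T = 2 * ((u x * dd v (dd v u) x + dd v u x * dd v u x) * G x)"
    unfolding inn[OF d\<Psi>(1,2)[OF W(2)]] twice[OF differentiable_bilinear[OF bounded_bilinear_mult du d(4)[OF W(2)]]]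
      mul[OF du d(4)[OF W(2)]] mul[OF d(2)[OF W(2)] d(3)] indep(2)[OF W(2)] Y T Z_def by simp
  have XX: "X \<bullet> X = 2 * E x" "Y \<bullet> Y = 2 * ((u x * u x) * G x)"
    using metric(1,3)[OF W(2)] X Y by simp_all
  have SX: "S \<bullet> X = dd v E x"
    using metric_dd[OF W(2) refl, of v] X S by (simp add: inner_commute)
  \<comment> \<open>These two orthogonality relations discharge the premises of
    \<open>gauss\<close>. They hold because the coordinates are orthogonal and \<open>E\<close> does
    not vary in direction \<open>w\<close>.\<close>
  have SY: "S \<bullet> Y = 0" using vv_w[OF W(2)] S Y by simp
  have TX: "T \<bullet> X = 0" using vw_v[OF W(2)] T X by (simp add: inner_commute)
  have TY: "T \<bullet> Y = 2 * ((u x * dd v u x) * G x)"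
    using w_vw[OF W(2)] T Y by (simp add: inner_commute)
  \<comment> \<open>Derivative in direction \<open>w\<close> of the orthogonality of the coordinate
    vectors.\<close>
  have UX: "U \<bullet> X = - (T \<bullet> Y)"
    using cross[OF W(2), of w] comm[OF W(2), of w v] X Y T U by (simp add: inner_commute)
  define a b c e where "a = u x" and "b = dd v u x" and "c = dd v (dd v u) x" and "e = E x"
  define g where "g = G x"
  define e' where "e' = dd v E x"
  note ab = a_def[symmetric] b_def[symmetric] c_def[symmetric] e_def[symmetric] g_def[symmetric] e'_def[symmetric]
  have p: "a > 0" "e > 0" "g > 0" using pos by (auto simp: a_def e_def g_def)
  have SU: "S \<bullet> U = e' / (2 * e) * (- (2 * (a * b * g))) + 3 / 2 * (2 * e) * (2 * (a * a * g))"
    using gauss(1)[OF SY TX] unfolding SX XX UX TY ab .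
  have TT: "T \<bullet> T = (2 * (a * b * g))\<^sup>2 / (2 * (a * a * g)) + 1 / 2 * (2 * e) * (2 * (a * a * g))"
    using gauss(2)[OF SY TX] unfolding XX TY ab .
  have TT': "(2 * (a * b * g))\<^sup>2 / (2 * (a * a * g)) = 2 * b * b * g"
    using p by (simp add: power2_eq_square field_simps)
  have SU': "e' / (2 * e) * (- (2 * (a * b * g))) = - (2 * a * g) * (e' * b / (2 * e))"
    using p by (simp add: field_simps)
  \<comment> \<open>The squares of \<open>b\<close> cancel, and the Gauss terms leave
    \<open>6 - 2 = 4\<close> times \<open>e * a * a * g\<close>. After division by
    \<open>2 * a * g\<close>, and then by \<open>e\<close>, this is the value
    \<open>2 * a\<close>.\<close>
  have "(2 * a * g) * (e' * b / (2 * e) - 2 * e * a) = (2 * a * g) * c"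
    using 2 ZY unfolding inner_commute[of Y Z] SU TT TT' SU' ab by (simp add: algebra_simps)
  then have "e' * b / (2 * e) - 2 * e * a = c"
    using p by (metis mult_cancel_left mult_pos_pos less_irrefl zero_less_numeral)
  then have "e' * b / (2 * e\<^sup>2) - c / e = 2 * a"
    using p by (auto simp: power2_eq_square field_simps)
  then show ?thesis unfolding a_def b_def c_def e_def e'_def .
qed

section \<open>The Laplacian of a one-dimensional Riemannian manifold\<close>

text \<open>With arc length \<open>s\<close>, where \<open>ds = sqrt E dx\<close>, this is minus the
  second derivative of \<open>u\<close> with respect to \<open>s\<close>, written in the coordinate
  \<open>x\<close>.\<close>

definition laplacian_1d ::
  "('i, 'p, 'b::euclidean_space) rmanifold \<Rightarrow> 'b \<Rightarrow> 'i \<Rightarrow> ('b \<Rightarrow> real) \<Rightarrow> 'b \<Rightarrow> real" where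
  "laplacian_1d M b i u x = (let E = (\<lambda>y. metric M i y b b) in
     dd b E x * dd b u x / (2 * (E x)\<^sup>2) - dd b (dd b u) x / E x)"

lemma riemannianD:
  assumes "riemannian_manifold M"
  shows "pts M = (\<Union>i\<in>idx M. cimage M i)"
    "i \<in> idx M \<Longrightarrow> open (cdom M i)"
    "i \<in> idx M \<Longrightarrow> openin (top_of_set (pts M)) (cimage M i)"
    "i \<in> idx M \<Longrightarrow> homeomorphism (cdom M i) (cimage M i) (param M i) (coord M i)"
    "i \<in> idx M \<Longrightarrow> j \<in> idx M \<Longrightarrow>
      smooth_on {x \<in> cdom M i. param M i x \<in> cimage M j} (local_rep M M id i j)"
    "i \<in> idx M \<Longrightarrow> x \<in> cdom M i \<Longrightarrow> bilinear (metric M i x)"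
    "i \<in> idx M \<Longrightarrow> x \<in> cdom M i \<Longrightarrow> metric M i x v w = metric M i x w v"
    "i \<in> idx M \<Longrightarrow> x \<in> cdom M i \<Longrightarrow> v \<noteq> 0 \<Longrightarrow> metric M i x v v > 0"
    "i \<in> idx M \<Longrightarrow> smooth_on (cdom M i) (\<lambda>x. metric M i x v w)"
    "i \<in> idx M \<Longrightarrow> j \<in> idx M \<Longrightarrow> x \<in> cdom M i \<Longrightarrow> param M i x \<in> cimage M j \<Longrightarrow>
      metric M i x v w = metric M j (local_rep M M id i j x)
        (frechet_derivative (local_rep M M id i j) (at x) v)
        (frechet_derivative (local_rep M M id i j) (at x) w)"
  using assms unfolding riemannian_manifold_def by blast+

locale riemannian_line =
  fixes B :: "('i, 'p::{t2_space,second_countable_topology}, 'b::euclidean_space) rmanifold" and b :: 'b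
  assumes B: "riemannian_manifold B" and Basis_eq: "Basis = {b}"
begin

lemma inner_b: "b \<bullet> b = 1"
  by (rule inner_same_Basis) (unfold Basis_eq, simp)

lemma vec_eq: "v = (v \<bullet> b) *\<^sub>R b"
  using euclidean_representation[of v, symmetric] unfolding Basis_eq by simp

lemma dd_b: "u differentiable (at x) \<Longrightarrow> dd v u x = (v \<bullet> b) *\<^sub>R dd b u x"
  using dd_euclidean[of u x v] unfolding Basis_eq by simp

context
  fixes i assumes i: "i \<in> idx B"
begin

definition E where "E = (\<lambda>y. metric B i y b b)"

lemma metric_eq: "x \<in> cdom B i \<Longrightarrow> metric B i x v w = (v \<bullet> b) * (w \<bullet> b) * E x"
proof -
  assume "x \<in> cdom B i"
  note bil = riemannianD(6)[OF B i this]
  have "metric B i x v w = metric B i x ((v \<bullet> b) *\<^sub>R b) ((w \<bullet> b) *\<^sub>R b)"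
    by (rule arg_cong2[OF vec_eq vec_eq])
  then show ?thesis by (simp add: bilinear_lmul[OF bil] bilinear_rmul[OF bil] E_def)
qed

lemma E_pos: "x \<in> cdom B i \<Longrightarrow> E x > 0"
  using riemannianD(8)[OF B i, of x b] inner_b unfolding E_def by fastforce

lemma E_smooth: "smooth_on (cdom B i) E"
  unfolding E_def by (rule riemannianD(9)[OF B i])

lemma dd_metric:
  assumes "x \<in> cdom B i"
  shows "dd d (\<lambda>y. metric B i y v w) x = (v \<bullet> b) * (w \<bullet> b) * ((d \<bullet> b) * dd b E x)"
proof -
  have "dd d (\<lambda>y. metric B i y v w) x = dd d (\<lambda>y. (v \<bullet> b) * (w \<bullet> b) * E y) x"
    by (rule dd_cong[OF riemannianD(2)[OF B i] assms]) (rule metric_eq)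
  also have "\<dots> = (v \<bullet> b) * (w \<bullet> b) * dd d E x"
    by (rule dd_linear[OF bounded_linear_mult_right smooth_onD(3)[OF E_smooth assms]])
  finally show ?thesis using dd_b[OF smooth_onD(3)[OF E_smooth assms], of d] by simp
qed

text \<open>In dimension one the three terms of the Koszul formula coincide up to sign, and two of
  them cancel.\<close>

lemma christoffel_line:
  assumes x: "x \<in> cdom B i"
  shows "christoffel B i x v w = ((v \<bullet> b) * (w \<bullet> b) * dd b E x / (2 * E x)) *\<^sub>R b"
  unfolding christoffel_def
proof (rule the_equality)
  show "\<forall>z. 2 * metric B i x (((v \<bullet> b) * (w \<bullet> b) * dd b E x / (2 * E x)) *\<^sub>R b) z =
      dd v (\<lambda>y. metric B i y w z) x + dd w (\<lambda>y. metric B i y v z) x - dd z (\<lambda>y. metric B i y v w) x"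
    using E_pos[OF x] unfolding metric_eq[OF x] dd_metric[OF x] by (simp add: inner_b)
  fix u assume "\<forall>z. 2 * metric B i x u z =
      dd v (\<lambda>y. metric B i y w z) x + dd w (\<lambda>y. metric B i y v z) x - dd z (\<lambda>y. metric B i y v w) x"
  then have "2 * ((u \<bullet> b) * E x) = (v \<bullet> b) * (w \<bullet> b) * dd b E x"
    unfolding metric_eq[OF x] dd_metric[OF x] by (drule_tac spec[of _ b]) (simp add: inner_b)
  then have "u \<bullet> b = (v \<bullet> b) * (w \<bullet> b) * dd b E x / (2 * E x)"
    using E_pos[OF x] by (simp add: field_simps)
  then have "(u \<bullet> b) *\<^sub>R b = ((v \<bullet> b) * (w \<bullet> b) * dd b E x / (2 * E x)) *\<^sub>R b" by simp
  then show "u = ((v \<bullet> b) * (w \<bullet> b) * dd b E x / (2 * E x)) *\<^sub>R b"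
    by (rule trans[OF vec_eq])
qed

text \<open>An orthonormal frame is a single field \<open>a *\<^sub>R b\<close> with
  \<open>a * a * E = 1\<close>. The terms with the derivative of \<open>a\<close> from the
  connection and from applying the field twice cancel, so the frame enters only through
  \<open>a * a = 1 / E\<close>.\<close>

lemma frame_laplacian_line:
  assumes x: "x \<in> cdom B i" and u: "smooth_on (cdom B i) u" and e: "local_orthonormal_frame B i x e"
  shows "frame_laplacian B i e u x = laplacian_1d B b i u x"
proof -
  obtain W where W: "open W" "x \<in> W" "W \<subseteq> cdom B i" and es: "smooth_on W (e b)"
    and on: "\<And>y. y \<in> W \<Longrightarrow> metric B i y (e b y) (e b y) = 1"
    using e unfolding local_orthonormal_frame_def Basis_eq by auto
  define a where "a y = e b y \<bullet> b" for y
  have eb: "e b = (\<lambda>y. a y *\<^sub>R b)" unfolding a_def by (intro ext vec_eq)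
  have aE: "a y * a y * E y = 1" if "y \<in> W" for y
    using on[OF that] metric_eq[of y] that W(3) by (auto simp: a_def)
  have da: "a differentiable (at y)" if "y \<in> W" for y
    using smooth_onD(3)[OF es that] unfolding a_def differentiable_def
    using has_derivative_inner_left by blast
  have dE: "E differentiable (at y)" "u differentiable (at y)" "dd b u differentiable (at y)" if "y \<in> W" for y
    using smooth_onD(3)[OF E_smooth] smooth_onD(3)[OF u] smooth_onD(3)[OF smooth_onD(2)[OF u]] that W(3) by auto
  have deb: "dd d (e b) x = dd d a x *\<^sub>R b" for d
    unfolding eb by (rule dd_linear[OF bounded_linear_scaleR_left da[OF W(2)]])
  have "dd b (\<lambda>y. a y * a y * E y) x = dd b (\<lambda>y. 1) x"
    by (rule dd_cong[OF W(1,2) aE])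
  then have 1: "a x * a x * dd b E x + (a x * dd b a x + dd b a x * a x) * E x = 0"
    using dd_bilinear[OF bounded_bilinear_mult
        differentiable_bilinear[OF bounded_bilinear_mult da[OF W(2)] da[OF W(2)]] dE(1)[OF W(2)], of b]
      dd_bilinear[OF bounded_bilinear_mult da[OF W(2)] da[OF W(2)], of b] by simp
  have vf: "vf_apply (e b) u y = a y * dd b u y" if "y \<in> W" for y
    using dd_scaleR[OF dE(2)[OF that]] by (simp add: vf_apply_def eb)
  have "dd (e b x) (vf_apply (e b) u) x = dd (e b x) (\<lambda>y. a y * dd b u y) x"
    by (rule dd_cong[OF W(1,2) vf])
  also have "\<dots> = a x * dd b (\<lambda>y. a y * dd b u y) x"
    using dd_scaleR[OF differentiable_bilinear[OF bounded_bilinear_mult da dE(3), OF W(2) W(2)]]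
    by (simp add: eb)
  also have "dd b (\<lambda>y. a y * dd b u y) x = a x * dd b (dd b u) x + dd b a x * dd b u x"
    by (rule dd_bilinear[OF bounded_bilinear_mult da[OF W(2)] dE(3)[OF W(2)]])
  finally have vv: "vf_apply (e b) (vf_apply (e b) u) x = a x * (a x * dd b (dd b u) x + dd b a x * dd b u x)"
    by (simp only: vf_apply_def[of "e b" "vf_apply (e b) u" x])
  have dea: "dd (e b x) a x = a x * dd b a x"
    using dd_scaleR[OF da[OF W(2)]] by (simp add: eb)
  have "levi_civita B i (e b) (e b) x = (a x * dd b a x + a x * a x * dd b E x / (2 * E x)) *\<^sub>R b"
    unfolding levi_civita_def deb christoffel_line[OF x] dea by (simp add: eb inner_b algebra_simps)
  then have "vf_apply (levi_civita B i (e b) (e b)) u x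
      = (a x * dd b a x + a x * a x * dd b E x / (2 * E x)) * dd b u x"
    using dd_scaleR[OF dE(2)[OF W(2)]] by (simp add: vf_apply_def)
  with vv have L: "frame_laplacian B i e u x = (a x * a x) * (dd b E x * dd b u x / (2 * E x)) - (a x * a x) * dd b (dd b u) x"
    unfolding frame_laplacian_def Basis_eq by (simp add: algebra_simps)
  have Ex: "E x > 0" by (rule E_pos[OF x])
  have "a x * a x = 1 / E x" using aE[OF W(2)] Ex by (simp add: field_simps)
  then show ?thesis
    unfolding L laplacian_1d_def Let_def E_def[symmetric] by (simp add: power2_eq_square mult_ac)
qed

text \<open>Without a frame the definite description in \<open>laplacian\<close> would have no
  witness; normalizing the coordinate field provides one.\<close>

lemma exists_frame:
  assumes x: "x \<in> cdom B i"
  shows "\<exists>e. local_orthonormal_frame B i x e"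
proof -
  define a where "a y = E y powr (- 1/2)" for y
  have op: "open (cdom B i)" by (rule riemannianD(2)[OF B i])
  have sa: "smooth_on (cdom B i) a"
    unfolding a_def
  proof (rule smooth_on_compose[OF op _ E_smooth])
    show "smooth_on {0<..} (\<lambda>t::real. t powr (- 1/2))" by (simp add: smooth_on_def Ck_on_powr)
  qed (use E_pos in auto)
  have "smooth_on (cdom B i) (\<lambda>y. a y *\<^sub>R b)"
    using sa Ck_on_linear[OF op bounded_linear_scaleR_left] by (auto simp: smooth_on_def)
  moreover have "metric B i y (a y *\<^sub>R b) (a y *\<^sub>R b) = 1" if "y \<in> cdom B i" for y
  proof -
    have "a y * a y = E y powr (- 1)" unfolding a_def powr_add[symmetric] by simp
    then show ?thesis
      using E_pos[OF that] by (simp add: metric_eq[OF that] inner_b powr_minus_divide)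
  qed
  ultimately have "local_orthonormal_frame B i x (\<lambda>_ y. a y *\<^sub>R b)"
    unfolding local_orthonormal_frame_def Basis_eq using op x by (intro exI[of _ "cdom B i"]) auto
  then show ?thesis by blast
qed

end

text \<open>Let \<open>t\<close> be the derivative of the transition map, so that \<open>E\<close>
  is multiplied by \<open>t * t\<close>. The derivative of \<open>t\<close> enters through that of
  the metric and through the second derivative of \<open>f\<close>, and the two contributions
  cancel.\<close>

lemma laplacian_1d_chart_independent:
  assumes i: "i \<in> idx B" and k: "k \<in> idx B" and x: "x \<in> cdom B i" and y: "y \<in> cdom B k"
    and xy: "param B i x = param B k y" and f: "smooth_fun B f"
  shows "laplacian_1d B b k (f \<circ> param B k) y = laplacian_1d B b i (f \<circ> param B i) x"
proof -
  define W where "W = {y \<in> cdom B k. param B k y \<in> cimage B i}"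
  define \<tau> where "\<tau> = local_rep B B id k i"
  note hom = riemannianD(4)[OF B k] riemannianD(4)[OF B i]
  have W: "open W" "y \<in> W" "W \<subseteq> cdom B k"
  proof -
    obtain O' where O': "open O'" "cimage B i = pts B \<inter> O'"
      using riemannianD(3)[OF B i] by (auto simp: openin_open)
    have "param B k ` cdom B k \<subseteq> pts B"
      using riemannianD(1)[OF B] k by (auto simp: cimage_def)
    then have "W = cdom B k \<inter> param B k -` O'" by (auto simp: W_def O'(2))
    then show "open W"
      using continuous_open_preimage[OF _ riemannianD(2)[OF B k] O'(1)] hom(1) by (auto simp: homeomorphism_def)
    show "y \<in> W" using y x xy[symmetric] by (auto simp: W_def cimage_def)
  qed (auto simp: W_def)
  have \<tau>: "smooth_on W \<tau>" unfolding W_def \<tau>_def by (rule riemannianD(5)[OF B k i])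
  have \<tau>_eq: "\<tau> z = coord B i (param B k z)" for z by (simp add: \<tau>_def local_rep_def)
  have \<tau>_in: "\<tau> z \<in> cdom B i" "param B i (\<tau> z) = param B k z" if "z \<in> W" for z
    using that hom(2) by (auto simp: W_def \<tau>_eq homeomorphism_def)
  have \<tau>y: "\<tau> y = x"
    using hom(2) x unfolding \<tau>_eq xy[symmetric] by (auto simp: homeomorphism_def)
  define t where "t z = dd b \<tau> z \<bullet> b" for z
  define u where "u = f \<circ> param B i"
  define u' where "u' = f \<circ> param B k"
  define E1 where "E1 = (\<lambda>y. metric B i y b b)"
  define E2 where "E2 = (\<lambda>y. metric B k y b b)"
  have su: "smooth_on (cdom B i) u" using f i unfolding smooth_fun_def u_def by blast
  have sE: "smooth_on (cdom B i) E1" unfolding E1_def by (rule riemannianD(9)[OF B i])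
  have d\<tau>: "\<tau> differentiable (at z)" "t differentiable (at z)" if "z \<in> W" for z
  proof -
    show "\<tau> differentiable (at z)" by (rule smooth_onD(3)[OF \<tau> that])
    show "t differentiable (at z)"
      using smooth_onD(3)[OF smooth_onD(2)[OF \<tau>] that] unfolding t_def differentiable_def
      using has_derivative_inner_left by blast
  qed
  have chain: "dd b (\<lambda>z. g (\<tau> z)) z = t z * dd b g (\<tau> z)" "(\<lambda>z. g (\<tau> z)) differentiable (at z)"
    if "z \<in> W" "smooth_on (cdom B i) g" for g :: "'b \<Rightarrow> real" and z
  proof -
    have dg: "g differentiable (at (\<tau> z))" using smooth_onD(3)[OF that(2)] \<tau>_in(1)[OF that(1)] by blast
    then show "dd b (\<lambda>z. g (\<tau> z)) z = t z * dd b g (\<tau> z)"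
      using dd_compose[OF d\<tau>(1)[OF that(1)] dg, of b] dd_b[OF dg, of "dd b \<tau> z"] by (simp add: t_def)
    show "(\<lambda>z. g (\<tau> z)) differentiable (at z)"
      using differentiable_chain_at[OF d\<tau>(1)[OF that(1)] dg] by (simp add: o_def)
  qed
  have u': "dd b u' z = t z * dd b u (\<tau> z)" if "z \<in> W" for z
  proof -
    have "dd b u' z = dd b (\<lambda>z. u (\<tau> z)) z"
      by (rule dd_cong[OF W(1) that]) (simp add: u_def u'_def \<tau>_in(2))
    then show ?thesis using chain(1)[OF that su] by simp
  qed
  have u'': "dd b (dd b u') y = t y * (t y * dd b (dd b u) x) + dd b t y * dd b u x"
  proof -
    have "dd b (dd b u') y = dd b (\<lambda>z. t z * dd b u (\<tau> z)) y" by (rule dd_cong[OF W(1,2) u'])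
    also have "\<dots> = t y * dd b (\<lambda>z. dd b u (\<tau> z)) y + dd b t y * dd b u (\<tau> y)"
      by (rule dd_bilinear[OF bounded_bilinear_mult d\<tau>(2)[OF W(2)] chain(2)[OF W(2) smooth_onD(2)[OF su]]])
    finally show ?thesis using chain(1)[OF W(2) smooth_onD(2)[OF su]] by (simp add: \<tau>y)
  qed
  have E2: "E2 z = t z * t z * E1 (\<tau> z)" if "z \<in> W" for z
  proof -
    have "E2 z = metric B i (\<tau> z) (dd b \<tau> z) (dd b \<tau> z)"
      unfolding E2_def \<tau>_def by (rule riemannianD(10)[OF B k i]) (use that in \<open>auto simp: W_def\<close>)
    also have "\<dots> = (dd b \<tau> z \<bullet> b) * (dd b \<tau> z \<bullet> b) * E i (\<tau> z)"
      by (rule metric_eq[OF i \<tau>_in(1)[OF that]])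
    finally show ?thesis by (simp only: t_def E1_def E_def[OF i])
  qed
  have E2': "dd b E2 y = t y * t y * (t y * dd b E1 x) + 2 * (t y * dd b t y) * E1 x"
  proof -
    note dt = d\<tau>(2)[OF W(2)]
    have "dd b E2 y = dd b (\<lambda>z. t z * t z * E1 (\<tau> z)) y" by (rule dd_cong[OF W(1,2) E2])
    also have "\<dots> = t y * t y * dd b (\<lambda>z. E1 (\<tau> z)) y + dd b (\<lambda>z. t z * t z) y * E1 (\<tau> y)"
      by (rule dd_bilinear[OF bounded_bilinear_mult differentiable_bilinear[OF bounded_bilinear_mult dt dt] chain(2)[OF W(2) sE]])
    also have "dd b (\<lambda>z. t z * t z) y = t y * dd b t y + dd b t y * t y"
      by (rule dd_bilinear[OF bounded_bilinear_mult dt dt])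
    finally show ?thesis using chain(1)[OF W(2) sE] by (simp add: \<tau>y algebra_simps)
  qed
  have bn: "b \<noteq> 0" using inner_b by auto
  have E1x: "E1 x > 0" unfolding E1_def by (rule riemannianD(8)[OF B i x bn])
  have "E2 y > 0" unfolding E2_def by (rule riemannianD(8)[OF B k y bn])
  then have ty: "t y \<noteq> 0" using E2[OF W(2)] by auto
  have E2y: "E2 y = t y * t y * E1 x" using E2[OF W(2)] \<tau>y by simp
  have u'y: "dd b u' y = t y * dd b u x" using u'[OF W(2)] \<tau>y by simp
  \<comment> \<open>\<open>T\<close> and \<open>T'\<close> stand for \<open>t\<close> and its
    derivative, \<open>e\<close> and \<open>e'\<close> for the metric coefficient and its
    derivative, \<open>p\<close> and \<open>q\<close> for the first and second derivative of the
    function. Both fractions on the left acquire the same extra term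
    \<open>T' * p / (T * T * e)\<close>.\<close>
  have alg: "(T * T * (T * e') + 2 * (T * T') * e) * (T * p) / (2 * (T * T * e)\<^sup>2) - (T * (T * q) + T' * p) / (T * T * e)
      = e' * p / (2 * e\<^sup>2) - q / e" if "T \<noteq> 0" "e > 0" for T T' e e' p q :: real
  proof -
    have "(T * T * (T * e') + 2 * (T * T') * e) * (T * p) / (2 * (T * T * e)\<^sup>2) = e' * p / (2 * e\<^sup>2) + T' * p / (T * T * e)"
      using that by (simp add: field_simps power2_eq_square)
    moreover have "(T * (T * q) + T' * p) / (T * T * e) = q / e + T' * p / (T * T * e)"
      using that by (simp add: add_divide_distrib)
    ultimately show ?thesis by simp
  qed
  show ?thesis
    unfolding laplacian_1d_def Let_def u_def[symmetric] u'_def[symmetric] E1_def[symmetric] E2_def[symmetric]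
      E2' E2y u'' u'y by (rule alg[OF ty E1x])
qed

text \<open>Existence of a frame and independence of frame and chart together make the definite
  description in \<open>laplacian\<close> proper and evaluate it.\<close>

lemma laplacian_line:
  assumes i: "i \<in> idx B" and x: "x \<in> cdom B i" and f: "smooth_fun B f"
  shows "laplacian B f (param B i x) = laplacian_1d B b i (f \<circ> param B i) x"
  unfolding laplacian_def
proof (rule the_equality)
  have s: "smooth_on (cdom B k) (f \<circ> param B k)" if "k \<in> idx B" for k
    using f that unfolding smooth_fun_def by blast
  obtain e where "local_orthonormal_frame B i x e" using exists_frame[OF i x] ..
  then show "\<exists>k y e. k \<in> idx B \<and> y \<in> cdom B k \<and> param B k y = param B i x \<and>
      local_orthonormal_frame B k y e \<and>
      laplacian_1d B b i (f \<circ> param B i) x = frame_laplacian B k e (f \<circ> param B k) y"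
    using i x frame_laplacian_line[OF i x s[OF i]] by metis
  fix L assume "\<exists>k y e. k \<in> idx B \<and> y \<in> cdom B k \<and> param B k y = param B i x \<and>
      local_orthonormal_frame B k y e \<and> L = frame_laplacian B k e (f \<circ> param B k) y"
  then obtain k y e where k: "k \<in> idx B" "y \<in> cdom B k" "param B k y = param B i x"
    "local_orthonormal_frame B k y e" "L = frame_laplacian B k e (f \<circ> param B k) y"
    by blast
  then show "L = laplacian_1d B b i (f \<circ> param B i) x"
    using frame_laplacian_line[OF k(1,2) s[OF k(1)] k(4)]
      laplacian_1d_chart_independent[OF i k(1) x k(2) k(3)[symmetric] f] by simp
qed

end

section \<open>Product charts and the main result\<close>

lemma warped_product_sel:
  "pts (warped_product B f F) = pts B \<times> pts F"
  "idx (warped_product B f F) = idx B \<times> idx F"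
  "cdom (warped_product B f F) (i, k) = cdom B i \<times> cdom F k"
  "param (warped_product B f F) (i, k) (x, y) = (param B i x, param F k y)"
  "metric (warped_product B f F) (i, k) (x, y) (v, v') (w, w') =
     metric B i x v w + (f (param B i x))\<^sup>2 * metric F k y v' w'"
  by (simp_all add: warped_product_def)

lemma dd_fst:
  assumes "g differentiable (at (fst z))"
  shows "dd v (\<lambda>z. g (fst z)) z = dd (fst v) g (fst z)" "(\<lambda>z. g (fst z)) differentiable (at z)"
proof -
  have "((\<lambda>z. g (fst z)) has_derivative (\<lambda>v. dd (fst v) g (fst z))) (at z)"
    using has_derivative_compose[OF has_derivative_fst[OF has_derivative_ident, of "at z"], of g] assms
    by (simp add: frechet_derivative_works)
  then show "dd v (\<lambda>z. g (fst z)) z = dd (fst v) g (fst z)" "(\<lambda>z. g (fst z)) differentiable (at z)"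
    by (auto simp: dd_eqI differentiable_def)
qed

lemma dd_snd:
  assumes "g differentiable (at (snd z))"
  shows "dd v (\<lambda>z. g (snd z)) z = dd (snd v) g (snd z)" "(\<lambda>z. g (snd z)) differentiable (at z)"
proof -
  have "((\<lambda>z. g (snd z)) has_derivative (\<lambda>v. dd (snd v) g (snd z))) (at z)"
    using has_derivative_compose[OF has_derivative_snd[OF has_derivative_ident, of "at z"], of g] assms
    by (simp add: frechet_derivative_works)
  then show "dd v (\<lambda>z. g (snd z)) z = dd (snd v) g (snd z)" "(\<lambda>z. g (snd z)) differentiable (at z)"
    by (auto simp: dd_eqI differentiable_def)
qed

lemma dd_zero: "u differentiable (at x) \<Longrightarrow> dd 0 u x = 0"
  by (rule linear_0[OF linear_frechet_derivative])

theorem corollary4p13: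
  fixes B :: "('i, 'p::{t2_space,second_countable_topology}, 'b::euclidean_space) rmanifold"
    and F :: "('j, 'q::{t2_space,second_countable_topology}, 'c::euclidean_space) rmanifold"
    and f :: "'p \<Rightarrow> real"
    and \<psi> :: "'p \<times> 'q \<Rightarrow> complex ^ ('k + 2) ^ ('k::finite + 2)"
  assumes "riemannian_manifold B" and "riemannian_manifold F"
    and "smooth_fun B f" and "\<forall>p\<in>pts B. f p > 0"
    and "isometric_immersion (warped_product B f F) complex_quadric \<psi>"
    and "DIM('b \<times> 'c) = 2"
    and "totally_geodesic (warped_product B f F) complex_quadric \<psi>"
    and "tangent_in_V (warped_product B f F) \<psi>"
  shows "\<forall>(p, q)\<in>pts (warped_product B f F).
           real DIM('b) * 2 \<le> laplacian B f p / f p \<and>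
           laplacian B f p / f p \<le> real DIM('b) * 2"
proof -
  \<comment> \<open>Both dimensions are positive, so both are 1. The two bounds then coincide, and
    the claim becomes an equation.\<close>
  have "DIM('b) + DIM('c) = 2" using assms(6) by simp
  then have dims: "DIM('b) = 1" "DIM('c) = 1" using DIM_positive[where 'a='b] DIM_positive[where 'a='c] by linarith+
  obtain b :: 'b where b: "Basis = {b}" using dims(1) by (rule card_1_singletonE)
  obtain c :: 'c where c: "Basis = {c}" using dims(2) by (rule card_1_singletonE)
  interpret B: riemannian_line B b using assms(1) b by unfold_locales
  interpret F: riemannian_line F c using assms(2) c by unfold_locales
  define M where "M = warped_product B f F"
  have main: "laplacian B f p = 2 * f p \<and> f p > 0" if pq: "p \<in> pts B" "q \<in> pts F" for p q
  proof
    show fp: "f p > 0" using assms(4) pq(1) by blast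
    have "(p, q) \<in> pts M" using pq by (simp add: M_def warped_product_sel)
    moreover have "smooth_map M complex_quadric \<psi>"
      using assms(5) by (simp add: isometric_immersion_def M_def)
    \<comment> \<open>Smoothness supplies one pair of charts around the point. The remaining
      hypotheses on \<open>\<psi>\<close> are stated for all pairs of charts and are evaluated in
      this one.\<close>
    ultimately obtain ik j xy W where ik: "ik \<in> idx M" and j: "j \<in> idx complex_quadric"
      and xy: "param M ik xy = (p, q)" and W: "open W" "xy \<in> W" "W \<subseteq> cdom M ik"
      and im: "\<psi> ` param M ik ` W \<subseteq> cimage complex_quadric j"
      and sm: "smooth_on W (local_rep M complex_quadric \<psi> ik j)"
      unfolding smooth_map_def by blast
    obtain i k where ik_eq: "ik = (i, k)" by (cases ik)
    obtain x y where xy_eq: "xy = (x, y)" by (cases xy)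
    have i: "i \<in> idx B" and k: "k \<in> idx F"
      using ik by (auto simp: M_def warped_product_sel ik_eq)
    have Wd: "fst z \<in> cdom B i" "snd z \<in> cdom F k" if "z \<in> W" for z
      using W(3) that by (auto simp: M_def warped_product_sel ik_eq)
    have px: "param B i x = p" using xy by (simp add: M_def warped_product_sel ik_eq xy_eq)
    define \<phi> where "\<phi> = local_rep M complex_quadric \<psi> ik j"
    define \<sigma> where "\<sigma> = param complex_quadric j"
    define \<Psi> where "\<Psi> = (\<lambda>z. \<sigma> (\<phi> z))"
    interpret Q: embedded_chart "1/2" quadric_pts j
      using j by unfold_locales (simp_all add: complex_quadric_def)
    have N: "embedded_submanifold (1/2) quadric_pts = complex_quadric"
      by (simp add: complex_quadric_def)
    have im': "\<psi> (param M ik z) \<in> cimage complex_quadric j" if "z \<in> W" for z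
      using im that by blast
    have \<phi>_in: "\<phi> ` W \<subseteq> cdom complex_quadric j"
    proof safe
      fix z assume "z \<in> W"
      from im'[OF this] show "\<phi> z \<in> cdom complex_quadric j"
        using Q.homeo unfolding N by (auto simp: \<phi>_def local_rep_def homeomorphism_def)
    qed
    have s\<sigma>: "smooth_on (cdom complex_quadric j) \<sigma>" using Q.smooth unfolding N \<sigma>_def .
    note s\<phi> = sm[folded \<phi>_def]
    have s\<Psi>: "smooth_on W \<Psi>" unfolding \<Psi>_def by (rule smooth_on_compose[OF W(1) s\<sigma> s\<phi> \<phi>_in])
    have d\<phi>: "\<phi> differentiable (at z)" if "z \<in> W" for z by (rule smooth_onD(3)[OF s\<phi> that])
    have d\<Psi>: "dd v \<Psi> z = dd (dd v \<phi> z) \<sigma> (\<phi> z)" if "z \<in> W" for v z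
      unfolding \<Psi>_def using \<phi>_in that by (intro dd_compose d\<phi> smooth_onD(3)[OF s\<sigma>]) auto
    have Wc: "z \<in> cdom M ik" if "z \<in> W" for z using W(3) that by blast
    \<comment> \<open>The factor 2 undoes the factor \<open>1/2\<close> in the metric of the
      quadric.\<close>
    have metric: "dd v \<Psi> z \<bullet> dd w \<Psi> z = 2 * metric M ik z v w" if "z \<in> W" for v w z
    proof -
      have "metric M ik z v w = metric complex_quadric j (\<phi> z) (dd v \<phi> z) (dd w \<phi> z)"
        using assms(5) ik j Wc[OF that] im'[OF that] unfolding isometric_immersion_def M_def[symmetric] \<phi>_def
        by blast
      also have "\<dots> = 1 / 2 * (dd v \<Psi> z \<bullet> dd w \<Psi> z)"
        unfolding d\<Psi>[OF that] using Q.metric unfolding N \<sigma>_def by simp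
      finally show ?thesis by simp
    qed
    \<comment> \<open>The coordinate directions of \<open>B\<close> and \<open>F\<close> in the
      product chart; they are orthogonal for the warped metric, and the functions \<open>E\<close>
      and \<open>G\<close> below each depend on one coordinate only.\<close>
    define v where "v = (b, 0 :: 'c)"
    define w where "w = (0 :: 'b, c)"
    have vw: "a = (fst a \<bullet> b) *\<^sub>R v + (snd a \<bullet> c) *\<^sub>R w" for a
      using B.vec_eq[of "fst a"] F.vec_eq[of "snd a"] by (simp add: v_def w_def prod_eq_iff)
    define E where "E = (\<lambda>z :: 'b \<times> 'c. B.E i (fst z))"
    define u where "u = (\<lambda>z :: 'b \<times> 'c. (f \<circ> param B i) (fst z))"
    define G where "G = (\<lambda>z :: 'b \<times> 'c. F.E k (snd z))"
    have su: "smooth_on (cdom B i) (f \<circ> param B i)" using assms(3) i by (simp add: smooth_fun_def)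
    note sE = B.E_smooth[OF i] and sG = F.E_smooth[OF k]
    have mv: "metric M ik z v v = E z" "metric M ik z v w = 0" "metric M ik z w w = (u z * u z) * G z" if "z \<in> W" for z
    proof -
      obtain z1 z2 where z: "z = (z1, z2)" by (cases z)
      have zz: "z1 \<in> cdom B i" "z2 \<in> cdom F k" using Wd[OF that] by (auto simp: z)
      show "metric M ik z v v = E z" "metric M ik z v w = 0" "metric M ik z w w = (u z * u z) * G z"
        unfolding z M_def ik_eq v_def w_def warped_product_sel B.metric_eq[OF i zz(1)] F.metric_eq[OF k zz(2)]
        by (simp_all add: E_def G_def u_def B.inner_b F.inner_b power2_eq_square)
    qed
    have dB: "(f \<circ> param B i) differentiable (at (fst z))" "B.E i differentiable (at (fst z))"
      "dd b (f \<circ> param B i) differentiable (at (fst z))" "F.E k differentiable (at (snd z))" if "z \<in> W" for z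
      using smooth_onD(3)[OF su] smooth_onD(3)[OF sE] smooth_onD(3)[OF smooth_onD(2)[OF su]] smooth_onD(3)[OF sG] Wd[OF that]
      by auto
    have dE: "dd v E z = dd b (B.E i) (fst z)" "dd w E z = 0" "E differentiable (at z)" if "z \<in> W" for z
      using dd_fst[OF dB(2)[OF that]] dd_zero[OF dB(2)[OF that]] by (auto simp: E_def v_def w_def)
    have dG: "dd v G z = 0" "G differentiable (at z)" if "z \<in> W" for z
      using dd_snd[OF dB(4)[OF that]] dd_zero[OF dB(4)[OF that]] by (auto simp: G_def v_def)
    have du: "dd v u z = dd b (f \<circ> param B i) (fst z)" "u differentiable (at z)" if "z \<in> W" for z
      using dd_fst[OF dB(1)[OF that]] unfolding u_def v_def by auto
    have ddu: "dd v (dd v u) xy = dd b (dd b (f \<circ> param B i)) x" "dd v u differentiable (at xy)"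
    proof -
      have "dd v (dd v u) xy = dd v (\<lambda>z. dd b (f \<circ> param B i) (fst z)) xy"
        by (rule dd_cong[OF W(1,2) du(1)])
      then show "dd v (dd v u) xy = dd b (dd b (f \<circ> param B i)) x"
        using dd_fst(1)[OF dB(3)[OF W(2)]] by (simp add: v_def xy_eq)
      show "dd v u differentiable (at xy)"
        by (rule differentiable_cong_open[OF W(1,2) _ dd_fst(2)[OF dB(3)[OF W(2)]]]) (rule du(1)[symmetric])
    qed
    have x: "x \<in> cdom B i" "y \<in> cdom F k" using Wd[OF W(2)] by (auto simp: xy_eq)
    have pos: "E xy > 0" "u xy > 0" "G xy > 0"
      using B.E_pos[OF i x(1)] F.E_pos[OF k x(2)] fp by (simp_all add: E_def u_def G_def xy_eq px)
    obtain A where A: "A \<in> real_structures j (\<phi> xy)" "range (frechet_derivative \<phi> (at xy)) \<subseteq> V_of A"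
      using assms(8) ik j Wc[OF W(2)] im'[OF W(2)] unfolding tangent_in_V_def M_def[symmetric] \<phi>_def by blast
    \<comment> \<open>A vanishing second fundamental form says that the covariant derivative in the
      quadric is the image under \<open>d\<phi>\<close> of a Christoffel vector of the surface,
      which is a combination of \<open>v\<close> and \<open>w\<close>.\<close>
    have tg: "\<exists>d e. dd a (dd a' \<phi>) xy + christoffel complex_quadric j (\<phi> xy) (dd a \<phi> xy) (dd a' \<phi> xy)
        = dd (d *\<^sub>R v + e *\<^sub>R w) \<phi> xy" for a a'
    proof -
      have "second_fundamental_form M complex_quadric \<psi> ik j xy a a' = 0"
        using assms(7) ik j Wc[OF W(2)] im'[OF W(2)] unfolding totally_geodesic_def M_def[symmetric] by blast
      then have "dd a (dd a' \<phi>) xy + christoffel complex_quadric j (\<phi> xy) (dd a \<phi> xy) (dd a' \<phi> xy)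
          = dd (christoffel M ik xy a a') \<phi> xy"
        unfolding second_fundamental_form_def Let_def \<phi>_def[symmetric] by simp
      then show ?thesis using vw[of "christoffel M ik xy a a'"] by metis
    qed
    have nz: "dd v \<Psi> xy \<noteq> 0" "dd w \<Psi> xy \<noteq> 0"
      using metric[OF W(2), of v v] metric[OF W(2), of w w] mv[OF W(2)] pos by auto
    have ort: "dd v \<Psi> xy \<bullet> dd w \<Psi> xy = 0" using metric[OF W(2)] mv(2)[OF W(2)] by simp
    \<comment> \<open>The two open places are \<open>S \<bullet> Y = 0\<close> and
      \<open>T \<bullet> X = 0\<close>. They remain as premises, in the form in which
      \<open>warped_surface_equation\<close> expects its Gauss equations.\<close>
    note gauss = totally_geodesic_gauss[OF j W(1,2) s\<phi> \<phi>_in A tg, folded \<sigma>_def, folded \<Psi>_def,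
        OF refl nz(1) refl nz(2) ort refl _ refl _ refl]
    have "dd v E xy * dd v u xy / (2 * (E xy)\<^sup>2) - dd v (dd v u) xy / E xy = 2 * u xy"
      by (rule warped_surface_equation[OF W(1,2) s\<Psi> dE(3) du(2) ddu(2) dG(2) dE(2) dG(1) pos _ _ _
            refl refl refl refl refl gauss])
        (simp_all add: metric mv)
    then have "laplacian_1d B b i (f \<circ> param B i) x = 2 * f p"
      unfolding laplacian_1d_def Let_def B.E_def[OF i, symmetric] dE(1)[OF W(2)] du(1)[OF W(2)] ddu(1)
      by (simp add: E_def u_def xy_eq px)
    then show "laplacian B f p = 2 * f p"
      using B.laplacian_line[OF i x(1) assms(3)] px by simp
  qed
  show ?thesis
  proof (clarify, goal_cases)
    case (1 p q)
    then have "p \<in> pts B" "q \<in> pts F" by (auto simp: warped_product_sel)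
    from main[OF this] show ?case by (auto simp: dims)
  qed
qed

end
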